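(* For all $1\le r\le k$ and all $0\le t\le 1$, $$\mathbb{E}\bigl\langle I(\alpha\wedge\beta=r)\bigr\rangle=\mathbb{E}\,\Gamma^{\otimes2}\{\alpha\wedge\beta=r\}=m_r-m_{r-1},$$ where $\langle\cdot\rangle$ denotes the average of functions of $\bigl((\vec\sigma^1,\alpha),(\vec\sigma^2,\beta)\bigr)$ with respect to $\Gamma^{\otimes2}$ and $I$ denotes an indicator.
   Context: Setting. Let $N\ge1$, $\Sigma_N=\{-1,+1\}^N$, and for $\vec\sigma^1,\vec\sigma^2\in\Sigma_N$ let $R_{1,2}=\frac1N\sum_{i\le N}\sigma^1_i\sigma^2_i$. Let $\xi$ be a smooth convex function with $\xi(0)=0$, and let $(H_N(\vec\sigma))_{\vec\sigma\in\Sigma_N}$ be a centered Gaussian process with $\mathbb{E}H_N(\vec\sigma^1)H_N(\vec\sigma^2)=N\xi(R_{1,2})$. Let $k\ge1$, $0=m_0<m_1<\dots<m_k<1$ and $0=q_0<q_1<\dots<q_k<q_{k+1}=1$. Derrida-Ruelle cascade with parameters $m_1,\dots,m_k$: $(u_{n_1})_{n_1\ge1}$ is the decreasing enumeration of a Poisson point process on $(0,\infty)$ with intensity $x^{-1-m_1}dx$; recursively for $2\le l\le k$, for all $(n_1,\dots,n_{l-1})\in\mathbb{N}^{l-1}$, $(u_{n_1\dots n_{l-1}n_l})_{n_l\ge1}$ are (decreasing enumerations of) independent Poisson point processes with intensity $x^{-1-m_l}dx$, independent of all previously constructed processes. For $\alpha=(n_1,\dots,n_k)\in\mathbb{N}^k$,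 $v_\alpha=\prod_{1\le l\le k}u_{n_1\dots n_l}$ and $w_\alpha=v_\alpha/\sum_{\gamma\in\mathbb{N}^k} v_\gamma$ (the sum is a.s. finite). Gaussian process: let $z_{il}$ ($1\le i\le N$, $0\le l\le k$) be independent centered Gaussian with $\mathbb{E}z_{il}^2=\xi'(q_{l+1})-\xi'(q_l)$, and let $z_l=(z_{il})_{i\le N}$. Let $(z_{n_1})_{n_1\ge1}$ be i.i.d. copies of the column $z_1$ and, for $2\le l\le k$ and all $(n_1,\dots,n_{l-1})$, let $(z_{n_1\dots n_l})_{n_l\ge1}$ be independent sequences of i.i.d. copies of $z_l$, independent of everything constructed at earlier levels and of $z_0$. For $\alpha=(n_1,\dots,n_k)$ let $(z^\alpha_{il})$ be the matrix with columns $(z_0,z_{n_1},z_{n_1n_2},\dots,z_{n_1\dots n_k})$ (columns indexed by $l=0,\dots,k$; the column $z_0$ is common to all $\alpha$), and $s^\alpha=(s^\alpha_1,\dots,s^\alpha_N)$ with $s_i^\alpha=\sum_{0\le l\le k}z_{il}^\alpha$. The process $H_N$, the Gaussian columns and the cascade are mutually independent. For $\alpha,\beta\in\mathbb{N}^k$, $\alpha\wedge\beta=\min\{l\ge1:\alpha_l\ne\beta_l\}$ if $\alpha\ne\beta$, and $\alpha\wedge\beta=k+1$ if $\alpha=\beta$. For $0\le t\le1$ let $H_t(\vec\sigma,\alpha)=\sqrt t\,H_N(\vec\sigma)+\sqrt{1-t}\,s^\alpha\cdot\vec\sigma$, and let $\Gamma$ be the random Gibbs probability measure on $\Sigma_N\times\mathbb{N}^k$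 with $\Gamma\{(\vec\sigma,\alpha)\}$ proportional to $w_\alpha\exp H_t(\vec\sigma,\alpha)$. *)

theory Defs
  imports "HOL-Probability.Probability"
begin

definition spins :: "nat \<Rightarrow> (nat \<Rightarrow> real) set" where
  "spins N = {1..N} \<rightarrow>\<^sub>E {-1, 1}"

definition overlap :: "nat \<Rightarrow> (nat \<Rightarrow> real) \<Rightarrow> (nat \<Rightarrow> real) \<Rightarrow> real" where
  "overlap N \<sigma> \<tau> = (1 / real N) * (\<Sum>i=1..N. \<sigma> i * \<tau> i)"

definition smooth_fun :: "(real \<Rightarrow> real) \<Rightarrow> bool" where
  "smooth_fun f \<longleftrightarrow> (\<forall>n. (deriv ^^ n) f differentiable_on UNIV)"

text \<open>Mean and variance are the parameters; variance 0 gives the point mass, which is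
  needed because the variances \<open>\<xi>' (q (l + 1)) - \<xi>' (q l)\<close> may vanish.\<close>

definition normal_law :: "real \<Rightarrow> real \<Rightarrow> real measure" where
  "normal_law \<mu> v =
     (if v = 0 then return borel \<mu> else density lborel (normal_density \<mu> (sqrt v)))"

definition centered_gaussian_process :: "'w measure \<Rightarrow> 'i set \<Rightarrow> ('i \<Rightarrow> 'w \<Rightarrow> real) \<Rightarrow> bool" where
  "centered_gaussian_process M T X \<longleftrightarrow>
     (\<forall>i\<in>T. X i \<in> borel_measurable M) \<and>
     (\<forall>J c. finite J \<longrightarrow> J \<subseteq> T \<longrightarrow>
        (\<exists>v\<ge>0. distr M borel (\<lambda>\<omega>. \<Sum>i\<in>J. c i * X i \<omega>) = normal_law 0 v))"

text \<open>\<open>poisson_pmf\<close> of the library requires a positive finite rate; here the rates 0 and \<open>\<infinity>\<close> are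
  needed, the latter meaning that the variable is almost surely infinite.\<close>

definition poisson_distributed :: "'w measure \<Rightarrow> ('w \<Rightarrow> ennreal) \<Rightarrow> ennreal \<Rightarrow> bool" where
  "poisson_distributed M K r \<longleftrightarrow>
     K \<in> borel_measurable M \<and>
     (if r = \<infinity> then AE \<omega> in M. K \<omega> = \<infinity>
      else \<forall>j::nat. measure M {\<omega> \<in> space M. K \<omega> = of_nat j} = enn2real r ^ j / fact j * exp (- enn2real r))"

text \<open>Number of points, with multiplicity, that a sequence has in \<open>A\<close>.\<close>

definition point_count :: "(nat \<Rightarrow> real) \<Rightarrow> real set \<Rightarrow> ennreal" where
  "point_count x A = emeasure (count_space UNIV) {n. x n \<in> A}"

text \<open>The sequence \<open>x\<close> enumerates the points of a Poisson point process with intensity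
  measure \<open>\<mu>\<close>.\<close>

definition poisson_process :: "'w measure \<Rightarrow> real measure \<Rightarrow> (nat \<Rightarrow> 'w \<Rightarrow> real) \<Rightarrow> bool" where
  "poisson_process M \<mu> x \<longleftrightarrow>
     (\<forall>n. x n \<in> borel_measurable M) \<and>
     (\<forall>A\<in>sets borel. poisson_distributed M (\<lambda>\<omega>. point_count (\<lambda>n. x n \<omega>) A) (emeasure \<mu> A)) \<and>
     (\<forall>(I :: nat set) A. finite I \<longrightarrow> A ` I \<subseteq> sets borel \<longrightarrow> disjoint_family_on A I \<longrightarrow>
        prob_space.indep_vars M (\<lambda>_. borel) (\<lambda>i \<omega>. point_count (\<lambda>n. x n \<omega>) (A i)) I)"

definition stable_intensity :: "real \<Rightarrow> real measure" where
  "stable_intensity m =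
     density lborel (\<lambda>x. ennreal (indicator {0<..} x * x powr (-1 - m)))"

definition decreasing_poisson_enumeration ::
    "'w measure \<Rightarrow> real \<Rightarrow> (nat \<Rightarrow> 'w \<Rightarrow> real) \<Rightarrow> bool" where
  "decreasing_poisson_enumeration M m x \<longleftrightarrow>
     poisson_process M (stable_intensity m) x \<and>
     (AE \<omega> in M. (\<forall>n. 0 < x n \<omega>) \<and> decseq (\<lambda>n. x n \<omega>))"

text \<open>A node \<open>(n\<^sub>1, \<dots>, n\<^sub>l)\<close> of the tree is a list of length \<open>l\<close>, the root is \<open>[]\<close>,
  and sibling labels start at 0.\<close>

definition leaves :: "nat \<Rightarrow> nat list set" where
  "leaves k = {\<alpha>. length \<alpha> = k}"

text \<open>The families of children of distinct inner nodes, of all levels, are mutually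
  independent.\<close>

definition derrida_ruelle_cascade ::
    "'w measure \<Rightarrow> nat \<Rightarrow> (nat \<Rightarrow> real) \<Rightarrow> (nat list \<Rightarrow> 'w \<Rightarrow> real) \<Rightarrow> bool" where
  "derrida_ruelle_cascade M k m u \<longleftrightarrow>
     (\<forall>p. length p < k \<longrightarrow>
        decreasing_poisson_enumeration M (m (Suc (length p))) (\<lambda>n. u (p @ [n]))) \<and>
     prob_space.indep_vars M (\<lambda>_. Pi\<^sub>M UNIV (\<lambda>_. borel)) (\<lambda>p \<omega> n. u (p @ [n]) \<omega>) {p. length p < k}"

definition cascade_product :: "nat \<Rightarrow> (nat list \<Rightarrow> real) \<Rightarrow> nat list \<Rightarrow> real" where
  "cascade_product k u \<alpha> = (\<Prod>l=1..k. u (take l \<alpha>))"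

definition cascade_weight :: "nat \<Rightarrow> (nat list \<Rightarrow> real) \<Rightarrow> nat list \<Rightarrow> real" where
  "cascade_weight k u \<alpha> = cascade_product k u \<alpha> / (\<Sum>\<^sub>\<infinity>\<gamma>\<in>leaves k. cascade_product k u \<gamma>)"

definition split_level :: "nat \<Rightarrow> nat list \<Rightarrow> nat list \<Rightarrow> nat" where
  "split_level k \<alpha> \<beta> =
     (if \<alpha> = \<beta> then k + 1 else LEAST l. 1 \<le> l \<and> \<alpha> ! (l - 1) \<noteq> \<beta> ! (l - 1))"

text \<open>The node \<open>p\<close> of level \<open>l\<close> carries its own copy \<open>(z p i)\<close>, \<open>1 \<le> i \<le> N\<close>, of the column
  \<open>z\<^sub>l\<close>; the root carries the column \<open>z\<^sub>0\<close> common to all leaves.\<close>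

definition gaussian_columns ::
    "'w measure \<Rightarrow> nat \<Rightarrow> nat \<Rightarrow> (real \<Rightarrow> real) \<Rightarrow> (nat \<Rightarrow> real) \<Rightarrow> (nat list \<Rightarrow> nat \<Rightarrow> 'w \<Rightarrow> real) \<Rightarrow> bool"
  where
  "gaussian_columns M N k \<xi> q z \<longleftrightarrow>
     prob_space.indep_vars M (\<lambda>_. borel) (\<lambda>(p, i). z p i) ({p. length p \<le> k} \<times> {1..N}) \<and>
     (\<forall>p i. length p \<le> k \<longrightarrow> i \<in> {1..N} \<longrightarrow>
        distr M borel (z p i) =
          normal_law 0 (deriv \<xi> (q (Suc (length p))) - deriv \<xi> (q (length p))))"

text \<open>The vector \<open>s\<^sup>\<alpha>\<close>.\<close>

definition leaf_field :: "nat \<Rightarrow> (nat list \<Rightarrow> nat \<Rightarrow> real) \<Rightarrow> nat list \<Rightarrow> nat \<Rightarrow> real" where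
  "leaf_field k z \<alpha> i = (\<Sum>l=0..k. z (take l \<alpha>) i)"

definition generated_events :: "'w measure \<Rightarrow> 'i set \<Rightarrow> ('i \<Rightarrow> 'w \<Rightarrow> real) \<Rightarrow> 'w set set" where
  "generated_events M T X =
     sigma_sets (space M) {X i -` A \<inter> space M | i A. i \<in> T \<and> A \<in> sets borel}"

definition independent_sources ::
    "'w measure \<Rightarrow> nat \<Rightarrow> nat \<Rightarrow> ((nat \<Rightarrow> real) \<Rightarrow> 'w \<Rightarrow> real) \<Rightarrow> (nat list \<Rightarrow> nat \<Rightarrow> 'w \<Rightarrow> real) \<Rightarrow>
      (nat list \<Rightarrow> 'w \<Rightarrow> real) \<Rightarrow> bool" where
  "independent_sources M N k H z u \<longleftrightarrow>
     prob_space.indep_sets M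
       ((!) [generated_events M (spins N) H,
             generated_events M ({p. length p \<le> k} \<times> {1..N}) (\<lambda>(p, i). z p i),
             generated_events M {p. 1 \<le> length p \<and> length p \<le> k} u])
       {0, 1, 2}"

text \<open>From here on \<open>h\<close>, \<open>z\<close>, \<open>u\<close> are realizations of the random objects.\<close>

definition hamiltonian ::
    "nat \<Rightarrow> nat \<Rightarrow> real \<Rightarrow> ((nat \<Rightarrow> real) \<Rightarrow> real) \<Rightarrow> (nat list \<Rightarrow> nat \<Rightarrow> real) \<Rightarrow>
      (nat \<Rightarrow> real) \<Rightarrow> nat list \<Rightarrow> real" where
  "hamiltonian N k t h z \<sigma> \<alpha> =
     sqrt t * h \<sigma> + sqrt (1 - t) * (\<Sum>i=1..N. leaf_field k z \<alpha> i * \<sigma> i)"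

definition gibbs_weight ::
    "nat \<Rightarrow> nat \<Rightarrow> real \<Rightarrow> ((nat \<Rightarrow> real) \<Rightarrow> real) \<Rightarrow> (nat list \<Rightarrow> nat \<Rightarrow> real) \<Rightarrow> (nat list \<Rightarrow> real) \<Rightarrow>
      (nat \<Rightarrow> real) \<times> nat list \<Rightarrow> real" where
  "gibbs_weight N k t h z u = (\<lambda>(\<sigma>, \<alpha>). cascade_weight k u \<alpha> * exp (hamiltonian N k t h z \<sigma> \<alpha>))"

definition gibbs_measure ::
    "nat \<Rightarrow> nat \<Rightarrow> real \<Rightarrow> ((nat \<Rightarrow> real) \<Rightarrow> real) \<Rightarrow> (nat list \<Rightarrow> nat \<Rightarrow> real) \<Rightarrow> (nat list \<Rightarrow> real) \<Rightarrow>
      ((nat \<Rightarrow> real) \<times> nat list) measure" where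
  "gibbs_measure N k t h z u =
     point_measure (spins N \<times> leaves k)
       (\<lambda>x. ennreal (gibbs_weight N k t h z u x /
          (\<Sum>\<^sub>\<infinity>y\<in>spins N \<times> leaves k. gibbs_weight N k t h z u y)))"

definition replica_average :: "'a measure \<Rightarrow> ('a \<times> 'a \<Rightarrow> real) \<Rightarrow> real" where
  "replica_average \<Gamma> f = (\<integral>x. f x \<partial>(\<Gamma> \<Otimes>\<^sub>M \<Gamma>))"

end

theory Submission
  imports Defs "HOL-Real_Asymp.Real_Asymp"
begin

text \<open>Write \<open>W\<^sub>\<alpha>\<close> for the unnormalized Gibbs mass of the leaf \<open>\<alpha>\<close> and \<open>Z\<close> for the sum of all \<open>W\<^sub>\<alpha>\<close>.
  It suffices to show \<open>E (Y / Z\<^sup>2) = 1 - m\<^sub>J\<close>, where \<open>Y\<close> is the sum over the nodes of level \<open>J\<close> of the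
  squared masses of their subtrees: the event \<open>\<alpha> \<and> \<beta> = r\<close> is the difference of the events that
  the two leaves agree up to level \<open>r - 1\<close> and up to level \<open>r\<close>. For a fixed state at the root, the Laplace
  functional of the Poisson process and the scaling of \<open>x\<^bsup>-1-m\<^esup> dx\<close> give, by recursion from the leaves,
  \<open>E exp (- \<lambda> Z - \<epsilon> \<lambda>\<^sup>2 Y) = exp (- \<lambda>\<^bsup>m\<^sub>1\<^esup> \<rho>(\<epsilon>)\<^bsup>m\<^sub>1/m\<^sub>J\<^esup> C)\<close>. Here only the constant \<open>C\<close> depends on the
  Gaussian field, while \<open>\<rho>(\<epsilon>) = c(\<epsilon>) / c(0)\<close> with \<open>c(\<epsilon>) = \<integral> (1 - exp (- x - \<epsilon> x\<^sup>2)) x\<^bsup>-1-m\<^sub>J\<^esup> dx\<close>, so that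
  \<open>\<rho>'(0) = m\<^sub>J (1 - m\<^sub>J)\<close>. Differentiating at \<open>\<epsilon> = 0\<close> and integrating against \<open>d\<lambda> / \<lambda>\<close> removes \<open>C\<close>.\<close>

section \<open>The exponential on the extended half-line and Poisson processes\<close>

text \<open>Two obstacles shape the proof. The joint transform has to reproduce itself from level to
  level. The factor \<lambda>^2 in front of \<open>Y\<close> achieves this: \<lambda> then only
  rescales the points, and stable intensities are homogeneous. At level \<open>J\<close> the
  perturbation is quadratic in the random mass \<open>P\<close> of a subtree; the scaling by
  \<open>P\<close> extracts \<rho>(\<epsilon>) for every value of \<open>P\<close>, hence
  independently of its law. Above level \<open>J\<close>, \<rho>(\<epsilon>) is a deterministic
  factor that each level raises to the quotient of two consecutive exponents. The final constant is
  the product of \<open>m_1 / m_J\<close>, of \<rho>'(0), and of the value \<open>1 / m_1\<close> of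
  the integral over \<lambda>. The second obstacle is that the convergence of \<open>Z\<close> is
  itself a conclusion, drawn from the transform as \<lambda> tends to 0. All sums and transforms
  therefore take values in [0, \<infinity>], and real numbers appear only once almost sure
  finiteness is available. The root column and \<open>H_N\<close>, which are common to all leaves,
  are averaged only at the end, when the expected ratio no longer depends on them.\<close>

text \<open>The map \<open>exp (- a)\<close> on [0, \<infinity>]. The case \<open>\<top>\<close> is
  separate because \<open>enn2real \<top>\<close> is 0, which would give the value 1.\<close>

definition nexp :: "ennreal \<Rightarrow> ennreal" where
  "nexp a = (if a = \<top> then 0 else ennreal (exp (- enn2real a)))"

text \<open>The inverse of \<open>nexp\<close> on [0, 1]. It writes an infinite product of Laplace
  transforms as \<open>nexp\<close> of an infinite sum, which always exists.\<close>

definition nlog :: "ennreal \<Rightarrow> ennreal" where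
  "nlog v = (if v = 0 then \<top> else ennreal (- ln (enn2real v)))"

lemma nexp_0 [simp]: "nexp 0 = 1" and nexp_top [simp]: "nexp \<top> = 0"
  by (simp_all add: nexp_def)

lemma nexp_ennreal: "0 \<le> r \<Longrightarrow> nexp (ennreal r) = ennreal (exp (- r))"
  by (simp add: nexp_def)

lemma nexp_le_1: "nexp a \<le> 1"
  by (auto simp: nexp_def simp flip: ennreal_1 intro!: ennreal_leI)

lemma nexp_less_top [simp]: "nexp a < \<top>"
  using nexp_le_1[of a] by (simp add: le_less_trans)

lemma nexp_ne_top [simp]: "nexp a \<noteq> \<top>"
  using nexp_less_top[of a] by (simp add: less_top)

lemma nexp_add: "nexp (a + b) = nexp a * nexp b"
  by (cases a; cases b)
    (auto simp: nexp_ennreal mult_exp_exp ennreal_mult[symmetric] simp flip: ennreal_plus)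

lemma nexp_sum: "nexp (\<Sum>i\<in>I. a i) = (\<Prod>i\<in>I. nexp (a i))"
  by (induction I rule: infinite_finite_induct) (auto simp: nexp_add)

lemma nexp_antimono: "a \<le> b \<Longrightarrow> nexp b \<le> nexp a"
  by (cases a; cases b) (auto simp: nexp_ennreal top_unique intro!: ennreal_leI)

lemma nexp_less_1: "0 < a \<Longrightarrow> nexp a < 1"
  by (cases a) (auto simp: nexp_ennreal ennreal_less_one_iff)

lemma measurable_nexp [measurable]: "nexp \<in> borel_measurable borel"
  unfolding nexp_def[abs_def] by measurable

lemma measurable_nlog [measurable]: "nlog \<in> borel_measurable borel"
  unfolding nlog_def[abs_def] by measurable

lemma nexp_nlog: "v \<le> 1 \<Longrightarrow> nexp (nlog v) = v"
  by (cases v) (auto simp: nlog_def nexp_ennreal ennreal_le_1 ln_le_zero_iff ennreal_eq_0_iff top_unique)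

text \<open>Continuity includes the point \<open>\<top>\<close>, so divergent sums pass to the limit
  as well; near a finite limit \<open>f\<close> is eventually finite and the real exponential
  applies.\<close>

lemma tendsto_nexp:
  assumes "(f \<longlongrightarrow> a) F"
  shows "((\<lambda>x. nexp (f x)) \<longlongrightarrow> nexp a) F"
proof (cases a)
  case (real r)
  have fin: "eventually (\<lambda>x. f x < \<top>) F"
    using assms real by (intro order_tendstoD(2)) auto
  have "((\<lambda>x. enn2real (f x)) \<longlongrightarrow> enn2real a) F"
    using tendsto_enn2real[of f r F] assms real by simp
  then have "((\<lambda>x. ennreal (exp (- enn2real (f x)))) \<longlongrightarrow> ennreal (exp (- enn2real a))) F"
    by (intro tendsto_ennrealI tendsto_exp tendsto_minus)
  moreover have "eventually (\<lambda>x. ennreal (exp (- enn2real (f x))) = nexp (f x)) F"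
    using fin by eventually_elim (auto simp: nexp_def)
  ultimately show ?thesis
    using real by (subst (asm) tendsto_cong) (auto simp: nexp_def)
next
  case top
  show ?thesis
  proof (rule order_tendstoI)
    fix y assume "nexp a < y"
    with top have "0 < y" by simp
    then obtain w where w: "0 < w" "w < y" using dense by blast
    then obtain e where e: "0 < e" "ennreal e < y"
      by (cases w) auto
    \<comment> \<open>The threshold is cut off at 0 so that \<open>nexp_ennreal\<close> applies to
      it; above it \<open>nexp (f x)\<close> is at most \<open>e\<close>.\<close>
    have "eventually (\<lambda>x. ennreal (max 0 (- ln e)) < f x) F"
      using assms top by (intro order_tendstoD(1)) auto
    then show "eventually (\<lambda>x. nexp (f x) < y) F"
    proof eventually_elim
      case (elim x)
      have "nexp (f x) \<le> nexp (ennreal (max 0 (- ln e)))"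
        using elim by (intro nexp_antimono) auto
      also have "\<dots> \<le> ennreal e"
      proof -
        have "exp (- max 0 (- ln e)) \<le> exp (ln e)" by simp
        moreover have "nexp (ennreal (max 0 (- ln e))) = ennreal (exp (- max 0 (- ln e)))"
          by (rule nexp_ennreal) simp
        ultimately show ?thesis using e(1) by (simp only:) (rule ennreal_leI, simp)
      qed
      finally show ?case using e(2) by simp
    qed
  next
    fix y assume "y < nexp a" with top show "eventually (\<lambda>x. y < nexp (f x)) F" by simp
  qed
qed

lemma nn_integral_le_1:
  assumes "prob_space M" "\<And>x. f x \<le> 1"
  shows "(\<integral>\<^sup>+x. f x \<partial>M) \<le> 1"
proof -
  interpret prob_space M by fact
  have "(\<integral>\<^sup>+x. f x \<partial>M) \<le> (\<integral>\<^sup>+x. 1 \<partial>M)" by (intro nn_integral_mono assms)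
  then show ?thesis by (simp add: emeasure_space_1)
qed

lemma nn_integral_one_minus:
  assumes "prob_space M" "f \<in> borel_measurable M" "\<And>x. f x \<le> 1"
  shows "(\<integral>\<^sup>+x. 1 - f x \<partial>M) = 1 - (\<integral>\<^sup>+x. f x \<partial>M)"
proof -
  interpret prob_space M by fact
  have "(\<integral>\<^sup>+x. f x \<partial>M) < \<top>"
    using nn_integral_le_1[of M f] assms by (simp add: le_less_trans)
  then show ?thesis
    using assms by (subst nn_integral_diff) (auto simp: emeasure_space_1)
qed

lemma tendsto_nn_integral_bounded:
  assumes "prob_space M" "\<And>i. f i \<in> borel_measurable M" "g \<in> borel_measurable M"
    and "\<And>i x. f i x \<le> 1" "AE x in M. (\<lambda>i. f i x) \<longlonglongrightarrow> g x"
  shows "(\<lambda>i. \<integral>\<^sup>+x. f i x \<partial>M) \<longlonglongrightarrow> (\<integral>\<^sup>+x. g x \<partial>M)"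
proof -
  interpret prob_space M by fact
  show ?thesis
    using assms by (intro nn_integral_dominated_convergence[where w="\<lambda>_. 1"])
      (auto simp: emeasure_space_1)
qed

lemma suminf_tendsto_ennreal: "(\<lambda>n. \<Sum>i<n. f i) \<longlonglongrightarrow> (\<Sum>i. f i :: ennreal)"
  by (rule summable_LIMSEQ) simp

lemma (in prob_space) nn_integral_nexp_sum:
  fixes A :: "'i \<Rightarrow> 'a \<Rightarrow> ennreal"
  assumes "indep_vars (\<lambda>_. borel) A I" "finite I"
  shows "(\<integral>\<^sup>+x. nexp (\<Sum>i\<in>I. c i * A i x) \<partial>M) = (\<Prod>i\<in>I. \<integral>\<^sup>+x. nexp (c i * A i x) \<partial>M)"
proof -
  have "indep_vars (\<lambda>_. borel) (\<lambda>i x. nexp (c i * A i x)) I"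
    by (rule indep_vars_compose2[OF assms(1)]) auto
  then show ?thesis
    unfolding nexp_sum by (rule indep_vars_nn_integral[OF assms(2)]) simp
qed

text \<open>For finitely many terms independence factorizes the expectation; the bound 1 permits the
  limit without knowing whether the series converges.\<close>

lemma (in prob_space) nn_integral_nexp_suminf:
  fixes A :: "nat \<Rightarrow> 'a \<Rightarrow> ennreal"
  assumes "indep_vars (\<lambda>_. borel) A UNIV"
  shows "(\<integral>\<^sup>+x. nexp (\<Sum>n. A n x) \<partial>M) = nexp (\<Sum>n. nlog (\<integral>\<^sup>+x. nexp (A n x) \<partial>M))"
proof -
  have [measurable]: "A n \<in> borel_measurable M" for n
    using assms by (auto simp: indep_vars_def)
  have "(\<lambda>N. \<integral>\<^sup>+x. nexp (\<Sum>n<N. A n x) \<partial>M) \<longlonglongrightarrow> (\<integral>\<^sup>+x. nexp (\<Sum>n. A n x) \<partial>M)"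
    by (intro tendsto_nn_integral_bounded prob_space_axioms nexp_le_1)
      (auto intro!: tendsto_nexp suminf_tendsto_ennreal)
  moreover have "(\<integral>\<^sup>+x. nexp (\<Sum>n<N. A n x) \<partial>M) = nexp (\<Sum>n<N. nlog (\<integral>\<^sup>+x. nexp (A n x) \<partial>M))" for N
  proof -
    have "(\<integral>\<^sup>+x. nexp (\<Sum>n<N. A n x) \<partial>M) = (\<Prod>n<N. \<integral>\<^sup>+x. nexp (A n x) \<partial>M)"
      using nn_integral_nexp_sum[OF indep_vars_subset[OF assms], of "{..<N}" "\<lambda>_. 1"] by simp
    also have "\<dots> = (\<Prod>n<N. nexp (nlog (\<integral>\<^sup>+x. nexp (A n x) \<partial>M)))"
      by (intro prod.cong refl nexp_nlog[symmetric] nn_integral_le_1 prob_space_axioms nexp_le_1)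
    finally show ?thesis by (simp add: nexp_sum)
  qed
  moreover have "(\<lambda>N. nexp (\<Sum>n<N. nlog (\<integral>\<^sup>+x. nexp (A n x) \<partial>M))) \<longlonglongrightarrow>
      nexp (\<Sum>n. nlog (\<integral>\<^sup>+x. nexp (A n x) \<partial>M))"
    by (intro tendsto_nexp suminf_tendsto_ennreal)
  ultimately show ?thesis
    using LIMSEQ_unique by simp
qed

section \<open>The Laplace functional of a Poisson process\<close>

text \<open>For finite \<open>r\<close> the expansion over the values of \<open>K\<close> is the
  exponential series, to which the value \<open>\<top>\<close> contributes 0. For
  \<open>r = \<infinity>\<close> both sides vanish once \<open>c > 0\<close>, whereas
  \<open>c = 0\<close> gives 1 on both sides by the convention
  \<open>0 * \<infinity> = 0\<close>.\<close>

lemma poisson_distributed_nexp: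
  assumes "prob_space M" "poisson_distributed M K r" "c \<noteq> \<top>"
    and Kr: "\<And>x. K x \<in> insert \<top> (range of_nat)"
  shows "(\<integral>\<^sup>+x. nexp (c * K x) \<partial>M) = nexp ((1 - nexp c) * r)"
proof -
  interpret prob_space M by fact
  have [measurable]: "K \<in> borel_measurable M"
    using assms(2) by (simp add: poisson_distributed_def)
  show ?thesis
  proof (cases "c = 0")
    case True then show ?thesis by (simp add: emeasure_space_1)
  next
    case c: False
    show ?thesis
    proof (cases r)
      case top
      have "0 < 1 - nexp c"
        using nexp_less_1[of c] c by (intro diff_gr0_ennreal) (simp add: zero_less_iff_neq_zero)
      then have rhs: "nexp ((1 - nexp c) * r) = 0"
        using top by (simp add: ennreal_mult_eq_top_iff)
      have "AE x in M. K x = \<top>"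
        using assms(2) top by (simp add: poisson_distributed_def)
      then have "AE x in M. nexp (c * K x) = 0"
        by eventually_elim (use c in \<open>simp add: ennreal_mult_eq_top_iff\<close>)
      then show ?thesis using rhs by (simp add: nn_integral_0_iff_AE)
    next
      case (real \<rho>)
      obtain d where d: "c = ennreal d" "0 \<le> d" using assms(3) by (cases c) auto
      define S where "S j = {x \<in> space M. K x = of_nat j}" for j
      have S[measurable]: "S j \<in> sets M" for j unfolding S_def by measurable
      have meas: "measure M (S j) = \<rho> ^ j / fact j * exp (- \<rho>)" for j
        using assms(2) real by (simp add: poisson_distributed_def S_def)
      have pt: "nexp (c * K x) = (\<Sum>j. ennreal (exp (- d) ^ j) * indicator (S j) x)" if "x \<in> space M" for x
      proof (cases "K x = \<top>")
        case True
        then show ?thesis using c by (simp add: ennreal_mult_eq_top_iff S_def)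
      next
        case False
        then obtain j where j: "K x = of_nat j" using Kr[of x] by auto
        have "(\<Sum>i. ennreal (exp (- d) ^ i) * indicator (S i) x) =
            (\<Sum>i\<in>{j}. ennreal (exp (- d) ^ i) * indicator (S i) x)"
          by (rule suminf_finite) (auto simp: S_def j that)
        also have "\<dots> = ennreal (exp (- d) ^ j)" using that j by (simp add: S_def)
        also have "\<dots> = nexp (c * K x)"
          using d by (simp add: j ennreal_of_nat_eq_real_of_nat ennreal_mult[symmetric] nexp_ennreal
              exp_of_nat_mult[symmetric] mult.commute)
        finally show ?thesis ..
      qed
      have "(\<integral>\<^sup>+x. nexp (c * K x) \<partial>M) = (\<integral>\<^sup>+x. (\<Sum>j. ennreal (exp (- d) ^ j) * indicator (S j) x) \<partial>M)"
        by (intro nn_integral_cong pt)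
      also have "\<dots> = (\<Sum>j. ennreal (exp (- d) ^ j) * emeasure M (S j))"
        by (subst nn_integral_suminf) (auto simp: nn_integral_cmult_indicator)
      also have "\<dots> = (\<Sum>j. ennreal ((exp (- d) * \<rho>) ^ j / fact j * exp (- \<rho>)))"
        using real by (intro suminf_cong)
          (auto simp: emeasure_eq_measure meas power_mult_distrib ennreal_mult[symmetric] field_simps)
      also have "\<dots> = ennreal (exp (exp (- d) * \<rho>) * exp (- \<rho>))"
        using real exp_converges[of "exp (- d) * \<rho>"]
        by (intro suminf_ennreal_eq sums_mult2) (auto simp: field_simps scaleR_conv_of_real)
      also have "\<dots> = nexp ((1 - nexp c) * r)"
      proof -
        have "(1 - nexp c) * r = ennreal ((1 - exp (- d)) * \<rho>)"
          using real d by (simp add: nexp_ennreal ennreal_minus ennreal_mult flip: ennreal_1)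
        moreover have "0 \<le> (1 - exp (- d)) * \<rho>" using real d by simp
        ultimately have "nexp ((1 - nexp c) * r) = ennreal (exp (- ((1 - exp (- d)) * \<rho>)))"
          by (simp only: nexp_ennreal)
        then show ?thesis
          by (simp add: mult_exp_exp algebra_simps)
      qed
      finally show ?thesis .
    qed
  qed
qed

text \<open>For a simple function the sum over the points is a finite combination of counts in
  disjoint sets, which are independent Poisson variables. Increasing approximation gives the general
  case: monotone convergence in the sum and in the intensity integral, bounded convergence in the
  expectation.\<close>

lemma poisson_process_laplace:
  fixes f :: "real \<Rightarrow> ennreal"
  assumes "prob_space M" "poisson_process M \<mu> x" "sets \<mu> = sets borel"
    and f [measurable]: "f \<in> borel_measurable borel"
  shows "(\<integral>\<^sup>+\<omega>. nexp (\<Sum>n. f (x n \<omega>)) \<partial>M) = nexp (\<integral>\<^sup>+y. 1 - nexp (f y) \<partial>\<mu>)"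
proof -
  interpret prob_space M by fact
  note assms(3)[measurable_cong]
  have [measurable]: "x n \<in> borel_measurable M" for n
    using assms(2) by (simp add: poisson_process_def)
  have simple: "(\<integral>\<^sup>+\<omega>. nexp (\<Sum>n. g (x n \<omega>)) \<partial>M) = nexp (\<integral>\<^sup>+y. 1 - nexp (g y) \<partial>\<mu>)"
    if g: "simple_function borel g" and gfin: "\<And>y. g y < \<top>" for g :: "real \<Rightarrow> ennreal"
  proof -
    define A where "A c = g -` {c}" for c
    have gm[measurable]: "g \<in> borel_measurable borel" using g by (rule borel_measurable_simple_function)
    have A[measurable]: "A c \<in> sets borel" for c
      unfolding A_def using measurable_sets[OF gm, of "{c}"] by simp
    have fin: "finite (range g)" using g by (simp add: simple_function_def)
    \<comment> \<open>\<open>poisson_process\<close> states the independence of counts for families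
      indexed by natural numbers, hence the enumeration of the values.\<close>
    obtain b where b: "bij_betw b {..<card (range g)} (range g)"
      using ex_bij_betw_nat_finite[OF fin] by (auto simp: atLeast0LessThan)
    let ?I = "{..<card (range g)}"
    have dec: "h (g y) = (\<Sum>i\<in>?I. h (b i) * indicator (A (b i)) y)" for y and h :: "ennreal \<Rightarrow> ennreal"
    proof -
      have "(\<Sum>i\<in>?I. h (b i) * indicator (A (b i)) y) = (\<Sum>c\<in>range g. h c * indicator (A c) y)"
        by (rule sum.reindex_bij_betw[OF b])
      also have "\<dots> = (\<Sum>c\<in>range g. if c = g y then h c else 0)"
        by (intro sum.cong) (auto simp: A_def)
      also have "\<dots> = h (g y)" using fin by (simp add: sum.delta)
      finally show ?thesis ..
    qed
    have disj: "disjoint_family_on (\<lambda>i. A (b i)) ?I"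
      using b by (auto simp: disjoint_family_on_def A_def bij_betw_def inj_on_def)
    have count: "(\<Sum>n. g (x n \<omega>)) = (\<Sum>i\<in>?I. b i * point_count (\<lambda>n. x n \<omega>) (A (b i)))" for \<omega>
    proof -
      have "(\<Sum>n. g (x n \<omega>)) = (\<integral>\<^sup>+n. (\<Sum>i\<in>?I. b i * indicator (A (b i)) (x n \<omega>)) \<partial>count_space UNIV)"
        by (subst dec[of id, simplified]) (simp add: nn_integral_count_space_nat)
      also have "\<dots> = (\<Sum>i\<in>?I. b i * (\<integral>\<^sup>+n. indicator (A (b i)) (x n \<omega>) \<partial>count_space UNIV))"
        by (subst nn_integral_sum) (auto simp: nn_integral_cmult)
      also have "\<dots> = (\<Sum>i\<in>?I. b i * point_count (\<lambda>n. x n \<omega>) (A (b i)))"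
      proof (intro sum.cong refl arg_cong2[where f="(*)"])
        fix i
        show "(\<integral>\<^sup>+n. indicator (A (b i)) (x n \<omega>) \<partial>count_space UNIV) = point_count (\<lambda>n. x n \<omega>) (A (b i))"
          using nn_integral_indicator[of "{n. x n \<omega> \<in> A (b i)}" "count_space UNIV"]
          by (simp add: point_count_def indicator_def)
      qed
      finally show ?thesis .
    qed
    have ind: "indep_vars (\<lambda>_. borel) (\<lambda>i \<omega>. point_count (\<lambda>n. x n \<omega>) (A (b i))) ?I"
      using assms(2)[unfolded poisson_process_def, THEN conjunct2, THEN conjunct2, rule_format,
          of ?I "\<lambda>i. A (b i)"] disj
      by (simp add: image_subset_iff)
    have "(\<integral>\<^sup>+\<omega>. nexp (\<Sum>n. g (x n \<omega>)) \<partial>M) =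
        (\<Prod>i\<in>?I. \<integral>\<^sup>+\<omega>. nexp (b i * point_count (\<lambda>n. x n \<omega>) (A (b i))) \<partial>M)"
      unfolding count by (rule nn_integral_nexp_sum[OF ind]) simp
    also have "\<dots> = (\<Prod>i\<in>?I. nexp ((1 - nexp (b i)) * emeasure \<mu> (A (b i))))"
    proof (intro prod.cong refl poisson_distributed_nexp prob_space_axioms)
      fix i assume "i \<in> ?I"
      then have "b i \<in> range g" using b by (auto simp: bij_betw_def)
      then show "b i \<noteq> \<top>" using gfin by (auto simp: less_top)
      show "poisson_distributed M (\<lambda>\<omega>. point_count (\<lambda>n. x n \<omega>) (A (b i))) (emeasure \<mu> (A (b i)))"
        using assms(2) by (auto simp: poisson_process_def)
      show "point_count (\<lambda>n. x n \<omega>) (A (b i)) \<in> insert \<top> (range of_nat)" for \<omega>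
        by (auto simp: point_count_def emeasure_count_space)
    qed
    also have "\<dots> = nexp (\<Sum>i\<in>?I. (1 - nexp (b i)) * emeasure \<mu> (A (b i)))"
      by (simp add: nexp_sum)
    also have "(\<Sum>i\<in>?I. (1 - nexp (b i)) * emeasure \<mu> (A (b i))) = (\<integral>\<^sup>+y. 1 - nexp (g y) \<partial>\<mu>)"
    proof -
      have [simp]: "A c \<in> sets \<mu>" for c by (simp add: assms(3))
      have "(\<integral>\<^sup>+y. 1 - nexp (g y) \<partial>\<mu>) = (\<integral>\<^sup>+y. (\<Sum>i\<in>?I. (1 - nexp (b i)) * indicator (A (b i)) y) \<partial>\<mu>)"
        by (intro nn_integral_cong) (rule dec[of "\<lambda>c. 1 - nexp c"])
      also have "\<dots> = (\<Sum>i\<in>?I. (1 - nexp (b i)) * emeasure \<mu> (A (b i)))"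
        by (subst nn_integral_sum) (auto simp: nn_integral_cmult_indicator)
      finally show ?thesis by simp
    qed
    finally show ?thesis .
  qed
  obtain F where F: "\<And>i. simple_function borel (F i)" "incseq F" "\<And>i y. F i y < \<top>"
      "\<And>y. (SUP i. F i y) = f y"
    by (rule borel_measurable_implies_simple_function_sequence'[OF f]) blast
  have Fm[measurable]: "F i \<in> borel_measurable borel" for i
    using F(1) by (rule borel_measurable_simple_function)
  have Flim: "(\<lambda>i. F i y) \<longlonglongrightarrow> f y" for y
    using F(2,4) LIMSEQ_SUP[of "\<lambda>i. F i y"] by (auto simp: incseq_def le_fun_def)
  have S: "(\<lambda>i. \<Sum>n. F i (x n \<omega>)) \<longlonglongrightarrow> (\<Sum>n. f (x n \<omega>))" for \<omega>
  proof -
    have "(\<lambda>i. \<integral>\<^sup>+n. F i (x n \<omega>) \<partial>count_space UNIV) \<longlonglongrightarrow> (\<integral>\<^sup>+n. f (x n \<omega>) \<partial>count_space UNIV)"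
      using F(2) by (intro nn_integral_LIMSEQ Flim) (auto simp: incseq_def le_fun_def)
    then show ?thesis by (simp add: nn_integral_count_space_nat)
  qed
  have "(\<lambda>i. \<integral>\<^sup>+\<omega>. nexp (\<Sum>n. F i (x n \<omega>)) \<partial>M) \<longlonglongrightarrow> (\<integral>\<^sup>+\<omega>. nexp (\<Sum>n. f (x n \<omega>)) \<partial>M)"
    by (intro tendsto_nn_integral_bounded prob_space_axioms nexp_le_1)
      (auto intro!: tendsto_nexp S)
  moreover have "(\<lambda>i. nexp (\<integral>\<^sup>+y. 1 - nexp (F i y) \<partial>\<mu>)) \<longlonglongrightarrow> nexp (\<integral>\<^sup>+y. 1 - nexp (f y) \<partial>\<mu>)"
  proof (intro tendsto_nexp nn_integral_LIMSEQ)
    show "incseq (\<lambda>i y. 1 - nexp (F i y))"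
      using F(2) by (auto simp: incseq_def le_fun_def intro!: ennreal_minus_mono nexp_antimono)
    show "(\<lambda>i. 1 - nexp (F i y)) \<longlonglongrightarrow> 1 - nexp (f y)" for y
      by (intro tendsto_diff_ennreal tendsto_const tendsto_nexp Flim) auto
  qed (auto simp: measurable_cong_sets[OF assms(3) refl])
  ultimately show ?thesis
    using simple[OF F(1,3)] LIMSEQ_unique by simp
qed

section \<open>Stable intensities\<close>

lemma space_stable_intensity [simp]: "space (stable_intensity m) = UNIV"
  and sets_stable_intensity [simp, measurable_cong]: "sets (stable_intensity m) = sets borel"
  by (simp_all add: stable_intensity_def)

lemma nn_integral_stable_intensity:
  assumes [measurable]: "f \<in> borel_measurable borel"
  shows "(\<integral>\<^sup>+x. f x \<partial>stable_intensity m) =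
    (\<integral>\<^sup>+x. ennreal (indicator {0<..} x * x powr (-1 - m)) * f x \<partial>lborel)"
  unfolding stable_intensity_def by (subst nn_integral_density) auto

lemma AE_stable_intensity_pos: "AE x in stable_intensity m. 0 < x"
  unfolding stable_intensity_def by (subst AE_density) (auto simp: indicator_def)

lemma nn_integral_stable_intensity_cong:
  "(\<And>x. 0 < x \<Longrightarrow> f x = g x) \<Longrightarrow>
    (\<integral>\<^sup>+x. f x \<partial>stable_intensity m) = (\<integral>\<^sup>+x. g x \<partial>stable_intensity m)"
  by (intro nn_integral_cong_AE eventually_mono[OF AE_stable_intensity_pos]) auto

text \<open>A vanishing integral would force \<open>f = 0\<close> almost everywhere on (0, 1), a set
  of positive Lebesgue measure on which the density is positive.\<close>

lemma nn_integral_stable_intensity_pos: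
  assumes f [measurable]: "f \<in> borel_measurable borel" and "\<And>x. 0 < x \<Longrightarrow> 0 < f x"
  shows "0 < (\<integral>\<^sup>+x. f x \<partial>stable_intensity m)"
proof (rule ccontr)
  assume "\<not> 0 < (\<integral>\<^sup>+x. f x \<partial>stable_intensity m)"
  then have "AE x in stable_intensity m. f x = 0"
    by (simp add: nn_integral_0_iff_AE)
  then have "AE x in lborel. 0 < x \<longrightarrow> f x = 0"
    unfolding stable_intensity_def by (subst (asm) AE_density) (auto simp: indicator_def)
  then have "AE x in lborel. (x::real) \<notin> {0<..<1}"
  proof eventually_elim
    case (elim x)
    then show ?case using assms(2)[of x] by auto
  qed
  then have "emeasure lborel {0<..<1::real} = 0"
    by (subst (asm) AE_iff_measurable[where N="{0<..<1}"]) auto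
  then show False by simp
qed

text \<open>Substituting \<open>y = c * x\<close> turns the density, Jacobian included, into
  \<open>c powr (- m)\<close> times itself. This homogeneity is the source of all powers in the
  recursion.\<close>

lemma nn_integral_stable_intensity_scale:
  assumes f [measurable]: "f \<in> borel_measurable borel" and c: "0 < c"
  shows "(\<integral>\<^sup>+x. f (c * x) \<partial>stable_intensity m) = ennreal (c powr m) * (\<integral>\<^sup>+x. f x \<partial>stable_intensity m)"
proof -
  have "(\<integral>\<^sup>+x. f x \<partial>stable_intensity m) =
      ennreal c * (\<integral>\<^sup>+x. ennreal (indicator {0<..} (c * x) * (c * x) powr (-1 - m)) * f (c * x) \<partial>lborel)"
    using c by (simp only: nn_integral_stable_intensity[OF f])
      (subst nn_integral_real_affine[where c=c and t=0], auto)
  also have "\<dots> = ennreal c * (\<integral>\<^sup>+x. ennreal (c powr (-1 - m)) *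
      (ennreal (indicator {0<..} x * x powr (-1 - m)) * f (c * x)) \<partial>lborel)"
    using c by (intro arg_cong[where f="\<lambda>t. ennreal c * t"] nn_integral_cong)
      (auto simp: indicator_def zero_less_mult_iff powr_mult ennreal_mult mult.assoc)
  also have "\<dots> = ennreal (c * c powr (-1 - m)) * (\<integral>\<^sup>+x. f (c * x) \<partial>stable_intensity m)"
    using c by (subst nn_integral_cmult) (auto simp: nn_integral_stable_intensity ennreal_mult mult.assoc)
  also have "c * c powr (-1 - m) = c powr (- m)"
    using c by (metis add.commute add_diff_cancel_left' diff_minus_eq_add minus_diff_eq powr_mult_base less_imp_le)
  finally have "ennreal (c powr m) * (\<integral>\<^sup>+x. f x \<partial>stable_intensity m) =
      ennreal (c powr m * c powr (- m)) * (\<integral>\<^sup>+x. f (c * x) \<partial>stable_intensity m)"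
    by (simp add: ennreal_mult mult.assoc)
  then show ?thesis using c by (simp add: powr_minus)
qed

section \<open>The powers produced by a stable intensity\<close>

text \<open>For finite positive \<open>C\<close> and positive \<open>b\<close> this is
  \<open>C powr (m / b)\<close> times a constant. As an integral it also makes sense at
  \<open>\<top>\<close>; \<open>b\<close> is the exponent passed up from the next level of the
  tree.\<close>

definition stable_power :: "real \<Rightarrow> real \<Rightarrow> ennreal \<Rightarrow> ennreal" where
  "stable_power m b C = (\<integral>\<^sup>+x. 1 - nexp (ennreal (x powr b) * C) \<partial>stable_intensity m)"

lemma sigma_finite_stable_intensity: "sigma_finite_measure (stable_intensity m)"
proof -
  have "sigma_finite_measure lborel" by (rule lborel.sigma_finite_measure_axioms)
  then show ?thesis
    unfolding stable_intensity_def
    by (intro sigma_finite_measure.sigma_finite_iff_density_finite[THEN iffD2]) auto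
qed

lemma measurable_stable_power [measurable]: "stable_power m b \<in> borel_measurable borel"
proof -
  interpret sigma_finite_measure "stable_intensity m" by (rule sigma_finite_stable_intensity)
  show ?thesis unfolding stable_power_def[abs_def] by measurable
qed

text \<open>The factor \<open>c = \<rho> powr (1 / b)\<close> on the points absorbs
  \<open>\<rho>\<close>, and rescaling the intensity by it costs \<open>c powr m\<close>.\<close>

lemma stable_power_scale:
  assumes "0 < \<rho>" "0 < b"
  shows "stable_power m b (ennreal \<rho> * C) = ennreal (\<rho> powr (m / b)) * stable_power m b C"
proof -
  define c where "c = \<rho> powr (1 / b)"
  have c: "0 < c" "c powr b = \<rho>" "c powr m = \<rho> powr (m / b)"
    using assms by (auto simp: c_def powr_powr)
  have "stable_power m b (ennreal \<rho> * C) = (\<integral>\<^sup>+x. 1 - nexp (ennreal ((c * x) powr b) * C) \<partial>stable_intensity m)"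
    unfolding stable_power_def
    using c assms by (intro nn_integral_stable_intensity_cong)
      (auto simp: powr_mult ennreal_mult mult_ac)
  then show ?thesis
    using c by (simp add: stable_power_def nn_integral_stable_intensity_scale[where f="\<lambda>x. 1 - nexp (ennreal (x powr b) * C)"])
qed

lemma stable_power_pos: "0 < C \<Longrightarrow> 0 < stable_power m b C"
  unfolding stable_power_def
  by (intro nn_integral_stable_intensity_pos)
    (auto intro!: diff_gr0_ennreal nexp_less_1 simp: ennreal_zero_less_mult_iff)

lemma one_minus_nexp_le: "1 - nexp a \<le> a"
proof (cases a)
  case (real r)
  have "1 - exp (- r) \<le> r" using exp_ge_add_one_self[of "- r"] by simp
  then show ?thesis using real by (simp add: nexp_ennreal ennreal_minus ennreal_leI flip: ennreal_1)
qed simp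

text \<open>Split at 1: \<open>1 - nexp y\<close> is at most \<open>y\<close>, used below 1, and at
  most 1, used above. The two resulting integrals converge because of \<open>m < b\<close> and
  \<open>0 < m\<close> respectively.\<close>

lemma stable_power_le:
  assumes "0 < m" "m < b"
  obtains K where "0 \<le> K" "\<And>C. stable_power m b C \<le> ennreal K * (1 + C)"
proof
  let ?i1 = "\<lambda>x::real. indicator {0..1} x * x powr (b - m - 1)"
  let ?i2 = "\<lambda>x::real. indicator {1..} x * x powr (-1 - m)"
  have i1: "(\<integral>\<^sup>+x. ennreal (?i1 x) \<partial>lborel) = ennreal (1 / (b - m))"
  proof -
    have "((\<lambda>x. x powr (b - m - 1)) has_integral 1 / (b - m)) {0..1}"
      using has_integral_powr_from_0[of "b - m - 1" 1] assms by simp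
    then have "(?i1 has_integral 1 / (b - m)) UNIV"
      by (subst (asm) has_integral_restrict_UNIV[symmetric])
        (simp add: indicator_def of_bool_def if_distrib[where f="\<lambda>t. t * _"] cong: if_cong)
    then show ?thesis by (intro nn_integral_has_integral_lborel) auto
  qed
  have i2: "(\<integral>\<^sup>+x. ennreal (?i2 x) \<partial>lborel) = ennreal (1 / m)"
  proof -
    have "((\<lambda>x. x powr (-1 - m)) has_integral 1 / m) {1..}"
      using has_integral_powr_to_inf[of "-1 - m" 1] assms by simp
    then have "(?i2 has_integral 1 / m) UNIV"
      by (subst (asm) has_integral_restrict_UNIV[symmetric])
        (simp add: indicator_def of_bool_def if_distrib[where f="\<lambda>t. t * _"] cong: if_cong)
    then show ?thesis by (intro nn_integral_has_integral_lborel) auto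
  qed
  show "0 \<le> 1 / (b - m) + 1 / m" using assms by simp
  fix C
  have "stable_power m b C \<le> (\<integral>\<^sup>+x. C * ennreal (?i1 x) + ennreal (?i2 x) \<partial>lborel)"
    unfolding stable_power_def
  proof (subst nn_integral_stable_intensity)
    show "(\<integral>\<^sup>+x. ennreal (indicator {0<..} x * x powr (- 1 - m)) * (1 - nexp (ennreal (x powr b) * C)) \<partial>lborel)
      \<le> (\<integral>\<^sup>+x. C * ennreal (?i1 x) + ennreal (?i2 x) \<partial>lborel)"
    proof (rule nn_integral_mono)
      fix x :: real
      consider "x \<le> 0" | "0 < x" "x < 1" | "1 \<le> x" by linarith
      then show "ennreal (indicator {0<..} x * x powr (- 1 - m)) * (1 - nexp (ennreal (x powr b) * C))
          \<le> C * ennreal (?i1 x) + ennreal (?i2 x)"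
      proof cases
        case 2
        have "ennreal (x powr (- 1 - m)) * (1 - nexp (ennreal (x powr b) * C)) \<le>
            ennreal (x powr (- 1 - m)) * (ennreal (x powr b) * C)"
          by (intro mult_left_mono one_minus_nexp_le) auto
        also have "\<dots> = C * ennreal (x powr (b - m - 1))"
        proof -
          have "x powr (b - m - 1) = x powr (- 1 - m) * x powr b"
            by (simp add: powr_add[symmetric] algebra_simps)
          then show ?thesis by (simp add: ennreal_mult mult_ac)
        qed
        finally show ?thesis using 2 by simp
      next
        case 3
        have "ennreal (x powr (- 1 - m)) * (1 - nexp (ennreal (x powr b) * C)) \<le>
            ennreal (x powr (- 1 - m)) * 1"
          by (intro mult_left_mono) (auto intro: diff_le_self_ennreal)
        then show ?thesis using 3 by (simp add: add_increasing)
      qed auto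
    qed
  qed auto
  also have "\<dots> = C * ennreal (1 / (b - m)) + ennreal (1 / m)"
    by (subst nn_integral_add) (auto simp: nn_integral_cmult i1 i2)
  also have "\<dots> \<le> ennreal (1 / (b - m) + 1 / m) * (1 + C)"
    using assms
    by (auto simp: algebra_simps distrib_left ennreal_plus[symmetric] simp del: ennreal_plus
       intro!: add_mono mult_left_mono ennreal_leI)
  finally show "stable_power m b C \<le> ennreal (1 / (b - m) + 1 / m) * (1 + C)" .
qed


section \<open>Explicit integrals over the half-line\<close>

lemma nn_integral_FTC_Ioi:
  fixes f F :: "real \<Rightarrow> real"
  assumes "\<And>x. 0 < x \<Longrightarrow> DERIV F x :> f x" "\<And>x. 0 < x \<Longrightarrow> isCont f x" "\<And>x. 0 < x \<Longrightarrow> 0 \<le> f x"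
    and "(F \<longlongrightarrow> A) (at_right 0)" "(F \<longlongrightarrow> B) at_top"
  shows "(\<integral>\<^sup>+x. ennreal (indicator {0<..} x * f x) \<partial>lborel) = ennreal (B - A)"
proof -
  have F: "((F \<circ> real_of_ereal) \<longlongrightarrow> A) (at_right 0)" "((F \<circ> real_of_ereal) \<longlongrightarrow> B) (at_left \<infinity>)"
    using assms(4,5) by (simp_all add: ereal_tendsto_simps zero_ereal_def)
  have e: "einterval 0 \<infinity> = {0<..}"
    by (auto simp: einterval_def zero_ereal_def)
  have "set_integrable lborel (einterval 0 \<infinity>) f" "(LBINT x=0..\<infinity>. f x) = B - A"
    by (rule interval_integral_FTC_nonneg[OF _ _ _ _ F]; use assms in \<open>simp add: zero_ereal_def\<close>)+
  then have i: "integrable lborel (\<lambda>x. indicator {0<..} x * f x)" "(\<integral>x. indicator {0<..} x * f x \<partial>lborel) = B - A"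
    by (simp_all add: interval_lebesgue_integral_def e set_integrable_def set_lebesgue_integral_def)
  show ?thesis
    unfolding i(2)[symmetric]
    by (rule nn_integral_eq_integral[OF i(1)]) (use assms(3) in \<open>auto simp: indicator_def\<close>)
qed

text \<open>This represents \<open>1 / z^2\<close> as a mixture of exponentials, so that a Laplace
  transform can stand in for the inverse square of a random denominator.\<close>

lemma nn_integral_exp_linear:
  assumes "0 < z"
  shows "(\<integral>\<^sup>+x. ennreal (indicator {0<..} x * (x * exp (- x * z))) \<partial>lborel) = ennreal (1 / z\<^sup>2)"
proof -
  let ?F = "\<lambda>x. - (x / z + 1 / z\<^sup>2) * exp (- x * z)"
  have "(?F \<longlongrightarrow> - (1 / z\<^sup>2)) (at_right 0)"
    using assms by (auto intro!: tendsto_eq_intros)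
  moreover have "(?F \<longlongrightarrow> 0) at_top"
    using assms by real_asymp
  ultimately have "(\<integral>\<^sup>+x. ennreal (indicator {0<..} x * (x * exp (- x * z))) \<partial>lborel) = ennreal (0 - - (1 / z\<^sup>2))"
    using assms by (intro nn_integral_FTC_Ioi)
      (auto intro!: derivative_eq_intros continuous_intros simp: field_simps power2_eq_square)
  then show ?thesis by simp
qed

text \<open>The substitution \<open>y = A * x powr m\<close> makes the integrand
  \<open>exp (- y) / m\<close>, so the value is free of \<open>A\<close>; in the application
  \<open>A\<close> is what depends on the state.\<close>

lemma nn_integral_exp_power:
  assumes "0 < A" "0 < m"
  shows "(\<integral>\<^sup>+x. ennreal (indicator {0<..} x * (x powr (m - 1) * A * exp (- A * x powr m))) \<partial>lborel) =
    ennreal (1 / m)"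
proof -
  let ?F = "\<lambda>x. - (1 / m) * exp (- A * x powr m)"
  have "(?F \<longlongrightarrow> - (1 / m)) (at_right 0)"
    using assms by real_asymp
  moreover have "(?F \<longlongrightarrow> 0) at_top"
    using assms by real_asymp
  ultimately have "(\<integral>\<^sup>+x. ennreal (indicator {0<..} x * (x powr (m - 1) * A * exp (- A * x powr m))) \<partial>lborel) =
      ennreal (0 - - (1 / m))"
    using assms by (intro nn_integral_FTC_Ioi)
      (auto intro!: derivative_eq_intros continuous_intros simp: field_simps)
  then show ?thesis by simp
qed

section \<open>The quadratic perturbation and its derivative at zero\<close>

text \<open>The function \<open>c(\<epsilon>)\<close> of the overview, with \<open>m\<close> in
  place of the exponent at level \<open>J\<close>.\<close>

definition stable_quadratic :: "real \<Rightarrow> real \<Rightarrow> ennreal" where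
  "stable_quadratic m \<epsilon> = (\<integral>\<^sup>+x. 1 - nexp (ennreal (x + \<epsilon> * x\<^sup>2)) \<partial>stable_intensity m)"

lemma stable_quadratic_0: "stable_quadratic m 0 = stable_power m 1 1"
  unfolding stable_quadratic_def stable_power_def
  by (intro nn_integral_stable_intensity_cong) simp

lemma stable_quadratic_finite:
  assumes "0 < m" "m < 1"
  shows "stable_quadratic m 0 < \<top>"
proof -
  obtain K where K: "0 \<le> K" "\<And>C. stable_power m 1 C \<le> ennreal K * (1 + C)"
    using stable_power_le assms by blast
  then show ?thesis
    using K(2)[of 1] by (auto simp: stable_quadratic_0 ennreal_mult_less_top intro: le_less_trans)
qed

text \<open>In terms of the Gamma function the two integrals are \<open>Gamma (2 - m)\<close> and
  \<open>Gamma (1 - m) / m\<close>. Two integrations by parts are merged into one antiderivative of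
  the difference of the integrands, which vanishes at both ends.\<close>

lemma stable_second_moment:
  assumes m: "0 < m" "m < 1"
  shows "(\<integral>\<^sup>+x. ennreal (x\<^sup>2 * exp (- x)) \<partial>stable_intensity m) = ennreal (m * (1 - m)) * stable_quadratic m 0"
proof -
  let ?f = "\<lambda>x. (1 - exp (- x)) * x powr (-1 - m)" and ?g = "\<lambda>x. exp (- x) * x powr (1 - m)"
  have e: "einterval 0 \<infinity> = {0<..}"
    by (auto simp: einterval_def zero_ereal_def)
  \<comment> \<open>Domination that makes \<open>?g\<close> integrable. The 4 comes from halving the
    argument: for \<open>x = 2 * y\<close>, \<open>(y * exp (- y))^2\<close> is a quarter of
    \<open>x^2 * exp (- x)\<close>.\<close>
  have le: "x\<^sup>2 * exp (- x) \<le> 4 * (1 - exp (- x))" if "0 < x" for x :: real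
  proof -
    define y where "y = x / 2"
    have y: "0 < y" "x = 2 * y" using that by (auto simp: y_def)
    have "(1 + y) * exp (- y) \<le> exp y * exp (- y)"
      using exp_ge_add_one_self[of y] by (intro mult_right_mono) auto
    then have "y * exp (- y) \<le> 1 - exp (- y)" by (simp add: algebra_simps mult_exp_exp)
    then have "(y * exp (- y))\<^sup>2 \<le> (1 - exp (- y))\<^sup>2" using y by (intro power_mono) auto
    also have "\<dots> \<le> (1 - exp (- y)) * (1 + exp (- y))"
      unfolding power2_eq_square using y by (intro mult_left_mono) auto
    also have "\<dots> = 1 - exp (- x)" by (simp add: algebra_simps mult_exp_exp y)
    also have "(y * exp (- y))\<^sup>2 = x\<^sup>2 * exp (- x) / 4"
      by (simp add: y power_mult_distrib power2_eq_square mult_exp_exp)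
    finally show ?thesis by simp
  qed
  have nnf: "(\<integral>\<^sup>+x. ennreal (indicator {0<..} x * ?f x) \<partial>lborel) = stable_quadratic m 0"
    unfolding stable_quadratic_def
    by (subst nn_integral_stable_intensity)
      (auto intro!: nn_integral_cong simp: indicator_def nexp_ennreal ennreal_minus ennreal_mult[symmetric] mult_ac
        simp flip: ennreal_1)
  have nng: "(\<integral>\<^sup>+x. ennreal (indicator {0<..} x * ?g x) \<partial>lborel) = (\<integral>\<^sup>+x. ennreal (x\<^sup>2 * exp (- x)) \<partial>stable_intensity m)"
    by (subst nn_integral_stable_intensity)
      (auto intro!: nn_integral_cong simp: indicator_def ennreal_mult[symmetric] mult_ac
        powr_add[symmetric] simp flip: powr_numeral)
  have "stable_quadratic m 0 < \<top>" by (rule stable_quadratic_finite[OF m])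
  then have fi: "integrable lborel (\<lambda>x. indicator {0<..} x * ?f x)"
    unfolding nnf[symmetric] by (intro integrableI_nonneg) (auto simp: indicator_def)
  have gi: "integrable lborel (\<lambda>x. indicator {0<..} x * ?g x)"
  proof (rule Bochner_Integration.integrable_bound)
    show "integrable lborel (\<lambda>x. 4 * (indicator {0<..} x * ?f x))" using fi by simp
    have "?g x \<le> 4 * ?f x" if "0 < x" for x
    proof -
      have "?g x = x powr (-1 - m) * (x\<^sup>2 * exp (- x))"
        using that by (simp add: powr_add[symmetric] flip: powr_numeral)
      also have "\<dots> \<le> x powr (-1 - m) * (4 * (1 - exp (- x)))"
        by (intro mult_left_mono le that) auto
      finally show ?thesis by (simp add: algebra_simps)
    qed
    then show "AE x in lborel. norm (indicator {0<..} x * ?g x) \<le> norm (4 * (indicator {0<..} x * ?f x))"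
      by (auto simp: indicator_def abs_mult)
  qed auto
  let ?h = "\<lambda>x. ?g x - m * (1 - m) * ?f x"
  \<comment> \<open>An antiderivative of \<open>?h\<close>: in its derivative the terms with
    \<open>exp (- x) * x powr (- m)\<close> from the two summands cancel.\<close>
  let ?K = "\<lambda>x. (1 - m) * (1 - exp (- x)) * x powr (- m) - exp (- x) * x powr (1 - m)"
  have hi: "integrable lborel (\<lambda>x. indicator {0<..} x * ?h x)"
  proof -
    have "integrable lborel (\<lambda>x. indicator {0<..} x * ?g x - m * (1 - m) * (indicator {0<..} x * ?f x))"
      by (intro Bochner_Integration.integrable_diff gi integrable_mult_right fi)
    then show ?thesis
      by (rule Bochner_Integration.integrable_cong[OF refl, THEN iffD1, rotated]) (simp add: algebra_simps)
  qed
  have "(LBINT x=0..\<infinity>. ?h x) = 0 - 0"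
  proof (rule interval_integral_FTC_integrable)
    show "(?K has_vector_derivative ?h x) (at x)" if "0 < ereal x" for x
    proof -
      have x: "0 < x" using that by (simp add: zero_ereal_def)
      have e1: "x powr (1 - m) = x powr (- m) * x" "x powr (- m) = x powr (-1 - m) * x"
        using x by (simp_all add: powr_mult_base[symmetric] mult.commute powr_add[symmetric])
           (metis add.commute add_uminus_conv_diff diff_add_cancel powr_mult_base less_imp_le mult.commute)+
      have e2: "x powr (- m - 1) = x powr (-1 - m)"
        by (rule arg_cong[where f="\<lambda>t. x powr t"]) linarith
      have "(?K has_real_derivative ?h x) (at x)"
        using x by (auto intro!: derivative_eq_intros simp: field_simps e1 e2)
      then show ?thesis by (simp add: has_real_derivative_iff_has_vector_derivative)
    qed
    show "isCont ?h x" if "0 < ereal x" for x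
      using that by (auto simp: zero_ereal_def intro!: continuous_intros)
    show "set_integrable lborel (einterval 0 \<infinity>) ?h"
      using hi by (simp add: set_integrable_def e)
    have "(?K \<longlongrightarrow> 0) (at_right 0)" using m by real_asymp
    then show "((?K \<circ> real_of_ereal) \<longlongrightarrow> 0) (at_right 0)"
      by (simp add: ereal_tendsto_simps zero_ereal_def)
    have "(?K \<longlongrightarrow> 0) at_top" using m by real_asymp
    then show "((?K \<circ> real_of_ereal) \<longlongrightarrow> 0) (at_left \<infinity>)"
      by (simp add: ereal_tendsto_simps)
  qed simp
  then have "(\<integral>x. indicator {0<..} x * ?h x \<partial>lborel) = 0"
    by (simp add: interval_lebesgue_integral_def e set_lebesgue_integral_def)
  moreover have "(\<integral>x. indicator {0<..} x * ?h x \<partial>lborel) =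
      (\<integral>x. indicator {0<..} x * ?g x - m * (1 - m) * (indicator {0<..} x * ?f x) \<partial>lborel)"
    by (intro Bochner_Integration.integral_cong) (auto simp: algebra_simps)
  ultimately have eq: "(\<integral>x. indicator {0<..} x * ?g x \<partial>lborel) = m * (1 - m) * (\<integral>x. indicator {0<..} x * ?f x \<partial>lborel)"
    using fi gi by simp
  have "(\<integral>\<^sup>+x. ennreal (indicator {0<..} x * ?g x) \<partial>lborel) = ennreal (\<integral>x. indicator {0<..} x * ?g x \<partial>lborel)"
    by (rule nn_integral_eq_integral[OF gi]) (auto simp: indicator_def)
  moreover have "(\<integral>\<^sup>+x. ennreal (indicator {0<..} x * ?f x) \<partial>lborel) = ennreal (\<integral>x. indicator {0<..} x * ?f x \<partial>lborel)"
    by (rule nn_integral_eq_integral[OF fi]) (auto simp: indicator_def)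
  ultimately show ?thesis
    unfolding nng[symmetric] nnf[symmetric] eq using m by (simp only:) (simp add: ennreal_mult')
qed



lemma stable_quadratic_pos: "0 \<le> \<epsilon> \<Longrightarrow> 0 < stable_quadratic m \<epsilon>"
  unfolding stable_quadratic_def
  by (intro nn_integral_stable_intensity_pos)
    (auto intro!: diff_gr0_ennreal nexp_less_1 add_pos_nonneg)

text \<open>The increment over \<open>\<epsilon> = 0\<close> appears as an integral of a nonnegative
  function, so that no subtraction in \<open>ennreal\<close> occurs.\<close>

lemma stable_quadratic_split:
  assumes "0 \<le> \<epsilon>"
  shows "stable_quadratic m \<epsilon> = stable_quadratic m 0 +
    (\<integral>\<^sup>+x. ennreal (exp (- x) * (1 - exp (- \<epsilon> * x\<^sup>2))) \<partial>stable_intensity m)"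
proof -
  have "stable_quadratic m \<epsilon> = (\<integral>\<^sup>+x. (1 - nexp (ennreal (x + 0 * x\<^sup>2))) +
      ennreal (exp (- x) * (1 - exp (- \<epsilon> * x\<^sup>2))) \<partial>stable_intensity m)"
    unfolding stable_quadratic_def
  proof (rule nn_integral_stable_intensity_cong)
    fix x :: real assume x: "0 < x"
    have "0 \<le> x + \<epsilon> * x\<^sup>2" using x assms by simp
    moreover have "0 \<le> exp (- x) * (1 - exp (- \<epsilon> * x\<^sup>2))" using assms by simp
    moreover have "1 - exp (- (x + \<epsilon> * x\<^sup>2)) = (1 - exp (- x)) + exp (- x) * (1 - exp (- \<epsilon> * x\<^sup>2))"
      by (simp add: algebra_simps mult_exp_exp)
    ultimately show "1 - nexp (ennreal (x + \<epsilon> * x\<^sup>2)) = (1 - nexp (ennreal (x + 0 * x\<^sup>2))) +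
        ennreal (exp (- x) * (1 - exp (- \<epsilon> * x\<^sup>2)))"
      using x by (simp add: nexp_ennreal ennreal_minus flip: ennreal_1 ennreal_plus)
  qed
  then show ?thesis
    by (subst (asm) nn_integral_add) (auto simp: stable_quadratic_def)
qed

text \<open>Derivatives at \<open>\<epsilon> = 0\<close> are taken along
  \<open>\<epsilon> = 1 / Suc n\<close>: dominated convergence is applied to sequences, and
  \<open>Suc\<close> keeps the denominator nonzero.\<close>

lemma n_one_minus_exp_tendsto:
  "(\<lambda>n. real (Suc n) * (1 - exp (- a / real (Suc n)))) \<longlonglongrightarrow> a"
proof (cases "a = 0")
  case False
  then show ?thesis by real_asymp
qed simp

text \<open>The difference quotients stay below their limit, so the limit itself serves as the
  dominating function.\<close>

lemma n_one_minus_exp_le: "real (Suc n) * (1 - exp (- a / real (Suc n))) \<le> a"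
proof -
  have "1 - exp (- a / real (Suc n)) \<le> a / real (Suc n)"
    using exp_ge_add_one_self[of "- a / real (Suc n)"] by simp
  then have "real (Suc n) * (1 - exp (- a / real (Suc n))) \<le> real (Suc n) * (a / real (Suc n))"
    by (intro mult_left_mono) auto
  then show ?thesis by simp
qed

text \<open>The function \<open>\<rho>(\<epsilon>)\<close> of the overview, real-valued so that it
  can be raised to real powers.\<close>

definition quadratic_ratio :: "real \<Rightarrow> real \<Rightarrow> real" where
  "quadratic_ratio m \<epsilon> = enn2real (stable_quadratic m \<epsilon>) / enn2real (stable_quadratic m 0)"

text \<open>By \<open>stable_quadratic_split\<close> this is the difference quotient of
  \<open>stable_quadratic\<close> at 0; its integrand is dominated by
  \<open>exp (- x) * x^2\<close>, and the limit is the second moment.\<close>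

lemma stable_quadratic_tendsto:
  assumes m: "0 < m" "m < 1"
  shows "(\<lambda>n. ennreal (real (Suc n)) *
      (\<integral>\<^sup>+x. ennreal (exp (- x) * (1 - exp (- (1 / real (Suc n)) * x\<^sup>2))) \<partial>stable_intensity m))
    \<longlonglongrightarrow> ennreal (m * (1 - m)) * stable_quadratic m 0"
proof -
  let ?f = "\<lambda>n x. ennreal (exp (- x) * (real (Suc n) * (1 - exp (- x\<^sup>2 / real (Suc n)))))"
  have "(\<lambda>n. \<integral>\<^sup>+x. ?f n x \<partial>stable_intensity m) \<longlonglongrightarrow> (\<integral>\<^sup>+x. ennreal (exp (- x) * x\<^sup>2) \<partial>stable_intensity m)"
  proof (rule nn_integral_dominated_convergence[where w="\<lambda>x. ennreal (exp (- x) * x\<^sup>2)"])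
    show "(\<integral>\<^sup>+x. ennreal (exp (- x) * x\<^sup>2) \<partial>stable_intensity m) < \<infinity>"
      using stable_second_moment[OF m] stable_quadratic_finite[OF m]
      by (simp add: mult.commute ennreal_mult_less_top)
    show "AE x in stable_intensity m. ?f n x \<le> ennreal (exp (- x) * x\<^sup>2)" for n
      using n_one_minus_exp_le[of n] by (intro AE_I2 ennreal_leI mult_left_mono) auto
    show "AE x in stable_intensity m. (\<lambda>n. ?f n x) \<longlonglongrightarrow> ennreal (exp (- x) * x\<^sup>2)"
      by (intro AE_I2 tendsto_ennrealI tendsto_mult_left n_one_minus_exp_tendsto)
  qed auto
  moreover have "(\<integral>\<^sup>+x. ?f n x \<partial>stable_intensity m) = ennreal (real (Suc n)) *
      (\<integral>\<^sup>+x. ennreal (exp (- x) * (1 - exp (- (1 / real (Suc n)) * x\<^sup>2))) \<partial>stable_intensity m)" for n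
  proof -
    have "?f n x = ennreal (real (Suc n)) * ennreal (exp (- x) * (1 - exp (- (1 / real (Suc n)) * x\<^sup>2)))" for x
      by (subst ennreal_mult'[symmetric]) (auto simp: mult_ac)
    then show ?thesis by (simp only:) (rule nn_integral_cmult, measurable)
  qed
  ultimately show ?thesis
    using stable_second_moment[OF m] by (simp only: mult.commute)
qed

text \<open>All three claims rest on the finiteness of the increment \<open>d\<close>, which is at
  most \<open>\<epsilon>\<close> times the second moment. The third one is the value of
  \<rho>'(0).\<close>

lemma quadratic_ratio:
  assumes m: "0 < m" "m < 1"
  shows "0 \<le> \<epsilon> \<Longrightarrow> stable_quadratic m \<epsilon> = ennreal (quadratic_ratio m \<epsilon>) * stable_quadratic m 0"
    and "0 \<le> \<epsilon> \<Longrightarrow> 0 < quadratic_ratio m \<epsilon>"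
    and "(\<lambda>n. real (Suc n) * (quadratic_ratio m (1 / real (Suc n)) - 1)) \<longlonglongrightarrow> m * (1 - m)"
proof -
  obtain c where c: "stable_quadratic m 0 = ennreal c" "0 < c"
    using stable_quadratic_finite[OF m] stable_quadratic_pos[of 0 m]
    by (cases "stable_quadratic m 0") auto
  define d where "d \<epsilon> = (\<integral>\<^sup>+x. ennreal (exp (- x) * (1 - exp (- \<epsilon> * x\<^sup>2))) \<partial>stable_intensity m)" for \<epsilon>
  have split: "stable_quadratic m \<epsilon> = ennreal c + d \<epsilon>" if "0 \<le> \<epsilon>" for \<epsilon>
    using stable_quadratic_split[OF that] by (simp add: c d_def)
  have fin: "d \<epsilon> < \<top>" if "0 \<le> \<epsilon>" for \<epsilon>
  proof -
    have "d \<epsilon> \<le> (\<integral>\<^sup>+x. ennreal \<epsilon> * ennreal (x\<^sup>2 * exp (- x)) \<partial>stable_intensity m)"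
      unfolding d_def
    proof (rule nn_integral_mono)
      fix x
      have "1 - exp (- \<epsilon> * x\<^sup>2) \<le> \<epsilon> * x\<^sup>2"
        using exp_ge_add_one_self[of "- \<epsilon> * x\<^sup>2"] by simp
      then have "exp (- x) * (1 - exp (- \<epsilon> * x\<^sup>2)) \<le> \<epsilon> * (x\<^sup>2 * exp (- x))"
        using mult_left_mono[of _ _ "exp (- x)"] by (simp add: mult_ac)
      then show "ennreal (exp (- x) * (1 - exp (- \<epsilon> * x\<^sup>2))) \<le> ennreal \<epsilon> * ennreal (x\<^sup>2 * exp (- x))"
        using that by (simp add: ennreal_mult[symmetric] ennreal_leI)
    qed
    also have "\<dots> < \<top>"
      by (subst nn_integral_cmult)
        (auto simp: stable_second_moment[OF m] ennreal_mult_less_top stable_quadratic_finite[OF m])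
    finally show ?thesis .
  qed
  have ratio: "quadratic_ratio m \<epsilon> = 1 + enn2real (d \<epsilon>) / c" if "0 \<le> \<epsilon>" for \<epsilon>
    using c fin[OF that]
    by (simp add: quadratic_ratio_def split[OF that] enn2real_plus add_divide_distrib)
  show pos: "0 < quadratic_ratio m \<epsilon>" if "0 \<le> \<epsilon>" for \<epsilon>
    using c by (simp add: ratio[OF that] add_pos_nonneg)
  show "stable_quadratic m \<epsilon> = ennreal (quadratic_ratio m \<epsilon>) * stable_quadratic m 0" if "0 \<le> \<epsilon>"
  proof -
    have "stable_quadratic m \<epsilon> = ennreal (enn2real (stable_quadratic m \<epsilon>))"
      using split[OF that] fin[OF that] by simp
    also have "enn2real (stable_quadratic m \<epsilon>) = quadratic_ratio m \<epsilon> * c"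
      using c by (simp add: quadratic_ratio_def)
    finally show ?thesis using c pos[OF that] by (simp add: ennreal_mult)
  qed
  have "(\<lambda>n. enn2real (ennreal (real (Suc n)) * d (1 / real (Suc n)))) \<longlonglongrightarrow> m * (1 - m) * c"
    using stable_quadratic_tendsto[OF m] m c
    by (intro tendsto_enn2real) (auto simp: d_def ennreal_mult)
  then have "(\<lambda>n. real (Suc n) * enn2real (d (1 / real (Suc n))) / c) \<longlonglongrightarrow> m * (1 - m) * c / c"
    using c by (intro tendsto_divide) (simp_all add: enn2real_mult del: of_nat_Suc)
  then show "(\<lambda>n. real (Suc n) * (quadratic_ratio m (1 / real (Suc n)) - 1)) \<longlonglongrightarrow> m * (1 - m)"
    using c by (simp add: ratio)
qed

text \<open>A chain rule along a sequence. Caratheodory's form of the derivative avoids dividing by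
  \<open>x n - 1\<close>, which may vanish.\<close>

lemma DERIV_tendsto_difference_quotient:
  fixes g :: "real \<Rightarrow> real"
  assumes g: "DERIV g 1 :> D" and x: "(\<lambda>n. real (Suc n) * (x n - 1)) \<longlonglongrightarrow> L"
  shows "(\<lambda>n. real (Suc n) * (g (x n) - g 1)) \<longlonglongrightarrow> D * L"
proof -
  obtain h where h: "\<And>z. g z - g 1 = h z * (z - 1)" "isCont h 1" "h 1 = D"
    using g by (auto simp: CARAT_DERIV)
  have "(\<lambda>n. 1 / real (Suc n) * (real (Suc n) * (x n - 1))) \<longlonglongrightarrow> 0 * L"
    by (intro tendsto_mult x LIMSEQ_Suc[OF lim_1_over_n]) 
  then have "(\<lambda>n. x n - 1) \<longlonglongrightarrow> 0" by simp
  then have "x \<longlonglongrightarrow> 1" by (simp add: LIM_zero_iff)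
  then have "(\<lambda>n. h (x n)) \<longlonglongrightarrow> D" using h isCont_tendsto_compose by metis
  then have "(\<lambda>n. h (x n) * (real (Suc n) * (x n - 1))) \<longlonglongrightarrow> D * L" by (intro tendsto_mult x)
  then show ?thesis by (simp add: h(1) mult_ac)
qed

lemma quadratic_ratio_exp_tendsto:
  assumes m: "0 < m" "m < 1"
  shows "(\<lambda>n. real (Suc n) * (exp (- A) - exp (- A * quadratic_ratio m (1 / real (Suc n)) powr \<theta>)))
    \<longlonglongrightarrow> A * exp (- A) * \<theta> * (m * (1 - m))"
proof -
  have "DERIV (\<lambda>x. - exp (- A * x powr \<theta>)) 1 :> A * exp (- A) * \<theta>"
    by (auto intro!: derivative_eq_intros)
  from DERIV_tendsto_difference_quotient[OF this quadratic_ratio(3)[OF m]] show ?thesis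
    by (simp add: algebra_simps)
qed

text \<open>For finite positive \<open>P\<close> the points are rescaled by \<open>P\<close>: both
  integrals acquire the same factor \<open>P powr m\<close>, and their ratio is free of
  \<open>P\<close>. This is why \<rho> can later be taken out of an expectation over a random
  \<open>P\<close>.\<close>

lemma stable_intensity_quadratic:
  assumes m: "0 < m" "m < 1" and \<epsilon>: "0 \<le> \<epsilon>"
  shows "(\<integral>\<^sup>+x. 1 - nexp (ennreal x * P + ennreal \<epsilon> * (ennreal x * P)\<^sup>2) \<partial>stable_intensity m) =
    ennreal (quadratic_ratio m \<epsilon>) * (\<integral>\<^sup>+x. 1 - nexp (ennreal x * P) \<partial>stable_intensity m)"
proof -
  consider "P = 0" | "P = \<top>" | p where "P = ennreal p" "0 < p"
    by (cases P) (auto simp: less_le)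
  then show ?thesis
  proof cases
    case 1 then show ?thesis by simp
  next
    case 2
    have i: "(\<integral>\<^sup>+x. 1 - nexp (ennreal x * P) \<partial>stable_intensity m) = (\<integral>\<^sup>+x. 1 \<partial>stable_intensity m)"
      using 2 by (intro nn_integral_stable_intensity_cong) (simp add: ennreal_mult_top)
    have i2: "(\<integral>\<^sup>+x. 1 - nexp (ennreal x * P + ennreal \<epsilon> * (ennreal x * P)\<^sup>2) \<partial>stable_intensity m) =
        (\<integral>\<^sup>+x. 1 \<partial>stable_intensity m)"
      using 2 by (intro nn_integral_stable_intensity_cong) (simp add: ennreal_mult_top)
    let ?I = "\<integral>\<^sup>+x. 1 \<partial>stable_intensity m"
    \<comment> \<open>Constants are invariant under rescaling, so the total mass equals
      \<open>2 powr m\<close> times itself; being positive, it is infinite.\<close>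
    have "?I = \<top>"
    proof -
      have sc: "?I = ennreal (c powr m) * ?I" if "0 < c" for c
        using nn_integral_stable_intensity_scale[of "\<lambda>_. 1" c m] that by simp
      have pos: "0 < ?I" by (rule nn_integral_stable_intensity_pos) auto
      show ?thesis
      proof (rule ccontr)
        assume "?I \<noteq> \<top>"
        then obtain c where c: "?I = ennreal c" "0 < c" using pos by (cases ?I) auto
        have "ennreal c = ennreal (2 powr m * c)"
          using sc[of 2] c by (simp add: ennreal_mult)
        then have "c = 2 powr m * c" using c by simp
        then have "(2::real) powr m = 1" using c by simp
        then show False using m by simp
      qed
    qed
    then show ?thesis
      unfolding i i2 using quadratic_ratio(2)[OF m \<epsilon>] by (simp add: ennreal_mult_top)
  next
    case 3
    have "(\<integral>\<^sup>+x. 1 - nexp (ennreal x * P + ennreal \<delta> * (ennreal x * P)\<^sup>2) \<partial>stable_intensity m) =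
        ennreal (p powr m) * stable_quadratic m \<delta>" if "0 \<le> \<delta>" for \<delta>
    proof -
      have "(\<integral>\<^sup>+x. 1 - nexp (ennreal x * P + ennreal \<delta> * (ennreal x * P)\<^sup>2) \<partial>stable_intensity m) =
          (\<integral>\<^sup>+x. 1 - nexp (ennreal (p * x + \<delta> * (p * x)\<^sup>2)) \<partial>stable_intensity m)"
        using 3 that by (intro nn_integral_stable_intensity_cong)
          (simp add: ennreal_mult[symmetric] ennreal_power mult.commute[of p] flip: ennreal_plus)
      then show ?thesis
        unfolding stable_quadratic_def
        using 3 by (simp add: nn_integral_stable_intensity_scale[where f="\<lambda>x. 1 - nexp (ennreal (x + \<delta> * x\<^sup>2))"])
    qed
    from this[of \<epsilon>] this[of 0] show ?thesis
      using quadratic_ratio(1)[OF m \<epsilon>] \<epsilon> by (simp add: mult_ac)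
  qed
qed


section \<open>Laws determined by Laplace transforms\<close>

text \<open>By Weierstrass, the numbers \<open>E (exp (- v X))\<close>, which are moments of \<open>exp (- X)\<close> for natural
  \<open>v\<close>, determine the law of \<open>X\<close>.\<close>

lemma (in prob_space) nexp_integral_determines:
  fixes X Y :: "'a \<Rightarrow> ennreal" and g :: "real \<Rightarrow> real"
  assumes [measurable]: "X \<in> borel_measurable M" "Y \<in> borel_measurable M"
    and eq: "\<And>v. 0 < v \<Longrightarrow> (\<integral>\<^sup>+\<omega>. nexp (ennreal v * X \<omega>) \<partial>M) = (\<integral>\<^sup>+\<omega>. nexp (ennreal v * Y \<omega>) \<partial>M)"
    and g: "continuous_on {0..1} g" and [measurable]: "g \<in> borel_measurable borel"
  shows "(\<integral>\<omega>. g (enn2real (nexp (X \<omega>))) \<partial>M) = (\<integral>\<omega>. g (enn2real (nexp (Y \<omega>))) \<partial>M)"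
proof -
  define x where "x Z \<omega> = enn2real (nexp (Z \<omega>))" for Z :: "'a \<Rightarrow> ennreal" and \<omega>
  have x01: "x Z \<omega> \<in> {0..1}" for Z \<omega>
    using nexp_le_1[of "Z \<omega>"] by (auto simp: x_def intro!: enn2real_leI)
  have xm: "x X \<in> borel_measurable M" "x Y \<in> borel_measurable M"
    unfolding x_def by measurable
  have pw: "ennreal (x Z \<omega> ^ i) = nexp (ennreal (real i) * Z \<omega>)" for Z \<omega> i
  proof (induction i)
    case (Suc i)
    have "ennreal (x Z \<omega> ^ Suc i) = nexp (Z \<omega>) * ennreal (x Z \<omega> ^ i)"
      using x01[of Z \<omega>] by (simp add: ennreal_mult x_def)
    also have "\<dots> = nexp (Z \<omega> + ennreal (real i) * Z \<omega>)"
      by (simp only: Suc nexp_add)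
    also have "Z \<omega> + ennreal (real i) * Z \<omega> = ennreal (real (Suc i)) * Z \<omega>"
      by (simp add: distrib_right)
    finally show ?case .
  qed simp
  \<comment> \<open>The moment of order \<open>i\<close> is the transform at \<open>v = i\<close>;
    order 0 is separate because \<open>eq\<close> speaks of positive parameters.\<close>
  have mom: "(\<integral>\<omega>. x X \<omega> ^ i \<partial>M) = (\<integral>\<omega>. x Y \<omega> ^ i \<partial>M)" for i
  proof (cases "i = 0")
    case False
    have "(\<integral>\<^sup>+\<omega>. ennreal (x X \<omega> ^ i) \<partial>M) = (\<integral>\<^sup>+\<omega>. ennreal (x Y \<omega> ^ i) \<partial>M)"
      unfolding pw using False by (intro eq) simp
    moreover have "(\<integral>\<omega>. x Z \<omega> ^ i \<partial>M) = enn2real (\<integral>\<^sup>+\<omega>. ennreal (x Z \<omega> ^ i) \<partial>M)"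
      if "x Z \<in> borel_measurable M" for Z
      using that x01[of Z] by (intro integral_eq_nn_integral) auto
    ultimately show ?thesis using xm by simp
  qed simp
  have "\<bar>(\<integral>\<omega>. g (x X \<omega>) \<partial>M) - (\<integral>\<omega>. g (x Y \<omega>) \<partial>M)\<bar> \<le> e" if e: "0 < e" for e
  proof -
    obtain p where p: "real_polynomial_function p" "\<And>y. y \<in> {0..1} \<Longrightarrow> \<bar>g y - p y\<bar> < e / 2"
      using Stone_Weierstrass_real_polynomial_function[OF _ g, of "e / 2"] e by auto
    obtain a n where pa: "p = (\<lambda>y. \<Sum>i\<le>n. a i * y ^ i)"
      using p(1) by (auto simp: real_polynomial_function_iff_sum)
    have pm[measurable]: "p \<in> borel_measurable borel" unfolding pa by measurable
    have "compact (g ` {0..1})" using g by (intro compact_continuous_image) auto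
    then obtain B where B: "\<And>y. y \<in> {0..1} \<Longrightarrow> \<bar>g y\<bar> \<le> B"
      using compact_imp_bounded by (fastforce simp: bounded_iff)
    have gi: "integrable M (\<lambda>\<omega>. g (x Z \<omega>))" if "x Z \<in> borel_measurable M" for Z
      using that B x01 by (intro integrable_const_bound[where B=B]) auto
    have xi: "integrable M (\<lambda>\<omega>. x Z \<omega> ^ i)" if "x Z \<in> borel_measurable M" for Z i
      using that x01[of Z] by (intro integrable_const_bound[where B=1]) (auto simp: power_le_one)
    have pint: "integrable M (\<lambda>\<omega>. p (x Z \<omega>))" "(\<integral>\<omega>. p (x Z \<omega>) \<partial>M) = (\<Sum>i\<le>n. a i * (\<integral>\<omega>. x Z \<omega> ^ i \<partial>M))"
      if "x Z \<in> borel_measurable M" for Z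
      unfolding pa using xi[OF that] by simp_all
    have d: "\<bar>(\<integral>\<omega>. g (x Z \<omega>) \<partial>M) - (\<integral>\<omega>. p (x Z \<omega>) \<partial>M)\<bar> \<le> e / 2" if "x Z \<in> borel_measurable M" for Z
    proof -
      have "\<bar>(\<integral>\<omega>. g (x Z \<omega>) - p (x Z \<omega>) \<partial>M)\<bar> \<le> (\<integral>\<omega>. \<bar>g (x Z \<omega>) - p (x Z \<omega>)\<bar> \<partial>M)"
        by (rule integral_abs_bound)
      also have "\<dots> \<le> (\<integral>\<omega>. e / 2 \<partial>M)"
        using gi[OF that] pint(1)[OF that] p(2)[OF x01] by (intro integral_mono) (auto intro: less_imp_le)
      finally show ?thesis
        using gi[OF that] pint(1)[OF that] by (simp add: prob_space)
    qed
    have "(\<integral>\<omega>. p (x X \<omega>) \<partial>M) = (\<integral>\<omega>. p (x Y \<omega>) \<partial>M)"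
      using pint(2) xm mom by simp
    then show ?thesis using d[OF xm(1)] d[OF xm(2)] by linarith
  qed
  then have "(\<integral>\<omega>. g (x X \<omega>) \<partial>M) - (\<integral>\<omega>. g (x Y \<omega>) \<partial>M) = 0"
    by (metis abs_le_zero_iff dense_ge le_less_linear)
  then show ?thesis by (simp add: x_def)
qed

text \<open>With \<open>y = exp (- X)\<close> the integrand is
  \<open>y * exp (- \<epsilon> * (ln y)^2)\<close>, which extends continuously by 0 to
  \<open>y = 0\<close>, the image of \<open>X = \<infinity>\<close>. It is thus a continuous test
  function on [0, 1].\<close>

lemma (in prob_space) nexp_quadratic_determined:
  fixes X Y :: "'a \<Rightarrow> ennreal"
  assumes [measurable]: "X \<in> borel_measurable M" "Y \<in> borel_measurable M"
    and eq: "\<And>v. 0 < v \<Longrightarrow> (\<integral>\<^sup>+\<omega>. nexp (ennreal v * X \<omega>) \<partial>M) = (\<integral>\<^sup>+\<omega>. nexp (ennreal v * Y \<omega>) \<partial>M)"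
    and \<epsilon>: "0 \<le> \<epsilon>"
  shows "(\<integral>\<^sup>+\<omega>. nexp (X \<omega> + ennreal \<epsilon> * (X \<omega>)\<^sup>2) \<partial>M) = (\<integral>\<^sup>+\<omega>. nexp (Y \<omega> + ennreal \<epsilon> * (Y \<omega>)\<^sup>2) \<partial>M)"
proof -
  define g where "g y = (if y \<le> 0 then 0 else y * exp (- \<epsilon> * (ln y)\<^sup>2))" for y :: real
  have gm[measurable]: "g \<in> borel_measurable borel" unfolding g_def by measurable
  have g0: "g y \<ge> 0" and gle: "g y \<le> \<bar>y\<bar>" for y
    using \<epsilon> by (auto simp: g_def mult_left_le)
  have "continuous_on {0..1} g"
  proof (clarsimp simp: continuous_on_eq_continuous_within)
    fix y :: real assume y: "0 \<le> y" "y \<le> 1"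
    show "continuous (at y within {0..1}) g"
    proof (cases "y = 0")
      case True
      have "(g \<longlongrightarrow> 0) (at 0 within {0..1})"
      proof (rule tendsto_sandwich[where f="\<lambda>_. 0" and h="\<lambda>y. \<bar>y\<bar>"])
        show "((\<lambda>y::real. \<bar>y\<bar>) \<longlongrightarrow> 0) (at 0 within {0..1})" by (auto intro!: tendsto_eq_intros)
      qed (auto simp: g0 gle)
      then show ?thesis using True by (simp add: continuous_within g_def)
    next
      case False
      then have "0 < y" using y by simp
      have "eventually (\<lambda>z. z \<in> {0<..}) (nhds y)"
        using \<open>0 < y\<close> by (intro eventually_nhds_in_open) auto
      then have "eventually (\<lambda>z. g z = z * exp (- \<epsilon> * (ln z)\<^sup>2)) (nhds y)"
        by (rule eventually_mono) (simp add: g_def)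
      then have "isCont g y \<longleftrightarrow> isCont (\<lambda>y. y * exp (- \<epsilon> * (ln y)\<^sup>2)) y"
        by (rule isCont_cong)
      moreover have "isCont (\<lambda>y. y * exp (- \<epsilon> * (ln y)\<^sup>2)) y"
        using \<open>0 < y\<close> by (auto intro!: continuous_intros)
      ultimately have "isCont g y" by blast
      then show ?thesis by (rule continuous_at_imp_continuous_at_within)
    qed
  qed
  from nexp_integral_determines[OF assms(1-3) this gm]
  have "(\<integral>\<omega>. g (enn2real (nexp (X \<omega>))) \<partial>M) = (\<integral>\<omega>. g (enn2real (nexp (Y \<omega>))) \<partial>M)" by simp
  moreover have "ennreal (\<integral>\<omega>. g (enn2real (nexp (Z \<omega>))) \<partial>M) = (\<integral>\<^sup>+\<omega>. nexp (Z \<omega> + ennreal \<epsilon> * (Z \<omega>)\<^sup>2) \<partial>M)"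
    if [measurable]: "Z \<in> borel_measurable M" for Z
  proof -
    have "ennreal (g (enn2real (nexp (Z \<omega>)))) = nexp (Z \<omega> + ennreal \<epsilon> * (Z \<omega>)\<^sup>2)" for \<omega>
    proof (cases "Z \<omega>")
      case (real r)
      then have "Z \<omega> + ennreal \<epsilon> * (Z \<omega>)\<^sup>2 = ennreal (r + \<epsilon> * r\<^sup>2)"
        using \<epsilon> by (simp add: ennreal_power ennreal_mult)
      moreover have "nexp (ennreal (r + \<epsilon> * r\<^sup>2)) = ennreal (exp (- (r + \<epsilon> * r\<^sup>2)))"
        using real \<epsilon> by (intro nexp_ennreal) simp
      ultimately show ?thesis using real by (simp add: nexp_ennreal g_def mult_exp_exp)
    qed (simp add: g_def)
    moreover have "integrable M (\<lambda>\<omega>. g (enn2real (nexp (Z \<omega>))))"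
    proof (rule integrable_const_bound[where B=1])
      show "AE \<omega> in M. norm (g (enn2real (nexp (Z \<omega>)))) \<le> 1"
      proof (intro AE_I2)
        fix \<omega>
        have "enn2real (nexp (Z \<omega>)) \<le> 1" by (intro enn2real_leI) (auto simp: nexp_le_1)
        then show "norm (g (enn2real (nexp (Z \<omega>)))) \<le> 1"
          using g0[of "enn2real (nexp (Z \<omega>))"] gle[of "enn2real (nexp (Z \<omega>))"]
          by (simp only: real_norm_def abs_of_nonneg abs_of_nonneg[OF enn2real_nonneg])
      qed
    qed measurable
    ultimately show ?thesis by (subst nn_integral_eq_integral[symmetric]) (auto simp: g0)
  qed
  ultimately show ?thesis by (metis assms(1,2))
qed

section \<open>Laplace transforms on the tree\<close>

abbreviation vec :: "('j \<Rightarrow> real) measure" where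
  "vec \<equiv> Pi\<^sub>M UNIV (\<lambda>_. borel)"

definition vadd :: "('j \<Rightarrow> real) \<Rightarrow> ('j \<Rightarrow> real) \<Rightarrow> 'j \<Rightarrow> real" where
  "vadd s v = (\<lambda>j. s j + v j)"

lemma measurable_vec_apply [measurable]: "(\<lambda>x. x j) \<in> borel_measurable vec"
  by (rule measurable_component_singleton) simp

lemma measurable_vecI: "(\<And>j. (\<lambda>x. f x j) \<in> borel_measurable M) \<Longrightarrow> f \<in> measurable M vec"
  by (rule measurable_PiM_single') (auto simp: space_PiM)

lemma measurable_vadd [measurable (raw)]:
  assumes "f \<in> measurable M vec" "g \<in> measurable M vec"
  shows "(\<lambda>x. vadd (f x) (g x)) \<in> measurable M vec"
proof (rule measurable_vecI)
  fix j
  have "(\<lambda>x. f x j) \<in> borel_measurable M" "(\<lambda>x. g x j) \<in> borel_measurable M"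
    using measurable_compose[OF assms(1) measurable_vec_apply] measurable_compose[OF assms(2) measurable_vec_apply]
    by auto
  then show "(\<lambda>x. vadd (f x) (g x) j) \<in> borel_measurable M"
    unfolding vadd_def by measurable
qed

lemma measurable_vadd_left: "vadd s \<in> measurable vec vec"
  by (rule measurable_vecI) (simp add: vadd_def)

text \<open>The sources of randomness: \<open>Weights p\<close> carries the points at the children of the node \<open>p\<close> (on the
  coordinates \<open>Inl\<close>), \<open>Mark p\<close> the Gaussian column at \<open>p\<close>, and \<open>External\<close> the process \<open>H\<^sub>N\<close> (on the coordinates
  \<open>Inr\<close>). A state is a partial sum of marks along a path, together with the values of \<open>H\<^sub>N\<close>.\<close>

datatype source = Weights "nat list" | Mark "nat list" | External

type_synonym 's state = "nat + 's \<Rightarrow> real"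

text \<open>\<open>n\<close> counts the levels still below \<open>p\<close>, and \<open>s\<close>
  already contains the mark of \<open>p\<close>: a mark is added on entering a child, before the
  recursive call.\<close>

fun partition_fun :: "('s state \<Rightarrow> ennreal) \<Rightarrow> (source \<Rightarrow> 's state) \<Rightarrow> nat \<Rightarrow> nat list \<Rightarrow> 's state \<Rightarrow> ennreal" where
  "partition_fun F d 0 p s = F s"
| "partition_fun F d (Suc n) p s =
     (\<Sum>i. ennreal (d (Weights p) (Inl i)) * partition_fun F d n (p @ [i]) (vadd s (d (Mark (p @ [i])))))"

text \<open>The squares are taken at the nodes \<open>j\<close> levels below \<open>p\<close>. The
  truncated subtraction \<open>n - 1\<close> is exact for \<open>j \<le> n\<close>, the range in
  which the function is used.\<close>

fun square_sum :: "('s state \<Rightarrow> ennreal) \<Rightarrow> (source \<Rightarrow> 's state) \<Rightarrow> nat \<Rightarrow> nat \<Rightarrow> nat list \<Rightarrow> 's state \<Rightarrow> ennreal" where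
  "square_sum F d 0 n p s = (partition_fun F d n p s)\<^sup>2"
| "square_sum F d (Suc j) n p s =
     (\<Sum>i. (ennreal (d (Weights p) (Inl i)))\<^sup>2 * square_sum F d j (n - 1) (p @ [i]) (vadd s (d (Mark (p @ [i])))))"

text \<open>What \<open>partition_fun\<close> reads at \<open>p\<close>; \<open>Mark p\<close> is
  absent because it enters through \<open>s\<close>.\<close>

fun sources_below :: "nat \<Rightarrow> nat list \<Rightarrow> source set" where
  "sources_below 0 p = {}"
| "sources_below (Suc n) p = insert (Weights p) (\<Union>i. insert (Mark (p @ [i])) (sources_below n (p @ [i])))"

text \<open>A partition function is thus a function of the sources in its own subtree, so the
  independence of disjoint subtrees can be applied to it.\<close>

lemma partition_fun_cong:
  "(\<And>a. a \<in> sources_below n p \<Longrightarrow> d a = d' a) \<Longrightarrow> partition_fun F d n p s = partition_fun F d' n p s"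
proof (induction n arbitrary: p s)
  case (Suc n)
  have "partition_fun F d n (p @ [i]) t = partition_fun F d' n (p @ [i]) t" for i t
    using Suc.prems by (intro Suc.IH) auto
  moreover have "d (Weights p) = d' (Weights p)" "\<And>i. d (Mark (p @ [i])) = d' (Mark (p @ [i]))"
    using Suc.prems by auto
  ultimately show ?case by simp
qed simp

lemma square_sum_cong:
  "j \<le> n \<Longrightarrow> (\<And>a. a \<in> sources_below n p \<Longrightarrow> d a = d' a) \<Longrightarrow> square_sum F d j n p s = square_sum F d' j n p s"
proof (induction j arbitrary: n p s)
  case 0
  then show ?case using partition_fun_cong[of n p d d' F s] by simp
next
  case (Suc j)
  then obtain n' where n: "n = Suc n'" by (cases n) auto
  have "square_sum F d j n' (p @ [i]) t = square_sum F d' j n' (p @ [i]) t" for i t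
    using Suc.prems n by (intro Suc.IH) auto
  moreover have "d (Weights p) = d' (Weights p)" "\<And>i. d (Mark (p @ [i])) = d' (Mark (p @ [i]))"
    using Suc.prems n by auto
  ultimately show ?case by (simp add: n)
qed

text \<open>State and data are functions on a common space, because in the recursion the state
  depends on the marks already read.\<close>

lemma measurable_partition_fun:
  assumes F: "F \<in> borel_measurable vec"
  shows "sources_below n p \<subseteq> A \<Longrightarrow> s \<in> measurable N vec \<Longrightarrow> d \<in> measurable N (Pi\<^sub>M A (\<lambda>_. vec)) \<Longrightarrow>
    (\<lambda>x. partition_fun F (d x) n p (s x)) \<in> borel_measurable N"
proof (induction n arbitrary: p s)
  case 0
  then show ?case using measurable_compose[OF 0(2) F] by simp
next
  case (Suc n)
  have d: "(\<lambda>x. d x a) \<in> measurable N vec" if "a \<in> A" for a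
    by (rule measurable_compose[OF Suc.prems(3) measurable_component_singleton[OF that]])
  have "(\<lambda>x. d x (Weights p)) \<in> measurable N vec" using Suc.prems by (intro d) auto
  from measurable_compose[OF this measurable_vec_apply]
  have [measurable]: "(\<lambda>x. d x (Weights p) j) \<in> borel_measurable N" for j .
  have [measurable]: "(\<lambda>x. partition_fun F (d x) n (p @ [i]) (vadd (s x) (d x (Mark (p @ [i]))))) \<in> borel_measurable N" for i
    using Suc.prems by (intro Suc.IH measurable_vadd d) auto
  show ?case by simp
qed

lemma measurable_square_sum:
  assumes F: "F \<in> borel_measurable vec"
  shows "j \<le> n \<Longrightarrow> sources_below n p \<subseteq> A \<Longrightarrow> s \<in> measurable N vec \<Longrightarrow> d \<in> measurable N (Pi\<^sub>M A (\<lambda>_. vec)) \<Longrightarrow>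
    (\<lambda>x. square_sum F (d x) j n p (s x)) \<in> borel_measurable N"
proof (induction j arbitrary: n p s)
  case 0
  then show ?case using measurable_partition_fun[OF F 0(2-4)] by simp
next
  case (Suc j)
  then obtain n' where n: "n = Suc n'" by (cases n) auto
  have d: "(\<lambda>x. d x a) \<in> measurable N vec" if "a \<in> A" for a
    by (rule measurable_compose[OF Suc.prems(4) measurable_component_singleton[OF that]])
  have "(\<lambda>x. d x (Weights p)) \<in> measurable N vec" using Suc.prems n by (intro d) auto
  from measurable_compose[OF this measurable_vec_apply]
  have [measurable]: "(\<lambda>x. d x (Weights p) j) \<in> borel_measurable N" for j .
  have [measurable]: "(\<lambda>x. square_sum F (d x) j n' (p @ [i]) (vadd (s x) (d x (Mark (p @ [i]))))) \<in> borel_measurable N" for i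
    using Suc.prems n by (intro Suc.IH measurable_vadd d) auto
  show ?case by (simp add: n)
qed

text \<open>The leaves get the exponent \<open>a (Suc k) = 1\<close>, which makes them an ordinary level of the recursion.
  The submultiplicative weight \<open>G\<close> controls the growth of \<open>F\<close>; it makes all the conditional
  expectations below finite for every value of the state.\<close>

locale marked_cascade = prob_space M for M :: "'w measure" +
  fixes D :: "source \<Rightarrow> 'w \<Rightarrow> 's state" and k :: nat and a :: "nat \<Rightarrow> real"
    and F G :: "'s state \<Rightarrow> ennreal" and \<nu> :: "nat \<Rightarrow> 's state measure"
  assumes indep: "indep_vars (\<lambda>_. vec) D (insert External (insert (Mark []) (sources_below k [])))"
    and laplace: "\<And>p f. length p < k \<Longrightarrow> f \<in> borel_measurable borel \<Longrightarrow>
      (\<integral>\<^sup>+\<omega>. nexp (\<Sum>i. f (D (Weights p) \<omega> (Inl i))) \<partial>M) =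
      nexp (\<integral>\<^sup>+y. 1 - nexp (f y) \<partial>stable_intensity (a (Suc (length p))))"
    and weights_pos: "\<And>p. length p < k \<Longrightarrow> AE \<omega> in M. \<forall>i. 0 < D (Weights p) \<omega> (Inl i)"
    and mark_law: "\<And>p. 1 \<le> length p \<Longrightarrow> length p \<le> k \<Longrightarrow> distr M vec (D (Mark p)) = \<nu> (length p)"
    and k_pos: "1 \<le> k"
    and a_pos: "0 < a 1" and a_less: "\<And>l. 1 \<le> l \<Longrightarrow> l \<le> k \<Longrightarrow> a l < a (Suc l)" and a_last: "a (Suc k) = 1"
    and F_meas: "F \<in> borel_measurable vec" and F_pos: "\<And>s. 0 < F s"
    and G_meas: "G \<in> borel_measurable vec" and G_ge_1: "\<And>s. 1 \<le> G s" and G_finite: "\<And>s. G s < \<top>"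
    and G_vadd: "\<And>s v. G (vadd s v) \<le> G s * G v"
    and G_integral: "\<And>l. 1 \<le> l \<Longrightarrow> l \<le> k \<Longrightarrow> (\<integral>\<^sup>+v. G v \<partial>\<nu> l) < \<top>"
    and F_le: "\<exists>K\<ge>0. \<forall>s. F s \<le> ennreal K * G s"
begin

abbreviation sources :: "source set" where
  "sources \<equiv> insert External (insert (Mark []) (sources_below k []))"

section \<open>Exponents and the sources of a subtree\<close>

lemma a_range:
  assumes "1 \<le> l" "l \<le> Suc k" shows "0 < a l" "a l \<le> 1"
proof -
  have "a 1 \<le> a l"
    using assms by (induction l rule: dec_induct) (auto intro: order_trans[OF _ less_imp_le[OF a_less]])
  then show "0 < a l" using a_pos by simp
  have "l \<le> Suc k \<Longrightarrow> 1 \<le> l \<Longrightarrow> a l \<le> a (Suc k)"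
    by (induction l rule: inc_induct) (auto intro!: order_trans[OF less_imp_le[OF a_less]])
  then show "a l \<le> 1" using assms a_last by simp
qed

lemma sources_below_subset: "length p + n = k \<Longrightarrow> sources_below n p \<subseteq> sources_below k []"
proof (induction p arbitrary: n rule: rev_induct)
  case (snoc x p)
  then have "sources_below (Suc n) p \<subseteq> sources_below k []" by (intro snoc.IH) simp
  then show ?case by auto
qed simp

lemma Mark_in_sources:
  assumes "length q \<le> k" shows "Mark q \<in> sources"
proof (cases q rule: rev_cases)
  case (snoc p x)
  then have "sources_below (Suc (k - Suc (length p))) p \<subseteq> sources_below k []"
    using assms by (intro sources_below_subset) simp
  then show ?thesis using snoc by auto
qed simp

text \<open>Labels below \<open>p\<close> extend \<open>p\<close>. The length inequality is strict
  for marks and weak for weights, since \<open>Weights p\<close> itself can occur.\<close>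

lemma sources_below_prefix:
  "Mark q \<in> sources_below n p \<Longrightarrow> length p < length q \<and> take (length p) q = p"
  "Weights q \<in> sources_below n p \<Longrightarrow> length p \<le> length q \<and> take (length p) q = p"
  "External \<notin> sources_below n p"
proof -
  have "(\<forall>q. Mark q \<in> sources_below n p \<longrightarrow> length p < length q \<and> take (length p) q = p) \<and>
    (\<forall>q. Weights q \<in> sources_below n p \<longrightarrow> length p \<le> length q \<and> take (length p) q = p) \<and>
    External \<notin> sources_below n p"
  proof (induction n arbitrary: p)
    case (Suc n)
    have *: "take (length p) q = p" if "take (length (p @ [i])) q = p @ [i]" for q i
    proof -
      have "take (length p) (take (length (p @ [i])) q) = take (length p) (p @ [i])"
        by (simp only: that)
      then show ?thesis by simp
    qed
    show ?case
    proof (intro conjI allI impI)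
      fix q assume "Mark q \<in> sources_below (Suc n) p"
      then obtain i where "q = p @ [i] \<or> Mark q \<in> sources_below n (p @ [i])" by auto
      then show "length p < length q" "take (length p) q = p"
        using Suc[of "p @ [i]"] *[of i q] by auto
    next
      fix q assume "Weights q \<in> sources_below (Suc n) p"
      then obtain i where "q = p \<or> Weights q \<in> sources_below n (p @ [i])" by auto
      then show "length p \<le> length q" "take (length p) q = p"
        using Suc[of "p @ [i]"] *[of i q] by auto
    next
      show "External \<notin> sources_below (Suc n) p" using Suc by auto
    qed
  qed simp
  then show "Mark q \<in> sources_below n p \<Longrightarrow> length p < length q \<and> take (length p) q = p"
    "Weights q \<in> sources_below n p \<Longrightarrow> length p \<le> length q \<and> take (length p) q = p"
    "External \<notin> sources_below n p"
    by auto
qed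

abbreviation subtree :: "nat \<Rightarrow> nat list \<Rightarrow> source set" where
  "subtree n q \<equiv> insert (Mark q) (sources_below n q)"

text \<open>The first \<open>Suc (length p)\<close> entries of a label tell to which child's subtree
  the source belongs.\<close>

lemma subtree_disjoint: "disjoint_family (\<lambda>i. subtree n (p @ [i]))"
proof -
  have key: "take (Suc (length p)) q = p @ [i]" if "b \<in> subtree n (p @ [i])" "b = Mark q \<or> b = Weights q" for b q i
    using that sources_below_prefix(1,2)[of q n "p @ [i]"] by auto
  have "b \<noteq> External" if "b \<in> subtree n (p @ [i])" for b i
    using that sources_below_prefix(3)[of n "p @ [i]"] by auto
  then have "i = j" if "b \<in> subtree n (p @ [i])" "b \<in> subtree n (p @ [j])" for b i j
    using key[OF that(1)] key[OF that(2)] that by (cases b) auto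
  then show ?thesis by (auto simp only: disjoint_family_on_def)
qed

lemma Weights_not_in_subtree: "Weights p \<notin> subtree n (p @ [i])"
  using sources_below_prefix(2)[of p n "p @ [i]"] by auto

lemma Mark_not_in_below: "Mark p \<notin> sources_below n p"
  using sources_below_prefix(1)[of p n p] by auto

section \<open>Independence of disjoint groups of sources\<close>

lemma D_measurable: "b \<in> sources \<Longrightarrow> D b \<in> measurable M vec"
  using indep by (auto simp: indep_vars_def)

text \<open>The restriction makes this a point of the product space over \<open>A\<close>, the form
  in which \<open>indep_vars\<close> yields independence of groups.\<close>

definition data :: "source set \<Rightarrow> 'w \<Rightarrow> source \<Rightarrow> 's state" where
  "data A \<omega> = restrict (\<lambda>b. D b \<omega>) A"

lemma data_apply: "b \<in> A \<Longrightarrow> data A \<omega> b = D b \<omega>"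
  by (simp add: data_def)

lemma data_measurable: "A \<subseteq> sources \<Longrightarrow> data A \<in> measurable M (Pi\<^sub>M A (\<lambda>_. vec))"
  unfolding data_def[abs_def] by (intro measurable_restrict D_measurable) auto

text \<open>Independence makes the joint law of the two groups a product. In the iterated integral
  \<open>\<omega>'\<close> acts as an independent copy of the sample, so one group can be
  frozen.\<close>

lemma nn_integral_independent:
  assumes "A \<subseteq> sources" "B \<subseteq> sources" "A \<inter> B = {}"
    and f: "(\<lambda>(x, y). f x y) \<in> borel_measurable (Pi\<^sub>M A (\<lambda>_. vec) \<Otimes>\<^sub>M Pi\<^sub>M B (\<lambda>_. vec))"
  shows "(\<integral>\<^sup>+\<omega>. f (data A \<omega>) (data B \<omega>) \<partial>M) = (\<integral>\<^sup>+\<omega>. \<integral>\<^sup>+\<omega>'. f (data A \<omega>) (data B \<omega>') \<partial>M \<partial>M)"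
proof -
  let ?A = "Pi\<^sub>M A (\<lambda>_. vec) :: (source \<Rightarrow> 's state) measure"
  let ?B = "Pi\<^sub>M B (\<lambda>_. vec) :: (source \<Rightarrow> 's state) measure"
  have Am[measurable]: "data A \<in> measurable M ?A" and Bm[measurable]: "data B \<in> measurable M ?B"
    using assms by (auto intro: data_measurable)
  interpret A: prob_space "distr M ?A (data A)" by (rule prob_space_distr[OF Am])
  interpret B: prob_space "distr M ?B (data B)" by (rule prob_space_distr[OF Bm])
  have "indep_var ?A (data A) ?B (data B)"
    unfolding data_def[abs_def] by (rule indep_var_restrict[OF indep]) (use assms in auto)
  then have eq: "distr M ?A (data A) \<Otimes>\<^sub>M distr M ?B (data B) = distr M (?A \<Otimes>\<^sub>M ?B) (\<lambda>\<omega>. (data A \<omega>, data B \<omega>))"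
    by (simp add: indep_var_distribution_eq)
  have "(\<integral>\<^sup>+\<omega>. f (data A \<omega>) (data B \<omega>) \<partial>M) =
      (\<integral>\<^sup>+z. (\<lambda>(x, y). f x y) z \<partial>distr M (?A \<Otimes>\<^sub>M ?B) (\<lambda>\<omega>. (data A \<omega>, data B \<omega>)))"
    using f by (subst nn_integral_distr) auto
  also have "\<dots> = (\<integral>\<^sup>+x. \<integral>\<^sup>+y. f x y \<partial>distr M ?B (data B) \<partial>distr M ?A (data A))"
    unfolding eq[symmetric] using f by (subst B.nn_integral_fst[symmetric]) auto
  also have "\<dots> = (\<integral>\<^sup>+x. \<integral>\<^sup>+\<omega>'. f x (data B \<omega>') \<partial>M \<partial>distr M ?A (data A))"
    using f by (intro nn_integral_cong nn_integral_distr Bm measurable_compose_Pair1[OF _ f, simplified]) auto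
  also have "\<dots> = (\<integral>\<^sup>+\<omega>. \<integral>\<^sup>+\<omega>'. f (data A \<omega>) (data B \<omega>') \<partial>M \<partial>M)"
  proof -
    have "(\<lambda>(x, \<omega>'). f x (data B \<omega>')) \<in> borel_measurable (?A \<Otimes>\<^sub>M M)"
      using measurable_compose[OF _ f, of "\<lambda>(x, \<omega>'). (x, data B \<omega>')" "?A \<Otimes>\<^sub>M M"]
      by (simp add: split_beta')
    from borel_measurable_nn_integral[OF this] show ?thesis by (subst nn_integral_distr[OF Am]) simp_all
  qed
  finally show ?thesis .
qed


text \<open>The mark of \<open>q\<close> is independent of the sources below \<open>q\<close> and
  can be integrated out under its law, which depends on the level alone.\<close>

lemma nn_integral_Mark:
  assumes q: "1 \<le> length q" "length q + n = k"
    and f: "(\<lambda>(v, y). f v y) \<in> borel_measurable (vec \<Otimes>\<^sub>M Pi\<^sub>M (sources_below n q) (\<lambda>_. vec))"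
  shows "(\<integral>\<^sup>+\<omega>. f (D (Mark q) \<omega>) (data (sources_below n q) \<omega>) \<partial>M) =
    (\<integral>\<^sup>+v. \<integral>\<^sup>+\<omega>. f v (data (sources_below n q) \<omega>) \<partial>M \<partial>\<nu> (length q))"
proof -
  let ?B = "sources_below n q"
  have Bs: "?B \<subseteq> sources" using sources_below_subset[OF q(2)] by auto
  have qs: "Mark q \<in> sources" using q by (intro Mark_in_sources) simp
  have Bm: "data ?B \<in> measurable M (Pi\<^sub>M ?B (\<lambda>_. vec))" by (rule data_measurable[OF Bs])
  have "(\<lambda>(x, y). f (x (Mark q)) y) \<in> borel_measurable (Pi\<^sub>M {Mark q} (\<lambda>_. vec) \<Otimes>\<^sub>M Pi\<^sub>M ?B (\<lambda>_. vec))"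
  proof -
    have "(\<lambda>z. (fst z (Mark q), snd z)) \<in>
        measurable (Pi\<^sub>M {Mark q} (\<lambda>_. vec) \<Otimes>\<^sub>M Pi\<^sub>M ?B (\<lambda>_. vec)) (vec \<Otimes>\<^sub>M Pi\<^sub>M ?B (\<lambda>_. vec))"
      by (intro measurable_Pair measurable_snd measurable_compose[OF measurable_fst measurable_component_singleton]) simp
    from measurable_compose[OF this f] show ?thesis by (simp add: split_beta')
  qed
  from nn_integral_independent[OF _ Bs _ this] qs Mark_not_in_below[of q n]
  have "(\<integral>\<^sup>+\<omega>. f (D (Mark q) \<omega>) (data ?B \<omega>) \<partial>M) = (\<integral>\<^sup>+\<omega>. \<integral>\<^sup>+\<omega>'. f (D (Mark q) \<omega>) (data ?B \<omega>') \<partial>M \<partial>M)"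
    by (simp add: data_apply)
  also have "\<dots> = (\<integral>\<^sup>+v. \<integral>\<^sup>+\<omega>'. f v (data ?B \<omega>') \<partial>M \<partial>distr M vec (D (Mark q)))"
  proof -
    have "(\<lambda>(x, \<omega>'). f x (data ?B \<omega>')) \<in> borel_measurable (vec \<Otimes>\<^sub>M M)"
      using measurable_compose[OF _ f, of "\<lambda>(x, \<omega>'). (x, data ?B \<omega>')" "vec \<Otimes>\<^sub>M M"] Bm
      by (simp add: split_beta')
    from borel_measurable_nn_integral[OF this] show ?thesis
      by (subst nn_integral_distr[OF D_measurable[OF qs]]) simp_all
  qed
  also have "distr M vec (D (Mark q)) = \<nu> (length q)" using q by (intro mark_law) auto
  finally show ?thesis .
qed

lemma prob_space_mark_law: "1 \<le> l \<Longrightarrow> l \<le> k \<Longrightarrow> prob_space (\<nu> l)"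
  and sets_mark_law: "1 \<le> l \<Longrightarrow> l \<le> k \<Longrightarrow> sets (\<nu> l) = sets vec"
proof -
  assume l: "1 \<le> l" "l \<le> k"
  \<comment> \<open>Any node of level \<open>l\<close> carries a mark with law
    \<open>\<nu> l\<close>; this one serves as a sample.\<close>
  let ?q = "replicate l (0::nat)"
  have "distr M vec (D (Mark ?q)) = \<nu> l" using mark_law[of ?q] l by simp
  moreover have "D (Mark ?q) \<in> measurable M vec" using l by (intro D_measurable Mark_in_sources) simp
  ultimately show "prob_space (\<nu> l)" "sets (\<nu> l) = sets vec"
    using prob_space_distr by (metis, metis sets_distr)
qed

text \<open>One step of the recursion: by the Laplace functional of the Poisson process, the subtrees
  below the children of \<open>p\<close> enter only through their common Laplace transform \<open>\<phi>\<close>, and the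
  scaling of the intensity extracts the power of \<open>c\<close>.\<close>

lemma laplace_step:
  fixes P Q :: "nat \<Rightarrow> (source \<Rightarrow> 's state) \<Rightarrow> ennreal"
  assumes p: "length p + Suc n = k" and c: "0 < c"
    and P: "\<And>i. P i \<in> borel_measurable (Pi\<^sub>M (subtree n (p @ [i])) (\<lambda>_. vec))"
    and Q: "\<And>i. Q i \<in> borel_measurable (Pi\<^sub>M (subtree n (p @ [i])) (\<lambda>_. vec))"
    and \<phi>: "\<And>i v. 0 < v \<Longrightarrow>
      (\<integral>\<^sup>+\<omega>. nexp (ennreal v * P i (data (subtree n (p @ [i])) \<omega>) +
        ennreal \<epsilon> * (ennreal v)\<^sup>2 * Q i (data (subtree n (p @ [i])) \<omega>)) \<partial>M) = \<phi> v"
  shows "(\<integral>\<^sup>+\<omega>. nexp (ennreal c * (\<Sum>i. ennreal (D (Weights p) \<omega> (Inl i)) * P i (data (subtree n (p @ [i])) \<omega>)) +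
      ennreal \<epsilon> * (ennreal c)\<^sup>2 *
        (\<Sum>i. (ennreal (D (Weights p) \<omega> (Inl i)))\<^sup>2 * Q i (data (subtree n (p @ [i])) \<omega>))) \<partial>M) =
    nexp (ennreal (c powr a (Suc (length p))) * (\<integral>\<^sup>+x. 1 - \<phi> x \<partial>stable_intensity (a (Suc (length p)))))"
proof -
  let ?K = "\<lambda>i. subtree n (p @ [i])"
  let ?B = "\<Union>i. ?K i"
  let ?m = "a (Suc (length p))"
  have sub: "sources_below (Suc n) p \<subseteq> sources" using sources_below_subset[OF p] by auto
  then have Bs: "?B \<subseteq> sources" and Ks: "?K i \<subseteq> sources" and ps: "Weights p \<in> sources" for i by auto
  have Km: "data (?K i) \<in> measurable M (Pi\<^sub>M (?K i) (\<lambda>_. vec))" for i by (rule data_measurable[OF Ks])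
  define W where "W i v y = ennreal v * P i y + ennreal \<epsilon> * (ennreal v)\<^sup>2 * Q i y" for i v y
  have Wv: "W i v \<in> borel_measurable (Pi\<^sub>M (?K i) (\<lambda>_. vec))" for i v
    unfolding W_def[abs_def] using P[of i] Q[of i] by measurable
  \<comment> \<open>\<open>\<phi>\<close> is prescribed at positive arguments. \<open>\<psi>\<close>
    agrees with it there, is measurable, and is defined on the whole line, with value 1 at
    nonpositive arguments.\<close>
  define \<psi> where "\<psi> v = (\<integral>\<^sup>+\<omega>. nexp (W 0 v (data (?K 0) \<omega>)) \<partial>M)" for v
  have \<psi>m: "\<psi> \<in> borel_measurable borel"
  proof -
    have [measurable]: "(\<lambda>\<omega>. P 0 (data (?K 0) \<omega>)) \<in> borel_measurable M" "(\<lambda>\<omega>. Q 0 (data (?K 0) \<omega>)) \<in> borel_measurable M"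
      using measurable_compose[OF Km P] measurable_compose[OF Km Q] by auto
    show ?thesis unfolding \<psi>_def[abs_def] W_def by measurable
  qed
  have \<psi>: "(\<integral>\<^sup>+\<omega>. nexp (W i v (data (?K i) \<omega>)) \<partial>M) = \<psi> v" for i v
  proof (cases "0 < v")
    case True then show ?thesis by (simp add: \<psi>_def W_def \<phi>)
  next
    case False then show ?thesis by (simp add: \<psi>_def W_def ennreal_neg)
  qed
  have \<psi>_le: "\<psi> v \<le> 1" for v
    unfolding \<psi>_def by (intro nn_integral_le_1 prob_space_axioms nexp_le_1)
  let ?f = "\<lambda>x y. nexp (\<Sum>i. W i (c * x (Weights p) (Inl i)) (restrict y (?K i)))"
  have fm: "(\<lambda>(x, y). ?f x y) \<in> borel_measurable (Pi\<^sub>M {Weights p} (\<lambda>_. vec) \<Otimes>\<^sub>M Pi\<^sub>M ?B (\<lambda>_. vec))"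
    (is "_ \<in> borel_measurable ?N")
  proof -
    have w: "(\<lambda>z. fst z (Weights p) (Inl i)) \<in> borel_measurable ?N" for i
    proof -
      have "(\<lambda>z. fst z (Weights p)) \<in> measurable ?N vec"
        by (rule measurable_compose[OF measurable_fst measurable_component_singleton]) simp
      from measurable_compose[OF this measurable_vec_apply] show ?thesis .
    qed
    have r: "(\<lambda>z. restrict (snd z) (?K i)) \<in> measurable ?N (Pi\<^sub>M (?K i) (\<lambda>_. vec))" for i
      by (rule measurable_compose[OF measurable_snd measurable_restrict_subset]) auto
    note [measurable] = w measurable_compose[OF r P] measurable_compose[OF r Q]
    show ?thesis unfolding W_def split_beta' by measurable
  qed
  have restr: "restrict (data ?B \<omega>) (?K i) = data (?K i) \<omega>" for i \<omega>
    by (auto simp: data_def fun_eq_iff restrict_def)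
  \<comment> \<open>The factor \<open>c\<close> is absorbed into the points; its square matches the
    squared points in the second sum.\<close>
  have fac: "ennreal c * (\<Sum>i. ennreal (u i) * X i) + ennreal \<epsilon> * (ennreal c)\<^sup>2 * (\<Sum>i. (ennreal (u i))\<^sup>2 * Y i) =
     (\<Sum>i. ennreal (c * u i) * X i + ennreal \<epsilon> * (ennreal (c * u i))\<^sup>2 * Y i)" for u :: "nat \<Rightarrow> real" and X Y
  proof -
    have "ennreal (c * u i) = ennreal c * ennreal (u i)" for i
      using c by (cases "0 \<le> u i") (auto simp: ennreal_mult ennreal_neg mult_le_0_iff not_le)
    then show ?thesis
      by (simp add: suminf_add[symmetric] power_mult_distrib mult.assoc)
  qed
  have indK: "indep_vars (\<lambda>i. Pi\<^sub>M (?K i) (\<lambda>_. vec)) (\<lambda>i. data (?K i)) UNIV"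
    unfolding data_def[abs_def] using Ks subtree_disjoint by (intro indep_vars_restrict[OF indep]) auto
  have "(\<integral>\<^sup>+\<omega>. nexp (ennreal c * (\<Sum>i. ennreal (D (Weights p) \<omega> (Inl i)) * P i (data (?K i) \<omega>)) +
      ennreal \<epsilon> * (ennreal c)\<^sup>2 *
        (\<Sum>i. (ennreal (D (Weights p) \<omega> (Inl i)))\<^sup>2 * Q i (data (?K i) \<omega>))) \<partial>M) =
      (\<integral>\<^sup>+\<omega>. ?f (data {Weights p} \<omega>) (data ?B \<omega>) \<partial>M)"
    by (simp only: fac W_def restr data_apply singletonI)
  \<comment> \<open>The points at \<open>p\<close> are frozen. Given them, the terms of the series
    are independent across the children, and each one integrates to \<open>\<psi>\<close> at its
    rescaled point.\<close>
  also have "\<dots> = (\<integral>\<^sup>+\<omega>. \<integral>\<^sup>+\<omega>'. ?f (data {Weights p} \<omega>) (data ?B \<omega>') \<partial>M \<partial>M)"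
    using ps Bs Weights_not_in_subtree by (intro nn_integral_independent fm) auto
  also have "\<dots> = (\<integral>\<^sup>+\<omega>. nexp (\<Sum>i. nlog (\<psi> (c * D (Weights p) \<omega> (Inl i)))) \<partial>M)"
  proof (rule nn_integral_cong)
    fix \<omega>
    have "indep_vars (\<lambda>_. borel) (\<lambda>i \<omega>'. W i (c * D (Weights p) \<omega> (Inl i)) (data (?K i) \<omega>')) UNIV"
      by (rule indep_vars_compose2[OF indK]) (rule Wv)
    from nn_integral_nexp_suminf[OF this]
    show "(\<integral>\<^sup>+\<omega>'. ?f (data {Weights p} \<omega>) (data ?B \<omega>') \<partial>M) = nexp (\<Sum>i. nlog (\<psi> (c * D (Weights p) \<omega> (Inl i))))"
      by (simp only: restr data_apply singletonI \<psi>)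
  qed
  \<comment> \<open>Laplace functional with \<open>f x = nlog (\<psi> (c * x))\<close>; as \<psi> is
    at most 1, \<open>1 - nexp (f x)\<close> is \<open>1 - \<psi> (c * x)\<close>.\<close>
  also have "\<dots> = nexp (\<integral>\<^sup>+x. 1 - nexp (nlog (\<psi> (c * x))) \<partial>stable_intensity ?m)"
    using p \<psi>m by (intro laplace[where f="\<lambda>x. nlog (\<psi> (c * x))"]) auto
  also have "(\<integral>\<^sup>+x. 1 - nexp (nlog (\<psi> (c * x))) \<partial>stable_intensity ?m) =
      ennreal (c powr ?m) * (\<integral>\<^sup>+x. 1 - \<psi> x \<partial>stable_intensity ?m)"
    using \<psi>m c by (simp add: nexp_nlog \<psi>_le nn_integral_stable_intensity_scale[where f="\<lambda>x. 1 - \<psi> x"])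
  also have "(\<integral>\<^sup>+x. 1 - \<psi> x \<partial>stable_intensity ?m) = (\<integral>\<^sup>+x. 1 - \<phi> x \<partial>stable_intensity ?m)"
    by (intro nn_integral_stable_intensity_cong) (simp add: \<phi> \<psi>_def W_def)
  finally show ?thesis .
qed


section \<open>Laplace exponents along the tree\<close>

text \<open>The constant \<open>C\<close> of the overview for a node of level \<open>l\<close> with
  \<open>n\<close> levels below it. Its children have points of exponent \<open>a (Suc l)\<close>,
  and their own transforms depend on the parameter through the power
  \<open>a (Suc (Suc l))\<close>.\<close>

primrec laplace_const :: "nat \<Rightarrow> nat \<Rightarrow> 's state \<Rightarrow> ennreal" where
  "laplace_const 0 l s = F s"
| "laplace_const (Suc n) l s =
     (\<integral>\<^sup>+v. stable_power (a (Suc l)) (a (Suc (Suc l))) (laplace_const n (Suc l) (vadd s v)) \<partial>\<nu> (Suc l))"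

lemma measurable_laplace_const: "l + n = k \<Longrightarrow> laplace_const n l \<in> borel_measurable vec"
proof (induction n arbitrary: l)
  case 0
  have "laplace_const 0 l = F" by (simp add: fun_eq_iff)
  then show ?case using F_meas by simp
next
  case (Suc n)
  then have l: "1 \<le> Suc l" "Suc l \<le> k" by auto
  interpret \<nu>: prob_space "\<nu> (Suc l)" by (rule prob_space_mark_law[OF l])
  note sets_mark_law[OF l, measurable_cong]
  have [measurable]: "laplace_const n (Suc l) \<in> borel_measurable vec" using Suc by simp
  have "(\<lambda>(s, v). stable_power (a (Suc l)) (a (Suc (Suc l))) (laplace_const n (Suc l) (vadd s v)))
      \<in> borel_measurable (vec \<Otimes>\<^sub>M \<nu> (Suc l))"
    by measurable
  from \<nu>.borel_measurable_nn_integral[OF this] show ?case by simp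
qed

lemma laplace_const_pos: "l + n = k \<Longrightarrow> 0 < laplace_const n l s"
proof (induction n arbitrary: l s)
  case 0
  then show ?case by (simp add: F_pos)
next
  case (Suc n)
  then have l: "1 \<le> Suc l" "Suc l \<le> k" and ln: "Suc l + n = k" by auto
  interpret \<nu>: prob_space "\<nu> (Suc l)" by (rule prob_space_mark_law[OF l])
  note sets_mark_law[OF l, measurable_cong] measurable_laplace_const[OF ln, measurable]
  have [measurable]: "(\<lambda>v. laplace_const n (Suc l) (vadd s v)) \<in> borel_measurable (\<nu> (Suc l))"
    using measurable_compose[OF measurable_vadd_left measurable_laplace_const[OF ln]]
    by (simp add: measurable_cong_sets[OF sets_mark_law[OF l] refl])
  have pos: "0 < stable_power (a (Suc l)) (a (Suc (Suc l))) (laplace_const n (Suc l) (vadd s v))" for v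
    by (intro stable_power_pos Suc.IH ln)
  show ?case
  proof (rule ccontr)
    assume "\<not> 0 < laplace_const (Suc n) l s"
    then have "AE v in \<nu> (Suc l). stable_power (a (Suc l)) (a (Suc (Suc l))) (laplace_const n (Suc l) (vadd s v)) = 0"
      by (simp add: nn_integral_0_iff_AE)
    then have "AE v in \<nu> (Suc l). False"
      using pos by (simp add: less_le)
    then show False by simp
  qed
qed

text \<open>\<open>stable_power\<close> is at most a multiple of \<open>1 + C\<close>, and
  submultiplicativity separates the state from the new mark, whose \<open>G\<close>-moment is
  finite. A bound by a multiple of \<open>G\<close> therefore survives each level.\<close>

lemma laplace_const_le: "l + n = k \<Longrightarrow> \<exists>K\<ge>0. \<forall>s. laplace_const n l s \<le> ennreal K * G s"
proof (induction n arbitrary: l)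
  case 0
  then show ?case using F_le by simp
next
  case (Suc n)
  then have l: "1 \<le> Suc l" "Suc l \<le> k" and ln: "Suc l + n = k" by auto
  interpret \<nu>: prob_space "\<nu> (Suc l)" by (rule prob_space_mark_law[OF l])
  note sets_mark_law[OF l, measurable_cong] G_meas[measurable]
  obtain K where K: "0 \<le> K" "\<And>s. laplace_const n (Suc l) s \<le> ennreal K * G s" using Suc.IH[OF ln] by auto
  obtain K' where K': "0 \<le> K'" "\<And>C. stable_power (a (Suc l)) (a (Suc (Suc l))) C \<le> ennreal K' * (1 + C)"
    using stable_power_le[of "a (Suc l)" "a (Suc (Suc l))"] a_range[of "Suc l"] a_less[OF l] l by auto
  obtain g where g: "(\<integral>\<^sup>+v. G v \<partial>\<nu> (Suc l)) = ennreal g" "0 \<le> g"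
    using G_integral[OF l] by (cases "\<integral>\<^sup>+v. G v \<partial>\<nu> (Suc l)") auto
  show ?case
  proof (intro exI[of _ "K' * (1 + K) * g"] conjI allI)
    show "0 \<le> K' * (1 + K) * g" using K K' g by simp
    fix s
    have "laplace_const (Suc n) l s \<le> (\<integral>\<^sup>+v. ennreal (K' * (1 + K)) * G s * G v \<partial>\<nu> (Suc l))"
      unfolding laplace_const.simps
    proof (rule nn_integral_mono)
      fix v
      \<comment> \<open>The summand 1 of \<open>1 + C\<close> is absorbed by
        \<open>G s * G v\<close>.\<close>
      have "1 * 1 \<le> G s * G v" by (intro mult_mono G_ge_1) auto
      then have "1 + laplace_const n (Suc l) (vadd s v) \<le> G s * G v + ennreal K * (G s * G v)"
        using order_trans[OF K(2)[of "vadd s v"] mult_left_mono[OF G_vadd]] by (intro add_mono) auto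
      also have "\<dots> = ennreal (1 + K) * (G s * G v)" using K by (simp add: distrib_right)
      finally have "ennreal K' * (1 + laplace_const n (Suc l) (vadd s v)) \<le> ennreal K' * (ennreal (1 + K) * (G s * G v))"
        by (rule mult_left_mono) simp
      with K'(2) have "stable_power (a (Suc l)) (a (Suc (Suc l))) (laplace_const n (Suc l) (vadd s v)) \<le>
          ennreal K' * (ennreal (1 + K) * (G s * G v))"
        by (rule order_trans)
      then show "stable_power (a (Suc l)) (a (Suc (Suc l))) (laplace_const n (Suc l) (vadd s v)) \<le>
          ennreal (K' * (1 + K)) * G s * G v"
        using K K' by (simp add: ennreal_mult mult.assoc del: ennreal_plus)
    qed
    also have "\<dots> = ennreal (K' * (1 + K)) * G s * ennreal g"
      by (subst nn_integral_cmult) (auto simp: g)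
    also have "\<dots> = ennreal (K' * (1 + K) * g) * G s"
      using K K' g by (simp add: ennreal_mult mult_ac del: ennreal_plus)
    finally show "laplace_const (Suc n) l s \<le> ennreal (K' * (1 + K) * g) * G s" .
  qed
qed

lemma laplace_const_finite: "l + n = k \<Longrightarrow> laplace_const n l s < \<top>"
  using laplace_const_le[of l n] G_finite[of s]
  by (metis ennreal_less_top ennreal_mult_less_top le_less_trans)

text \<open>Tonelli moves the average over the mark outside; for each mark the integral over the
  points is \<open>stable_power\<close>, from which \<open>\<rho>\<close> is scaled out. This
  evaluates the integral left by \<open>laplace_step\<close> when the exponents of the children
  carry a common factor \<open>\<rho>\<close>.\<close>

lemma stable_intensity_mark:
  assumes ln: "Suc l + n = k" and \<rho>: "0 < \<rho>"
  shows "(\<integral>\<^sup>+x. 1 - (\<integral>\<^sup>+v. nexp (ennreal (x powr a (Suc (Suc l))) * (ennreal \<rho> * laplace_const n (Suc l) (vadd s v))) \<partial>\<nu> (Suc l))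
      \<partial>stable_intensity (a (Suc l))) = ennreal (\<rho> powr (a (Suc l) / a (Suc (Suc l)))) * laplace_const (Suc n) l s"
proof -
  let ?m = "a (Suc l)" and ?b = "a (Suc (Suc l))"
  have l: "1 \<le> Suc l" "Suc l \<le> k" using ln by auto
  interpret \<nu>: prob_space "\<nu> (Suc l)" by (rule prob_space_mark_law[OF l])
  interpret S: sigma_finite_measure "stable_intensity ?m" by (rule sigma_finite_stable_intensity)
  interpret pair_sigma_finite "\<nu> (Suc l)" "stable_intensity ?m" ..
  note sets_mark_law[OF l, measurable_cong] measurable_laplace_const[OF ln, measurable]
  let ?f = "\<lambda>x v. nexp (ennreal (x powr ?b) * (ennreal \<rho> * laplace_const n (Suc l) (vadd s v)))"
  have [measurable]: "(\<lambda>v. laplace_const n (Suc l) (vadd s v)) \<in> borel_measurable (\<nu> (Suc l))"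
    using measurable_compose[OF measurable_vadd_left measurable_laplace_const[OF ln]]
    by (simp add: measurable_cong_sets[OF sets_mark_law[OF l] refl])
  have "(\<integral>\<^sup>+x. 1 - (\<integral>\<^sup>+v. ?f x v \<partial>\<nu> (Suc l)) \<partial>stable_intensity ?m) =
      (\<integral>\<^sup>+x. \<integral>\<^sup>+v. 1 - ?f x v \<partial>\<nu> (Suc l) \<partial>stable_intensity ?m)"
    by (intro nn_integral_cong nn_integral_one_minus[symmetric] \<nu>.prob_space_axioms nexp_le_1) measurable
  also have "\<dots> = (\<integral>\<^sup>+v. \<integral>\<^sup>+x. 1 - ?f x v \<partial>stable_intensity ?m \<partial>\<nu> (Suc l))"
    by (rule Fubini') measurable
  also have "\<dots> = (\<integral>\<^sup>+v. stable_power ?m ?b (ennreal \<rho> * laplace_const n (Suc l) (vadd s v)) \<partial>\<nu> (Suc l))"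
    by (simp add: stable_power_def)
  also have "\<dots> = (\<integral>\<^sup>+v. ennreal (\<rho> powr (?m / ?b)) * stable_power ?m ?b (laplace_const n (Suc l) (vadd s v)) \<partial>\<nu> (Suc l))"
    using \<rho> a_range[of "Suc (Suc l)"] l by (simp add: stable_power_scale)
  also have "\<dots> = ennreal (\<rho> powr (?m / ?b)) * laplace_const (Suc n) l s"
    by (simp add: nn_integral_cmult)
  finally show ?thesis .
qed


section \<open>Joint transforms of partition functions and square sums\<close>

abbreviation Z :: "nat \<Rightarrow> nat list \<Rightarrow> 's state \<Rightarrow> 'w \<Rightarrow> ennreal" where
  "Z n p s \<omega> \<equiv> partition_fun F (\<lambda>b. D b \<omega>) n p s"

abbreviation Y :: "nat \<Rightarrow> nat \<Rightarrow> nat list \<Rightarrow> 's state \<Rightarrow> 'w \<Rightarrow> ennreal" where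
  "Y j n p s \<omega> \<equiv> square_sum F (\<lambda>b. D b \<omega>) j n p s"

lemma Z_data: "sources_below n p \<subseteq> A \<Longrightarrow> Z n p s \<omega> = partition_fun F (data A \<omega>) n p s"
  by (rule partition_fun_cong) (auto simp: data_apply)

lemma Y_data: "j \<le> n \<Longrightarrow> sources_below n p \<subseteq> A \<Longrightarrow> Y j n p s \<omega> = square_sum F (data A \<omega>) j n p s"
  by (rule square_sum_cong) (auto simp: data_apply)

lemma child_measurable:
  shows "(\<lambda>d. partition_fun F d n q (vadd s (d (Mark q)))) \<in> borel_measurable (Pi\<^sub>M (subtree n q) (\<lambda>_. vec))"
    and "j \<le> n \<Longrightarrow> (\<lambda>d. square_sum F d j n q (vadd s (d (Mark q)))) \<in> borel_measurable (Pi\<^sub>M (subtree n q) (\<lambda>_. vec))"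
proof -
  have s: "(\<lambda>d. vadd s (d (Mark q))) \<in> measurable (Pi\<^sub>M (subtree n q) (\<lambda>_. vec)) vec"
  proof -
    have "(\<lambda>d. d (Mark q)) \<in> measurable (Pi\<^sub>M (subtree n q) (\<lambda>_. vec)) vec"
      by (rule measurable_component_singleton) simp
    from measurable_compose[OF this measurable_vadd_left] show ?thesis .
  qed
  show "(\<lambda>d. partition_fun F d n q (vadd s (d (Mark q)))) \<in> borel_measurable (Pi\<^sub>M (subtree n q) (\<lambda>_. vec))"
    by (rule measurable_partition_fun[OF F_meas _ s, where A="subtree n q" and d="\<lambda>d. d"]) auto
  show "j \<le> n \<Longrightarrow> (\<lambda>d. square_sum F d j n q (vadd s (d (Mark q)))) \<in> borel_measurable (Pi\<^sub>M (subtree n q) (\<lambda>_. vec))"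
    by (rule measurable_square_sum[OF F_meas _ _ s, where A="subtree n q" and d="\<lambda>d. d"]) auto
qed

lemma child_partition_measurable:
  assumes "length q + n = k"
  shows "(\<lambda>\<omega>. Z n q (vadd s (D (Mark q) \<omega>)) \<omega>) \<in> borel_measurable M"
proof -
  have sub: "subtree n q \<subseteq> sources"
    using sources_below_subset[OF assms] Mark_in_sources[of q] assms by auto
  from measurable_compose[OF data_measurable[OF sub] child_measurable(1)]
  show ?thesis
    by (simp add: Z_data[where A="subtree n q", OF subset_insertI] data_apply)
qed

text \<open>By independence of the mark of \<open>q\<close> from the sources below, the transform
  can be computed for a frozen mark, where it is \<open>h\<close> at the shifted state.\<close>

lemma nn_integral_child:
  assumes q: "1 \<le> length q" "length q + n = k" and j: "j \<le> n"
    and h: "\<And>s. (\<integral>\<^sup>+\<omega>. nexp (c1 * Z n q s \<omega> + c2 * Y j n q s \<omega>) \<partial>M) = h s"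
  shows "(\<integral>\<^sup>+\<omega>. nexp (c1 * Z n q (vadd s (D (Mark q) \<omega>)) \<omega> + c2 * Y j n q (vadd s (D (Mark q) \<omega>)) \<omega>) \<partial>M) =
    (\<integral>\<^sup>+v. h (vadd s v) \<partial>\<nu> (length q))"
proof -
  let ?B = "sources_below n q"
  let ?f = "\<lambda>v y. nexp (c1 * partition_fun F y n q (vadd s v) + c2 * square_sum F y j n q (vadd s v))"
  have [measurable]: "(\<lambda>z. vadd s (fst z)) \<in> measurable (vec \<Otimes>\<^sub>M Pi\<^sub>M ?B (\<lambda>_. vec)) vec"
    by (rule measurable_compose[OF measurable_fst measurable_vadd_left])
  have [measurable]: "(\<lambda>z. partition_fun F (snd z) n q (vadd s (fst z))) \<in> borel_measurable (vec \<Otimes>\<^sub>M Pi\<^sub>M ?B (\<lambda>_. vec))"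
    by (rule measurable_partition_fun[OF F_meas order_refl]) measurable
  have [measurable]: "(\<lambda>z. square_sum F (snd z) j n q (vadd s (fst z))) \<in> borel_measurable (vec \<Otimes>\<^sub>M Pi\<^sub>M ?B (\<lambda>_. vec))"
    by (rule measurable_square_sum[OF F_meas j order_refl]) measurable
  have "(\<lambda>(v, y). ?f v y) \<in> borel_measurable (vec \<Otimes>\<^sub>M Pi\<^sub>M ?B (\<lambda>_. vec))"
    unfolding split_beta' by measurable
  from nn_integral_Mark[OF q this] show ?thesis
    by (simp add: Z_data[where A="?B", OF order_refl, symmetric] Y_data[where A="?B", OF j order_refl, symmetric] h)
qed

text \<open>If the children have a transform that is exponential in a power of the parameter, then
  \<open>laplace_step\<close> and \<open>stable_intensity_mark\<close> give the same form at the
  node, with the next exponent. The leaves start this with the power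
  \<open>a (Suc k) = 1\<close>.\<close>

lemma laplace_partition_fun:
  "length p + n = k \<Longrightarrow> 0 < c \<Longrightarrow>
    (\<integral>\<^sup>+\<omega>. nexp (ennreal c * Z n p s \<omega>) \<partial>M) =
    nexp (ennreal (c powr a (Suc (length p))) * laplace_const n (length p) s)"
proof (induction n arbitrary: p s c)
  case 0
  then show ?case by (simp add: a_last emeasure_space_1)
next
  case (Suc n)
  let ?l = "length p" and ?K = "\<lambda>i. subtree n (p @ [i])"
  let ?P = "\<lambda>i d. partition_fun F d n (p @ [i]) (vadd s (d (Mark (p @ [i]))))"
  let ?\<phi> = "\<lambda>v. \<integral>\<^sup>+x. nexp (ennreal (v powr a (Suc (Suc ?l))) * (ennreal 1 * laplace_const n (Suc ?l) (vadd s x))) \<partial>\<nu> (Suc ?l)"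
  have PZ: "?P i (data (?K i) \<omega>) = Z n (p @ [i]) (vadd s (D (Mark (p @ [i])) \<omega>)) \<omega>" for i \<omega>
    by (simp add: Z_data[where A="?K i", OF subset_insertI] data_apply)
  \<comment> \<open>The quadratic part of \<open>laplace_step\<close> is switched off: both
    \<open>\<epsilon>\<close> and \<open>Q\<close> are 0.\<close>
  have "(\<integral>\<^sup>+\<omega>. nexp (ennreal v * ?P i (data (?K i) \<omega>) + ennreal 0 * (ennreal v)\<^sup>2 * 0) \<partial>M) = ?\<phi> v"
    if "0 < v" for i v
    using nn_integral_child[of "p @ [i]" n 0 "ennreal v" 0] Suc.IH[of "p @ [i]" v] Suc.prems that
    unfolding PZ by simp
  from laplace_step[OF Suc.prems(1,2) child_measurable(1) _ this]
  have "(\<integral>\<^sup>+\<omega>. nexp (ennreal c * Z (Suc n) p s \<omega>) \<partial>M) =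
      nexp (ennreal (c powr a (Suc ?l)) * (\<integral>\<^sup>+x. 1 - ?\<phi> x \<partial>stable_intensity (a (Suc ?l))))"
    unfolding PZ by simp
  also have "(\<integral>\<^sup>+x. 1 - ?\<phi> x \<partial>stable_intensity (a (Suc ?l))) = laplace_const (Suc n) ?l s"
    using stable_intensity_mark[of ?l n 1 s] Suc.prems by simp
  finally show ?case .
qed

text \<open>\<open>Suc j\<close> is the distance from \<open>p\<close> down to the level
  \<open>J\<close> of the squares. There the factor \<rho> arises from
  \<open>stable_intensity_quadratic\<close>. A level with exponent \<open>m\<close> above one with
  exponent \<open>b\<close> raises the factor to the power \<open>m / b\<close>, which turns the
  exponent \<open>b / a J\<close> of \<rho> into \<open>m / a J\<close>.\<close>

lemma laplace_square_sum:
  "length p + n = k \<Longrightarrow> j < n \<Longrightarrow> 0 < c \<Longrightarrow> 0 \<le> \<epsilon> \<Longrightarrow>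
    (\<integral>\<^sup>+\<omega>. nexp (ennreal c * Z n p s \<omega> + ennreal \<epsilon> * (ennreal c)\<^sup>2 * Y (Suc j) n p s \<omega>) \<partial>M) =
    nexp (ennreal (c powr a (Suc (length p))) *
      (ennreal (quadratic_ratio (a (length p + Suc j)) \<epsilon> powr (a (Suc (length p)) / a (length p + Suc j))) *
        laplace_const n (length p) s))"
proof (induction j arbitrary: p n s c)
  case 0
  then obtain n' where n: "n = Suc n'" by (cases n) auto
  let ?l = "length p" and ?K = "\<lambda>i. subtree n' (p @ [i])"
  let ?m = "a (Suc ?l)"
  have m: "0 < ?m" "?m < 1"
    using 0 n a_range[of "Suc ?l"] a_less[of "Suc ?l"] a_range[of "Suc (Suc ?l)"] by auto
  have ln: "Suc ?l + n' = k" using 0 n by simp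
  let ?P = "\<lambda>i d. partition_fun F d n' (p @ [i]) (vadd s (d (Mark (p @ [i]))))"
  let ?Z = "\<lambda>i \<omega>. Z n' (p @ [i]) (vadd s (D (Mark (p @ [i])) \<omega>)) \<omega>"
  have PZ: "?P i (data (?K i) \<omega>) = ?Z i \<omega>" for i \<omega>
    by (simp add: Z_data[where A="?K i", OF subset_insertI] data_apply)
  have Zm[measurable]: "?Z i \<in> borel_measurable M" for i
    using child_partition_measurable[of "p @ [i]" n'] ln by simp
  let ?\<chi> = "\<lambda>v. \<integral>\<^sup>+x. nexp (ennreal (v powr a (Suc (Suc ?l))) * (ennreal 1 * laplace_const n' (Suc ?l) (vadd s x))) \<partial>\<nu> (Suc ?l)"
  have \<chi>: "(\<integral>\<^sup>+\<omega>. nexp (ennreal v * ?Z i \<omega>) \<partial>M) = ?\<chi> v" if "0 < v" for i v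
    using nn_integral_child[of "p @ [i]" n' 0 "ennreal v" 0] laplace_partition_fun[of "p @ [i]" n' v] ln that
    by simp
  \<comment> \<open>\<open>laplace_step\<close> demands one transform for all children, here that of
    child 0. With the quadratic term included, equality is obtained from the equality of the linear
    transforms at all parameters, which determines the law.\<close>
  let ?\<phi> = "\<lambda>v. \<integral>\<^sup>+\<omega>. nexp (ennreal v * ?Z 0 \<omega> + ennreal \<epsilon> * (ennreal v * ?Z 0 \<omega>)\<^sup>2) \<partial>M"
  have \<phi>: "(\<integral>\<^sup>+\<omega>. nexp (ennreal v * ?P i (data (?K i) \<omega>) +
      ennreal \<epsilon> * (ennreal v)\<^sup>2 * (?P i (data (?K i) \<omega>))\<^sup>2) \<partial>M) = ?\<phi> v" if "0 < v" for i v
  proof -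
    have "(\<integral>\<^sup>+\<omega>. nexp (ennreal v * ?Z i \<omega> + ennreal \<epsilon> * (ennreal v * ?Z i \<omega>)\<^sup>2) \<partial>M) = ?\<phi> v"
    proof (rule nexp_quadratic_determined[OF _ _ _ 0(4)])
      show "(\<lambda>\<omega>. ennreal v * ?Z i \<omega>) \<in> borel_measurable M" "(\<lambda>\<omega>. ennreal v * ?Z 0 \<omega>) \<in> borel_measurable M"
        by measurable
      fix w :: real assume "0 < w"
      then show "(\<integral>\<^sup>+\<omega>. nexp (ennreal w * (ennreal v * ?Z i \<omega>)) \<partial>M) = (\<integral>\<^sup>+\<omega>. nexp (ennreal w * (ennreal v * ?Z 0 \<omega>)) \<partial>M)"
        using \<chi>[of "w * v"] that by (simp add: ennreal_mult mult.assoc)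
    qed
    then show ?thesis unfolding PZ by (simp add: power_mult_distrib mult.assoc)
  qed
  have sq_m: "(\<lambda>d. (?P i d)\<^sup>2) \<in> borel_measurable (Pi\<^sub>M (?K i) (\<lambda>_. vec))" for i
    using child_measurable(1)[of n' "p @ [i]" s] by measurable
  have "(\<integral>\<^sup>+\<omega>. nexp (ennreal c * Z n p s \<omega> + ennreal \<epsilon> * (ennreal c)\<^sup>2 * Y (Suc 0) n p s \<omega>) \<partial>M) =
      nexp (ennreal (c powr ?m) * (\<integral>\<^sup>+x. 1 - ?\<phi> x \<partial>stable_intensity ?m))"
    using laplace_step[OF _ 0(3) child_measurable(1) sq_m \<phi>] 0 n unfolding PZ by simp
  \<comment> \<open>Tonelli brings the integral over the points inside the expectation, where \<rho>
    factors out for each value of the child's mass; a second exchange restores the linear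
    transform.\<close>
  also have "(\<integral>\<^sup>+x. 1 - ?\<phi> x \<partial>stable_intensity ?m) =
      ennreal (quadratic_ratio ?m \<epsilon>) * (\<integral>\<^sup>+x. 1 - ?\<chi> x \<partial>stable_intensity ?m)"
  proof -
    interpret S: sigma_finite_measure "stable_intensity ?m" by (rule sigma_finite_stable_intensity)
    interpret pair_sigma_finite M "stable_intensity ?m" ..
    have "(\<integral>\<^sup>+x. 1 - ?\<phi> x \<partial>stable_intensity ?m) =
        (\<integral>\<^sup>+x. \<integral>\<^sup>+\<omega>. 1 - nexp (ennreal x * ?Z 0 \<omega> + ennreal \<epsilon> * (ennreal x * ?Z 0 \<omega>)\<^sup>2) \<partial>M \<partial>stable_intensity ?m)"
      by (intro nn_integral_cong nn_integral_one_minus[symmetric] prob_space_axioms nexp_le_1) measurable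
    also have "\<dots> = (\<integral>\<^sup>+\<omega>. \<integral>\<^sup>+x. 1 - nexp (ennreal x * ?Z 0 \<omega> + ennreal \<epsilon> * (ennreal x * ?Z 0 \<omega>)\<^sup>2) \<partial>stable_intensity ?m \<partial>M)"
      by (rule Fubini') measurable
    also have "\<dots> = (\<integral>\<^sup>+\<omega>. ennreal (quadratic_ratio ?m \<epsilon>) * (\<integral>\<^sup>+x. 1 - nexp (ennreal x * ?Z 0 \<omega>) \<partial>stable_intensity ?m) \<partial>M)"
      by (simp only: stable_intensity_quadratic[OF m 0(4)])
    also have "\<dots> = ennreal (quadratic_ratio ?m \<epsilon>) * (\<integral>\<^sup>+\<omega>. \<integral>\<^sup>+x. 1 - nexp (ennreal x * ?Z 0 \<omega>) \<partial>stable_intensity ?m \<partial>M)"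
      by (rule nn_integral_cmult) measurable
    also have "(\<integral>\<^sup>+\<omega>. \<integral>\<^sup>+x. 1 - nexp (ennreal x * ?Z 0 \<omega>) \<partial>stable_intensity ?m \<partial>M) =
        (\<integral>\<^sup>+x. \<integral>\<^sup>+\<omega>. 1 - nexp (ennreal x * ?Z 0 \<omega>) \<partial>M \<partial>stable_intensity ?m)"
      by (rule Fubini'[symmetric]) measurable
    also have "\<dots> = (\<integral>\<^sup>+x. 1 - (\<integral>\<^sup>+\<omega>. nexp (ennreal x * ?Z 0 \<omega>) \<partial>M) \<partial>stable_intensity ?m)"
      by (intro nn_integral_cong nn_integral_one_minus prob_space_axioms nexp_le_1) measurable
    also have "\<dots> = (\<integral>\<^sup>+x. 1 - ?\<chi> x \<partial>stable_intensity ?m)"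
      by (rule nn_integral_stable_intensity_cong) (simp only: \<chi>)
    finally show ?thesis .
  qed
  also have "(\<integral>\<^sup>+x. 1 - ?\<chi> x \<partial>stable_intensity ?m) = laplace_const n ?l s"
    using stable_intensity_mark[OF ln, of 1 s] n by simp
  finally show ?case
    using m quadratic_ratio(2)[OF m 0(4)] by simp
next
  case (Suc j)
  then obtain n' where n: "n = Suc n'" by (cases n) auto
  let ?l = "length p" and ?K = "\<lambda>i. subtree n' (p @ [i])"
  let ?m = "a (Suc ?l)" and ?b = "a (Suc (Suc ?l))" and ?J = "?l + Suc (Suc j)"
  have ln: "Suc ?l + n' = k" and jn: "Suc j \<le> n'" "j < n'" using Suc n by simp_all
  have J: "0 < a ?J" "a ?J < 1"
    using Suc.prems n a_range[of ?J] a_less[of ?J] a_range[of "Suc ?J"] by auto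
  \<comment> \<open>The factor delivered by the induction hypothesis one level down.\<close>
  define R where "R = quadratic_ratio (a ?J) \<epsilon> powr (?b / a ?J)"
  have R: "0 < R" using quadratic_ratio(2)[OF J Suc.prems(4)] by (simp add: R_def)
  let ?P = "\<lambda>i d. partition_fun F d n' (p @ [i]) (vadd s (d (Mark (p @ [i]))))"
  let ?Q = "\<lambda>i d. square_sum F d (Suc j) n' (p @ [i]) (vadd s (d (Mark (p @ [i]))))"
  let ?\<phi> = "\<lambda>v. \<integral>\<^sup>+x. nexp (ennreal (v powr ?b) * (ennreal R * laplace_const n' (Suc ?l) (vadd s x))) \<partial>\<nu> (Suc ?l)"
  have PZ: "?P i (data (?K i) \<omega>) = Z n' (p @ [i]) (vadd s (D (Mark (p @ [i])) \<omega>)) \<omega>" for i \<omega>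
    by (simp add: Z_data[where A="?K i", OF subset_insertI] data_apply)
  have QY: "?Q i (data (?K i) \<omega>) = Y (Suc j) n' (p @ [i]) (vadd s (D (Mark (p @ [i])) \<omega>)) \<omega>" for i \<omega>
    by (simp only: Y_data[where A="?K i", OF jn(1) subset_insertI] data_apply insertI1)
  have "(\<integral>\<^sup>+\<omega>. nexp (ennreal v * ?P i (data (?K i) \<omega>) + ennreal \<epsilon> * (ennreal v)\<^sup>2 * ?Q i (data (?K i) \<omega>)) \<partial>M) = ?\<phi> v"
    if v: "0 < v" for i v
  proof -
    have IH: "(\<integral>\<^sup>+\<omega>. nexp (ennreal v * Z n' (p @ [i]) t \<omega> + ennreal \<epsilon> * (ennreal v)\<^sup>2 * Y (Suc j) n' (p @ [i]) t \<omega>) \<partial>M) =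
        nexp (ennreal (v powr ?b) * (ennreal R * laplace_const n' (Suc ?l) t))" for t
      using Suc.IH[of "p @ [i]" n' v t] ln jn v Suc.prems(4) by (simp add: R_def)
    have "1 \<le> length (p @ [i])" "length (p @ [i]) + n' = k" using ln by auto
    from nn_integral_child[OF this jn(1) IH] show ?thesis unfolding PZ QY by simp
  qed
  from laplace_step[OF _ Suc.prems(3) child_measurable(1) child_measurable(2)[OF jn(1)] this]
  have "(\<integral>\<^sup>+\<omega>. nexp (ennreal c * Z n p s \<omega> + ennreal \<epsilon> * (ennreal c)\<^sup>2 * Y (Suc (Suc j)) n p s \<omega>) \<partial>M) =
      nexp (ennreal (c powr ?m) * (\<integral>\<^sup>+x. 1 - ?\<phi> x \<partial>stable_intensity ?m))"
    using Suc.prems(1) n unfolding PZ QY by simp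
  also have "(\<integral>\<^sup>+x. 1 - ?\<phi> x \<partial>stable_intensity ?m) = ennreal (R powr (?m / ?b)) * laplace_const n ?l s"
    using stable_intensity_mark[OF ln R, of s] n by simp
  also have "R powr (?m / ?b) = quadratic_ratio (a ?J) \<epsilon> powr (?m / a ?J)"
    using a_range[of "Suc (Suc ?l)"] ln by (simp add: R_def powr_powr)
  finally show ?case .
qed

end

section \<open>Expected square sums\<close>

lemma suminf_power2_le: "(\<Sum>i. (f i)\<^sup>2) \<le> (\<Sum>i. f i :: ennreal)\<^sup>2"
proof -
  have "f i \<le> (\<Sum>i. f i)" for i
    using sum_le_suminf[of f "{i}"] by simp
  then have "(\<Sum>i. f i * f i) \<le> (\<Sum>i. f i * (\<Sum>i. f i))"
    by (intro suminf_le mult_left_mono) auto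
  then show ?thesis by (simp add: power2_eq_square)
qed

text \<open>This makes the square sum finite wherever the partition function is, and supplies the
  bound for dominated convergence.\<close>

lemma square_sum_le: "j \<le> n \<Longrightarrow> square_sum F d j n p s \<le> (partition_fun F d n p s)\<^sup>2"
proof (induction j arbitrary: n p s)
  case (Suc j)
  then obtain n' where n: "n = Suc n'" by (cases n) auto
  have "square_sum F d (Suc j) n p s \<le>
      (\<Sum>i. (ennreal (d (Weights p) (Inl i)) * partition_fun F d n' (p @ [i]) (vadd s (d (Mark (p @ [i])))))\<^sup>2)"
    using Suc by (auto simp: n power_mult_distrib intro!: suminf_le mult_left_mono)
  also have "\<dots> \<le> (partition_fun F d n p s)\<^sup>2"
    unfolding n partition_fun.simps by (rule suminf_power2_le)
  finally show ?case .
qed simp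

lemma partition_fun_pos:
  "(\<And>q i. length q < length p + n \<Longrightarrow> 0 < d (Weights q) (Inl i)) \<Longrightarrow> (\<And>s. 0 < F s) \<Longrightarrow>
    0 < partition_fun F d n p s"
proof (induction n arbitrary: p s)
  case (Suc n)
  have "0 < partition_fun F d n (p @ [0]) t" for t
    using Suc.prems by (intro Suc.IH) auto
  then have "0 < ennreal (d (Weights p) (Inl 0)) * partition_fun F d n (p @ [0]) (vadd s (d (Mark (p @ [0]))))"
    using Suc by (auto simp: ennreal_zero_less_mult_iff)
  also have "\<dots> \<le> partition_fun F d (Suc n) p s"
    using sum_le_suminf[of "\<lambda>i. ennreal (d (Weights p) (Inl i)) *
      partition_fun F d n (p @ [i]) (vadd s (d (Mark (p @ [i]))))" "{0}"] by simp
  finally show ?case .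
qed simp

context marked_cascade
begin

lemma measurable_Z [measurable]: "Z k [] s \<in> borel_measurable M"
  and measurable_Y [measurable]: "j \<le> k \<Longrightarrow> Y j k [] s \<in> borel_measurable M"
proof -
  have B: "sources_below k [] \<subseteq> sources" by auto
  show "Z k [] s \<in> borel_measurable M"
    using measurable_partition_fun[OF F_meas order_refl measurable_const[of s] data_measurable[OF B]]
    by (simp add: Z_data[OF order_refl] space_PiM)
  show "Y j k [] s \<in> borel_measurable M" if "j \<le> k"
    using measurable_square_sum[OF F_meas that order_refl measurable_const[of s] data_measurable[OF B]]
    by (simp add: Y_data[OF that order_refl] space_PiM)
qed

text \<open>Positivity is decided by the weights, so a single null set serves all states.\<close>

lemma AE_Z_pos: "AE \<omega> in M. \<forall>s. 0 < Z k [] s \<omega>"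
proof -
  have "AE \<omega> in M. \<forall>p. length p < k \<longrightarrow> (\<forall>i. 0 < D (Weights p) \<omega> (Inl i))"
    using weights_pos by (subst AE_all_countable) auto
  then show ?thesis
    by eventually_elim (auto intro!: partition_fun_pos F_pos)
qed

text \<open>As \<lambda> tends to 0, the expectation of \<open>exp (- \<lambda> Z)\<close> tends to
  the probability of \<open>Z < \<infinity>\<close>, while its computed value tends to 1 because
  \<open>laplace_const\<close> is finite.\<close>

lemma AE_Z_finite: "AE \<omega> in M. Z k [] s \<omega> < \<top>"
proof -
  have "(\<lambda>n. \<integral>\<^sup>+\<omega>. nexp (ennreal (1 / real (Suc n)) * Z k [] s \<omega>) \<partial>M) \<longlonglongrightarrow>
      (\<integral>\<^sup>+\<omega>. indicator {\<omega> \<in> space M. Z k [] s \<omega> < \<top>} \<omega> \<partial>M)"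
  proof (intro tendsto_nn_integral_bounded prob_space_axioms nexp_le_1)
    show "AE \<omega> in M. (\<lambda>n. nexp (ennreal (1 / real (Suc n)) * Z k [] s \<omega>)) \<longlonglongrightarrow>
        indicator {\<omega> \<in> space M. Z k [] s \<omega> < \<top>} \<omega>"
    proof (rule AE_I2)
      fix \<omega> assume \<omega>: "\<omega> \<in> space M"
      show "(\<lambda>n. nexp (ennreal (1 / real (Suc n)) * Z k [] s \<omega>)) \<longlonglongrightarrow>
        indicator {\<omega> \<in> space M. Z k [] s \<omega> < \<top>} \<omega>"
      proof (cases "Z k [] s \<omega>")
        case (real r)
        have eq: "ennreal (1 / real (Suc n)) * Z k [] s \<omega> = ennreal (1 / real (Suc n) * r)" for n
          unfolding real(2) by (rule ennreal_mult'[symmetric]) simp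
        have "(\<lambda>n. ennreal (1 / real (Suc n) * r)) \<longlonglongrightarrow> ennreal (0 * r)"
          by (intro tendsto_ennrealI tendsto_mult_right LIMSEQ_Suc[OF lim_1_over_n])
        then have "(\<lambda>n. nexp (ennreal (1 / real (Suc n)) * Z k [] s \<omega>)) \<longlonglongrightarrow> nexp (ennreal (0 * r))"
          unfolding eq by (rule tendsto_nexp)
        then show ?thesis using real \<omega> by simp
      next
        case top
        have "ennreal (1 / real (Suc n)) * Z k [] s \<omega> = \<top>" for n
          unfolding top by (subst ennreal_mult_top) (simp add: ennreal_eq_0_iff)
        then show ?thesis using top by simp
      qed
    qed
  qed measurable
  moreover have "(\<lambda>n. \<integral>\<^sup>+\<omega>. nexp (ennreal (1 / real (Suc n)) * Z k [] s \<omega>) \<partial>M) \<longlonglongrightarrow> 1"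
  proof -
    obtain c where c: "laplace_const k 0 s = ennreal c" "0 \<le> c"
      using laplace_const_finite[of 0 k s] by (cases "laplace_const k 0 s") auto
    have "(\<lambda>n. (1 / real (Suc n)) powr a 1 * c) \<longlonglongrightarrow> 0 powr a 1 * c"
      using a_pos by (intro tendsto_mult_right tendsto_powr' LIMSEQ_Suc[OF lim_1_over_n]) auto
    then have "(\<lambda>n. nexp (ennreal ((1 / real (Suc n)) powr a 1 * c))) \<longlonglongrightarrow> nexp (ennreal (0 powr a 1 * c))"
      by (intro tendsto_nexp tendsto_ennrealI)
    then show ?thesis
      using c by (simp add: laplace_partition_fun[of "[]" k] ennreal_mult')
  qed
  ultimately have "(\<integral>\<^sup>+\<omega>. indicator {\<omega> \<in> space M. Z k [] s \<omega> < \<top>} \<omega> \<partial>M) = 1"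
    by (rule LIMSEQ_unique)
  then have "emeasure M {\<omega> \<in> space M. Z k [] s \<omega> < \<top>} = 1"
    by simp
  then have "AE \<omega> in M. \<omega> \<in> {\<omega> \<in> space M. Z k [] s \<omega> < \<top>}"
    by (intro AE_prob_1) (simp add: emeasure_eq_measure)
  then show ?thesis by simp
qed

text \<open>Both sides are limits of difference quotients in \<epsilon> of the joint transform: on
  the left by dominated convergence, on the right by the derivative of \<rho>. The power
  \<open>a 1 / a J\<close> and \<rho>'(0) combine to \<open>a 1 * (1 - a J)\<close>.\<close>

lemma expectation_square_sum_exp:
  assumes J: "1 \<le> J" "J \<le> k" and x: "0 < x" and c: "laplace_const k 0 s = ennreal c" "0 < c"
  defines "z \<equiv> \<lambda>\<omega>. enn2real (Z k [] s \<omega>)" and "y \<equiv> \<lambda>\<omega>. enn2real (Y J k [] s \<omega>)"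
  shows "(\<integral>\<^sup>+\<omega>. ennreal (exp (- x * z \<omega>) * (x\<^sup>2 * y \<omega>)) \<partial>M) =
    ennreal (x powr a 1 * c * exp (- (x powr a 1 * c)) * (a 1 * (1 - a J)))"
proof -
  let ?A = "x powr a 1 * c"
  let ?\<epsilon> = "\<lambda>n. 1 / real (Suc n)"
  have m: "0 < a J" "a J < 1"
    using a_range[of J] a_less[of J] a_range[of "Suc J"] J by auto
  have [measurable]: "z \<in> borel_measurable M" "y \<in> borel_measurable M"
    unfolding z_def y_def using J by measurable
  have fin: "AE \<omega> in M. Z k [] s \<omega> = ennreal (z \<omega>) \<and> Y J k [] s \<omega> = ennreal (y \<omega>) \<and> y \<omega> \<le> (z \<omega>)\<^sup>2"
    using AE_Z_finite[of s]
  proof eventually_elim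
    case (elim \<omega>)
    have le: "Y J k [] s \<omega> \<le> (Z k [] s \<omega>)\<^sup>2" using J by (intro square_sum_le)
    have Zz: "Z k [] s \<omega> = ennreal (z \<omega>)" using elim by (simp add: z_def)
    have "Y J k [] s \<omega> \<le> ennreal ((z \<omega>)\<^sup>2)" using le unfolding Zz by (simp add: ennreal_power z_def)
    moreover from this have "Y J k [] s \<omega> = ennreal (y \<omega>)"
      by (cases "Y J k [] s \<omega>") (auto simp: y_def top_unique)
    ultimately show ?case using Zz by (simp only: ennreal_le_iff zero_le_power2 simp_thms)
  qed
  let ?f = "\<lambda>n \<omega>. ennreal (exp (- x * z \<omega>) * (real (Suc n) * (1 - exp (- (x\<^sup>2 * y \<omega>) / real (Suc n)))))"
  have lim: "(\<lambda>n. \<integral>\<^sup>+\<omega>. ?f n \<omega> \<partial>M) \<longlonglongrightarrow> (\<integral>\<^sup>+\<omega>. ennreal (exp (- x * z \<omega>) * (x\<^sup>2 * y \<omega>)) \<partial>M)"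
  proof (rule nn_integral_dominated_convergence[where w="\<lambda>\<omega>. ennreal (exp (- x * z \<omega>) * (x\<^sup>2 * y \<omega>))"])
    show "AE \<omega> in M. ?f n \<omega> \<le> ennreal (exp (- x * z \<omega>) * (x\<^sup>2 * y \<omega>))" for n
      using n_one_minus_exp_le[of n] by (intro AE_I2 ennreal_leI mult_left_mono) auto
    show "AE \<omega> in M. (\<lambda>n. ?f n \<omega>) \<longlonglongrightarrow> ennreal (exp (- x * z \<omega>) * (x\<^sup>2 * y \<omega>))"
      by (intro AE_I2 tendsto_ennrealI tendsto_mult_left n_one_minus_exp_tendsto)
    \<comment> \<open>The bound 2: by \<open>y \<omega> \<le> (z \<omega>)^2\<close> it suffices
      that \<open>w^2 * exp (- w) \<le> 2\<close> for \<open>w = x * z \<omega>\<close>, that is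
      \<open>w^2 / 2 \<le> exp w\<close>.\<close>
    have "(\<integral>\<^sup>+\<omega>. ennreal (exp (- x * z \<omega>) * (x\<^sup>2 * y \<omega>)) \<partial>M) \<le> (\<integral>\<^sup>+\<omega>. ennreal 2 \<partial>M)"
    proof (rule nn_integral_mono_AE, use fin in eventually_elim)
      case (elim \<omega>)
      have "0 \<le> x * z \<omega>" using x by (simp add: z_def)
      then have "(x * z \<omega>)\<^sup>2 / 2 \<le> exp (x * z \<omega>)"
        using exp_lower_Taylor_quadratic[of "x * z \<omega>"] by linarith
      then have "exp (- x * z \<omega>) * (x * z \<omega>)\<^sup>2 \<le> exp (- x * z \<omega>) * (2 * exp (x * z \<omega>))"
        by (intro mult_left_mono) auto
      then have "exp (- x * z \<omega>) * (x * z \<omega>)\<^sup>2 \<le> 2" by (simp add: exp_minus field_simps)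
      moreover have "exp (- x * z \<omega>) * (x\<^sup>2 * y \<omega>) \<le> exp (- x * z \<omega>) * (x * z \<omega>)\<^sup>2"
        using elim by (simp add: power_mult_distrib mult_left_mono)
      ultimately show ?case by (intro ennreal_leI) linarith
    qed
    also have "\<dots> < \<infinity>" by (simp add: emeasure_space_1)
    finally show "(\<integral>\<^sup>+\<omega>. ennreal (exp (- x * z \<omega>) * (x\<^sup>2 * y \<omega>)) \<partial>M) < \<infinity>" .
  qed measurable
  have eq: "(\<integral>\<^sup>+\<omega>. ?f n \<omega> \<partial>M) = ennreal (real (Suc n) *
      (exp (- ?A) - exp (- ?A * quadratic_ratio (a J) (?\<epsilon> n) powr (a 1 / a J))))" for n
  proof -
    define R where "R = quadratic_ratio (a J) (?\<epsilon> n) powr (a 1 / a J)"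
    have R: "0 < R" using quadratic_ratio(2)[OF m, of "?\<epsilon> n"] by (simp add: R_def)
    obtain j where j: "J = Suc j" "j < k" using J by (cases J) auto
    let ?g = "\<lambda>\<omega>. nexp (ennreal x * Z k [] s \<omega> + ennreal (?\<epsilon> n) * (ennreal x)\<^sup>2 * Y J k [] s \<omega>)"
    have [measurable]: "Y J k [] s \<in> borel_measurable M" using J by simp
    have "AE \<omega> in M. ?f n \<omega> = ennreal (real (Suc n)) * (nexp (ennreal x * Z k [] s \<omega>) - ?g \<omega>)"
      using fin
    proof eventually_elim
      case (elim \<omega>)
      have nn: "0 \<le> x * z \<omega>" "0 \<le> ?\<epsilon> n * x\<^sup>2 * y \<omega>" using x by (simp_all add: z_def y_def)
      have ZY: "Z k [] s \<omega> = ennreal (z \<omega>)" "Y J k [] s \<omega> = ennreal (y \<omega>)"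
        using elim by blast+
      have e1: "nexp (ennreal x * Z k [] s \<omega>) = ennreal (exp (- x * z \<omega>))"
        using elim x nn by (simp add: nexp_ennreal ennreal_mult'[symmetric])
      have "ennreal x * Z k [] s \<omega> + ennreal (?\<epsilon> n) * (ennreal x)\<^sup>2 * Y J k [] s \<omega> =
          ennreal (x * z \<omega> + ?\<epsilon> n * x\<^sup>2 * y \<omega>)"
      proof -
        have "ennreal x * Z k [] s \<omega> = ennreal (x * z \<omega>)"
          unfolding ZY by (rule ennreal_mult'[symmetric]) (use x in simp)
        moreover have "ennreal (?\<epsilon> n) * (ennreal x)\<^sup>2 * Y J k [] s \<omega> = ennreal (?\<epsilon> n * x\<^sup>2 * y \<omega>)"
          unfolding ZY ennreal_power[OF less_imp_le[OF x]] 
          using ennreal_mult'[of "?\<epsilon> n * x\<^sup>2" "y \<omega>"] ennreal_mult'[of "?\<epsilon> n" "x\<^sup>2"] by simp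
        ultimately show ?thesis using nn by (simp only: ennreal_plus)
      qed
      then have e2: "?g \<omega> = ennreal (exp (- (x * z \<omega> + ?\<epsilon> n * x\<^sup>2 * y \<omega>)))"
        using nn by (simp only: nexp_ennreal add_nonneg_nonneg)
      have "exp (- x * z \<omega>) * (real (Suc n) * (1 - exp (- (x\<^sup>2 * y \<omega>) / real (Suc n)))) =
          real (Suc n) * (exp (- x * z \<omega>) - exp (- (x * z \<omega> + ?\<epsilon> n * x\<^sup>2 * y \<omega>)))"
        by (simp add: algebra_simps mult_exp_exp diff_divide_distrib exp_add exp_diff exp_minus divide_inverse del: of_nat_Suc)
      then show ?case
        unfolding e1 e2 by (simp only: ennreal_minus ennreal_mult' of_nat_0_le_iff exp_ge_zero)
    qed
    then have "(\<integral>\<^sup>+\<omega>. ?f n \<omega> \<partial>M) = (\<integral>\<^sup>+\<omega>. ennreal (real (Suc n)) * (nexp (ennreal x * Z k [] s \<omega>) - ?g \<omega>) \<partial>M)"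
      by (rule nn_integral_cong_AE)
    also have "\<dots> = ennreal (real (Suc n)) * (\<integral>\<^sup>+\<omega>. nexp (ennreal x * Z k [] s \<omega>) - ?g \<omega> \<partial>M)"
      by (rule nn_integral_cmult) measurable
    also have "(\<integral>\<^sup>+\<omega>. nexp (ennreal x * Z k [] s \<omega>) - ?g \<omega> \<partial>M) =
        (\<integral>\<^sup>+\<omega>. nexp (ennreal x * Z k [] s \<omega>) \<partial>M) - (\<integral>\<^sup>+\<omega>. ?g \<omega> \<partial>M)"
    proof (rule nn_integral_diff)
      have "(\<integral>\<^sup>+\<omega>. ?g \<omega> \<partial>M) \<le> 1" by (intro nn_integral_le_1 prob_space_axioms nexp_le_1)
      then show "(\<integral>\<^sup>+\<omega>. ?g \<omega> \<partial>M) \<noteq> \<infinity>" by (auto simp: top_unique)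
      show "AE \<omega> in M. ?g \<omega> \<le> nexp (ennreal x * Z k [] s \<omega>)" by (intro AE_I2 nexp_antimono) simp
    qed measurable
    also have "(\<integral>\<^sup>+\<omega>. nexp (ennreal x * Z k [] s \<omega>) \<partial>M) = ennreal (exp (- ?A))"
      using laplace_partition_fun[of "[]" k x s] x c by (simp add: ennreal_mult'[symmetric] nexp_ennreal)
    also have "(\<integral>\<^sup>+\<omega>. ?g \<omega> \<partial>M) = nexp (ennreal (x powr a 1) * (ennreal R * ennreal c))"
      using laplace_square_sum[of "[]" k j x "?\<epsilon> n" s] x c j by (simp add: R_def)
    also have "\<dots> = ennreal (exp (- ?A * R))"
    proof -
      have "ennreal (x powr a 1) * (ennreal R * ennreal c) = ennreal (?A * R)"
        using R c by (simp add: ennreal_mult mult_ac)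
      moreover have "0 \<le> ?A * R" using R c by simp
      ultimately show ?thesis by (simp add: nexp_ennreal)
    qed
    also have "ennreal (real (Suc n)) * (ennreal (exp (- ?A)) - ennreal (exp (- ?A * R))) =
        ennreal (real (Suc n) * (exp (- ?A) - exp (- ?A * R)))"
      by (simp only: ennreal_minus exp_ge_zero ennreal_mult' of_nat_0_le_iff)
    finally show ?thesis by (simp only: R_def)
  qed
  have "(\<lambda>n. ennreal (real (Suc n) *
      (exp (- ?A) - exp (- ?A * quadratic_ratio (a J) (?\<epsilon> n) powr (a 1 / a J))))) \<longlonglongrightarrow>
      ennreal (?A * exp (- ?A) * (a 1 / a J) * (a J * (1 - a J)))"
    by (intro tendsto_ennrealI quadratic_ratio_exp_tendsto m)
  with lim have "(\<integral>\<^sup>+\<omega>. ennreal (exp (- x * z \<omega>) * (x\<^sup>2 * y \<omega>)) \<partial>M) =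
      ennreal (?A * exp (- ?A) * (a 1 / a J) * (a J * (1 - a J)))"
    unfolding eq by (rule LIMSEQ_unique)
  also have "?A * exp (- ?A) * (a 1 / a J) * (a J * (1 - a J)) = ?A * exp (- ?A) * (a 1 * (1 - a J))"
    using m by simp
  finally show ?thesis .
qed

text \<open>Integrating \<open>x \<mapsto> x * exp (- x * z)\<close> over the half-line turns the transform into the
  ratio of the square sum and the squared partition function.\<close>

lemma expectation_square_ratio:
  assumes J: "1 \<le> J" "J \<le> k"
  shows "(\<integral>\<^sup>+\<omega>. Y J k [] s \<omega> / (Z k [] s \<omega>)\<^sup>2 \<partial>M) = ennreal (1 - a J)"
proof -
  define z where "z \<omega> = enn2real (Z k [] s \<omega>)" for \<omega>
  define y where "y \<omega> = enn2real (Y J k [] s \<omega>)" for \<omega>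
  obtain c where c: "laplace_const k 0 s = ennreal c" "0 < c"
    using laplace_const_finite[of 0 k s] laplace_const_pos[of 0 k s] by (cases "laplace_const k 0 s") auto
  have m: "0 < a J" "a J < 1"
    using a_range[of J] a_less[of J] a_range[of "Suc J"] J by auto
  have [measurable]: "z \<in> borel_measurable M" "y \<in> borel_measurable M"
    unfolding z_def y_def using J by measurable
  have y: "0 \<le> y \<omega>" for \<omega> by (simp add: y_def)
  let ?h = "\<lambda>x \<omega>. ennreal (indicator {0<..} x * (x * exp (- x * z \<omega>)) * y \<omega>)"
  have "AE \<omega> in M. Y J k [] s \<omega> / (Z k [] s \<omega>)\<^sup>2 = (\<integral>\<^sup>+x. ?h x \<omega> \<partial>lborel)"
    using AE_Z_finite[of s] AE_Z_pos
  proof eventually_elim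
    case (elim \<omega>)
    have z: "Z k [] s \<omega> = ennreal (z \<omega>)" "0 < z \<omega>"
      using elim by (auto simp: z_def enn2real_positive_iff)
    have "Y J k [] s \<omega> \<le> (Z k [] s \<omega>)\<^sup>2" using J by (intro square_sum_le)
    then have Yy: "Y J k [] s \<omega> = ennreal (y \<omega>)"
      using z by (cases "Y J k [] s \<omega>") (auto simp: y_def top_unique ennreal_power)
    have "(\<integral>\<^sup>+x. ?h x \<omega> \<partial>lborel) = (\<integral>\<^sup>+x. ennreal (indicator {0<..} x * (x * exp (- x * z \<omega>))) * ennreal (y \<omega>) \<partial>lborel)"
      using y by (intro nn_integral_cong) (simp add: ennreal_mult'')
    also have "\<dots> = ennreal (1 / (z \<omega>)\<^sup>2) * ennreal (y \<omega>)"
      using nn_integral_exp_linear[OF z(2)] by (subst nn_integral_multc) auto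
    also have "\<dots> = ennreal (y \<omega>) / ennreal ((z \<omega>)\<^sup>2)"
      using y z by (simp add: divide_ennreal ennreal_mult''[symmetric])
    finally show ?case using z Yy by (simp add: ennreal_power)
  qed
  then have "(\<integral>\<^sup>+\<omega>. Y J k [] s \<omega> / (Z k [] s \<omega>)\<^sup>2 \<partial>M) = (\<integral>\<^sup>+\<omega>. \<integral>\<^sup>+x. ?h x \<omega> \<partial>lborel \<partial>M)"
    by (rule nn_integral_cong_AE)
  also have "\<dots> = (\<integral>\<^sup>+x. \<integral>\<^sup>+\<omega>. ?h x \<omega> \<partial>M \<partial>lborel)"
  proof -
    interpret pair_sigma_finite lborel M ..
    show ?thesis by (rule Fubini') measurable
  qed
  also have "\<dots> = (\<integral>\<^sup>+x. ennreal (indicator {0<..} x * (x powr (a 1 - 1) * c * exp (- c * x powr a 1))) *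
      ennreal (a 1 * (1 - a J)) \<partial>lborel)"
  proof (rule nn_integral_cong)
    fix x :: real
    show "(\<integral>\<^sup>+\<omega>. ?h x \<omega> \<partial>M) = ennreal (indicator {0<..} x * (x powr (a 1 - 1) * c * exp (- c * x powr a 1))) *
      ennreal (a 1 * (1 - a J))"
    proof (cases "0 < x")
      case True
      \<comment> \<open>One factor \<open>x\<close> of the kernel is written as
        \<open>x^2 / x\<close>, since the transform computed before carries
        \<open>x^2\<close>.\<close>
      have "(\<integral>\<^sup>+\<omega>. ?h x \<omega> \<partial>M) = (\<integral>\<^sup>+\<omega>. ennreal (1 / x) * ennreal (exp (- x * z \<omega>) * (x\<^sup>2 * y \<omega>)) \<partial>M)"
        using True by (intro nn_integral_cong) (simp add: ennreal_mult'[symmetric] power2_eq_square mult_ac)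
      also have "\<dots> = ennreal (1 / x) * (\<integral>\<^sup>+\<omega>. ennreal (exp (- x * z \<omega>) * (x\<^sup>2 * y \<omega>)) \<partial>M)"
        by (rule nn_integral_cmult) measurable
      also have "(\<integral>\<^sup>+\<omega>. ennreal (exp (- x * z \<omega>) * (x\<^sup>2 * y \<omega>)) \<partial>M) =
          ennreal (x powr a 1 * c * exp (- (x powr a 1 * c)) * (a 1 * (1 - a J)))"
        unfolding z_def y_def by (rule expectation_square_sum_exp[OF J True c])
      also have "ennreal (1 / x) * \<dots> = ennreal (x powr (a 1 - 1) * c * exp (- c * x powr a 1) * (a 1 * (1 - a J)))"
        using True by (simp add: ennreal_mult'[symmetric] powr_diff mult_ac)
      finally show ?thesis using True m a_pos by (simp add: ennreal_mult''[symmetric])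
    qed simp
  qed
  \<comment> \<open>The integral \<open>1 / a 1\<close> cancels the factor \<open>a 1\<close>;
    \<open>c\<close>, the only trace of the state, has disappeared.\<close>
  also have "\<dots> = ennreal (1 / a 1) * ennreal (a 1 * (1 - a J))"
    using nn_integral_exp_power[OF c(2) a_pos] by (subst nn_integral_multc) auto
  also have "\<dots> = ennreal (1 - a J)"
    using a_pos m by (simp add: ennreal_mult''[symmetric])
  finally show ?thesis .
qed

section \<open>Averaging over the state at the root\<close>

definition root_state :: "'w \<Rightarrow> 's state" where
  "root_state \<omega> = vadd (D (Mark []) \<omega>) (D External \<omega>)"

text \<open>The root state is independent of everything below the root, and an expectation that is
  the same for every frozen state is unchanged by averaging.\<close>

lemma nn_integral_root_state:
  assumes f: "(\<lambda>(s, y). f s y) \<in> borel_measurable (vec \<Otimes>\<^sub>M Pi\<^sub>M (sources_below k []) (\<lambda>_. vec))"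
    and K: "\<And>s. (\<integral>\<^sup>+\<omega>. f s (data (sources_below k []) \<omega>) \<partial>M) = K"
  shows "(\<integral>\<^sup>+\<omega>. f (root_state \<omega>) (data (sources_below k []) \<omega>) \<partial>M) = K"
proof -
  let ?A = "{Mark [], External}" and ?B = "sources_below k []"
  let ?N = "Pi\<^sub>M ?A (\<lambda>_. vec) \<Otimes>\<^sub>M Pi\<^sub>M ?B (\<lambda>_. vec) :: ((source \<Rightarrow> 's state) \<times> (source \<Rightarrow> 's state)) measure"
  have r: "root_state \<omega> = vadd (data ?A \<omega> (Mark [])) (data ?A \<omega> External)" for \<omega>
    by (simp add: root_state_def data_apply)
  have c: "(\<lambda>x. fst x b) \<in> measurable ?N vec" if "b \<in> ?A" for b
    by (rule measurable_compose[OF measurable_fst measurable_component_singleton[OF that]])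
  have "(\<lambda>x. (vadd (fst x (Mark [])) (fst x External), snd x)) \<in> measurable ?N (vec \<Otimes>\<^sub>M Pi\<^sub>M ?B (\<lambda>_. vec))"
    by (intro measurable_Pair measurable_snd measurable_vadd c) auto
  from measurable_compose[OF this f]
  have "(\<lambda>(x, y). f (vadd (x (Mark [])) (x External)) y) \<in> borel_measurable ?N"
    by (simp add: split_beta')
  moreover have "?A \<subseteq> sources" "?B \<subseteq> sources" "?A \<inter> ?B = {}"
    using Mark_not_in_below[of "[]" k] sources_below_prefix(3)[of k "[]"] by auto
  ultimately have "(\<integral>\<^sup>+\<omega>. f (root_state \<omega>) (data ?B \<omega>) \<partial>M) =
      (\<integral>\<^sup>+\<omega>. \<integral>\<^sup>+\<omega>'. f (root_state \<omega>) (data ?B \<omega>') \<partial>M \<partial>M)"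
    unfolding r by (intro nn_integral_independent[where f="\<lambda>x y. f (vadd (x (Mark [])) (x External)) y"])
  then show ?thesis by (simp add: K emeasure_space_1)
qed

lemma measurable_tree_functions:
  shows "(\<lambda>x. partition_fun F (snd x) k [] (fst x)) \<in> borel_measurable (vec \<Otimes>\<^sub>M Pi\<^sub>M (sources_below k []) (\<lambda>_. vec))"
    and "J \<le> k \<Longrightarrow> (\<lambda>x. square_sum F (snd x) J k [] (fst x)) \<in> borel_measurable (vec \<Otimes>\<^sub>M Pi\<^sub>M (sources_below k []) (\<lambda>_. vec))"
  by (rule measurable_partition_fun[OF F_meas order_refl]; measurable)
    (rule measurable_square_sum[OF F_meas _ order_refl]; measurable?)

lemma expectation_square_ratio_root:
  assumes J: "1 \<le> J" "J \<le> k"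
  shows "(\<integral>\<^sup>+\<omega>. Y J k [] (root_state \<omega>) \<omega> / (Z k [] (root_state \<omega>) \<omega>)\<^sup>2 \<partial>M) = ennreal (1 - a J)"
proof -
  let ?B = "sources_below k []"
  let ?f = "\<lambda>s y. square_sum F y J k [] s / (partition_fun F y k [] s)\<^sup>2"
  note measurable_tree_functions(1)[measurable] measurable_tree_functions(2)[OF J(2), measurable]
  have "(\<lambda>(s, y). ?f s y) \<in> borel_measurable (vec \<Otimes>\<^sub>M Pi\<^sub>M ?B (\<lambda>_. vec))"
    unfolding split_beta' by measurable
  from nn_integral_root_state[OF this, of "ennreal (1 - a J)"] show ?thesis
    using expectation_square_ratio[OF J]
    by (simp add: Z_data[OF order_refl] Y_data[OF J(2) order_refl])
qed

text \<open>For a fixed state, finiteness holds off a null set that may depend on the state. To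
  insert the random state, the indicator of \<open>Z = \<top>\<close> is integrated instead.\<close>

lemma AE_Z_root_finite: "AE \<omega> in M. Z k [] (root_state \<omega>) \<omega> < \<top>"
proof -
  let ?B = "sources_below k []"
  let ?f = "\<lambda>s y. if partition_fun F y k [] s = \<top> then 1 else 0 :: ennreal"
  note measurable_tree_functions(1)[measurable]
  have "(\<lambda>(s, y). ?f s y) \<in> borel_measurable (vec \<Otimes>\<^sub>M Pi\<^sub>M ?B (\<lambda>_. vec))"
    unfolding split_beta' by measurable
  moreover have "(\<integral>\<^sup>+\<omega>. ?f s (data ?B \<omega>) \<partial>M) = 0" for s
  proof -
    have "AE \<omega> in M. ?f s (data ?B \<omega>) = 0"
      using AE_Z_finite[of s] by eventually_elim (auto simp: Z_data[OF order_refl])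
    then show ?thesis by (subst nn_integral_cong_AE[where v="\<lambda>_. 0"]) auto
  qed
  ultimately have 0: "(\<integral>\<^sup>+\<omega>. ?f (root_state \<omega>) (data ?B \<omega>) \<partial>M) = 0"
    by (rule nn_integral_root_state)
  have rm: "root_state \<in> measurable M vec"
    unfolding root_state_def[abs_def] by (intro measurable_vadd D_measurable) auto
  have "(\<lambda>\<omega>. Z k [] (root_state \<omega>) \<omega>) \<in> borel_measurable M"
    using measurable_partition_fun[OF F_meas order_refl rm data_measurable, of k "[]"]
    by (auto simp: Z_data[OF order_refl])
  then have "AE \<omega> in M. ?f (root_state \<omega>) (data ?B \<omega>) = 0"
    using 0 by (subst (asm) nn_integral_0_iff_AE) (auto simp: Z_data[OF order_refl, symmetric])
  then show ?thesis
    by eventually_elim (auto simp: Z_data[OF order_refl] less_top split: if_splits)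
qed

end

section \<open>Sums over leaves\<close>

lemma countable_leaves: "countable (leaves k)"
  by (rule countable_subset[of _ UNIV]) auto

lemma measurable_nn_integral_count_space:
  assumes "countable A" "\<And>a. a \<in> A \<Longrightarrow> (\<lambda>\<omega>. f \<omega> a) \<in> borel_measurable M"
  shows "(\<lambda>\<omega>. \<integral>\<^sup>+a. f \<omega> a \<partial>count_space A) \<in> borel_measurable M"
proof -
  interpret sigma_finite_measure "count_space A"
    by (rule sigma_finite_measure_count_space_countable[OF assms(1)])
  have "(\<lambda>x. (\<lambda>i \<omega>. f \<omega> i) (snd x) (fst x)) \<in> borel_measurable (M \<Otimes>\<^sub>M count_space A)"
    by (rule measurable_compose_countable'[where I=A and f="\<lambda>i x. f (fst x) i"])
      (use assms in \<open>auto intro!: measurable_compose[OF measurable_fst]\<close>)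
  then show ?thesis
    by (intro borel_measurable_nn_integral) (simp add: split_beta')
qed

text \<open>Summability of real functions is absolute, and in the remaining case both sides take
  their default value 0.\<close>

lemma infsum_real_eq_integral:
  fixes f :: "'a \<Rightarrow> real"
  shows "infsum f A = integral\<^sup>L (count_space A) f"
proof (cases "f summable_on A")
  case True
  then have "Infinite_Set_Sum.abs_summable_on f A"
    using summable_on_iff_abs_summable_on_real[of f A] abs_summable_equivalent[of f A] by blast
  from infsetsum_infsum[OF this] show ?thesis
    by (simp add: infsetsum_def)
next
  case False
  then have "\<not> Infinite_Set_Sum.abs_summable_on f A"
    using summable_on_iff_abs_summable_on_real[of f A] abs_summable_equivalent[of f A] by blast
  then show ?thesis
    using False by (simp add: infsum_not_exists abs_summable_on_def not_integrable_integral_eq)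
qed

lemma measurable_infsum_real:
  fixes f :: "'w \<Rightarrow> 'a \<Rightarrow> real"
  assumes "countable A" "\<And>a. a \<in> A \<Longrightarrow> (\<lambda>\<omega>. f \<omega> a) \<in> borel_measurable M"
  shows "(\<lambda>\<omega>. infsum (f \<omega>) A) \<in> borel_measurable M"
proof -
  interpret sigma_finite_measure "count_space A"
    by (rule sigma_finite_measure_count_space_countable[OF assms(1)])
  have "(\<lambda>x. (\<lambda>i \<omega>. f \<omega> i) (snd x) (fst x)) \<in> borel_measurable (M \<Otimes>\<^sub>M count_space A)"
    by (rule measurable_compose_countable'[where I=A and f="\<lambda>i x. f (fst x) i"])
      (use assms in \<open>auto intro!: measurable_compose[OF measurable_fst]\<close>)
  then show ?thesis
    unfolding infsum_real_eq_integral by (intro borel_measurable_lebesgue_integral) (simp add: split_beta')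
qed

lemma ennreal_infsum:
  fixes f :: "'a \<Rightarrow> real"
  assumes "\<And>x. x \<in> A \<Longrightarrow> 0 \<le> f x" "(\<integral>\<^sup>+x. ennreal (f x) \<partial>count_space A) < \<top>"
  shows "ennreal (infsum f A) = (\<integral>\<^sup>+x. ennreal (f x) \<partial>count_space A)"
proof -
  have "integrable (count_space A) f"
    using assms by (intro integrableI_nonneg) (auto simp: AE_count_space)
  then show ?thesis
    unfolding infsum_real_eq_integral
    using assms(1) by (intro nn_integral_eq_integral[symmetric]) (auto simp: AE_count_space)
qed

lemma nn_integral_leaves_0: "(\<integral>\<^sup>+\<alpha>. h \<alpha> \<partial>count_space (leaves 0)) = (h [] :: ennreal)"
proof -
  have "leaves 0 = {[]}" by (auto simp: leaves_def)
  then show ?thesis by (simp add: nn_integral_count_space_finite)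
qed

lemma nn_integral_leaves_Suc:
  "(\<integral>\<^sup>+\<alpha>. h \<alpha> \<partial>count_space (leaves (Suc n))) = (\<Sum>i. \<integral>\<^sup>+\<alpha>. h (i # \<alpha>) \<partial>count_space (leaves n) :: ennreal)"
proof -
  interpret L: sigma_finite_measure "count_space (leaves n)"
    by (rule sigma_finite_measure_count_space_countable[OF countable_leaves])
  have "bij_betw (\<lambda>(i, \<alpha>). i # \<alpha>) (UNIV \<times> leaves n) (leaves (Suc n))"
    by (rule bij_betw_byWitness[where f'="\<lambda>\<alpha>. (hd \<alpha>, tl \<alpha>)"])
      (auto simp: leaves_def length_Suc_conv)
  from nn_integral_bij_count_space[OF this, of h]
  have "(\<integral>\<^sup>+\<alpha>. h \<alpha> \<partial>count_space (leaves (Suc n))) =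
      (\<integral>\<^sup>+x. h (fst x # snd x) \<partial>(count_space UNIV \<Otimes>\<^sub>M count_space (leaves n)))"
    by (simp add: pair_measure_countable countable_leaves split_beta')
  also have "\<dots> = (\<integral>\<^sup>+i. \<integral>\<^sup>+\<alpha>. h (i # \<alpha>) \<partial>count_space (leaves n) \<partial>count_space UNIV)"
    by (subst L.nn_integral_fst[symmetric]) (simp_all add: pair_measure_countable countable_leaves)
  finally show ?thesis by (simp add: nn_integral_count_space_nat)
qed

section \<open>Masses of leaves and of pairs of leaves\<close>

text \<open>\<open>p\<close> is the node already reached; the second list is the rest of the path
  below it.\<close>

primrec path_weight :: "(source \<Rightarrow> 's state) \<Rightarrow> nat list \<Rightarrow> nat list \<Rightarrow> ennreal" where
  "path_weight d p [] = 1"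
| "path_weight d p (i # r) = ennreal (d (Weights p) (Inl i)) * path_weight d (p @ [i]) r"

primrec path_state :: "(source \<Rightarrow> 's state) \<Rightarrow> nat list \<Rightarrow> 's state \<Rightarrow> nat list \<Rightarrow> 's state" where
  "path_state d p s [] = s"
| "path_state d p s (i # r) = path_state d (p @ [i]) (vadd s (d (Mark (p @ [i])))) r"

definition leaf_mass :: "('s state \<Rightarrow> ennreal) \<Rightarrow> (source \<Rightarrow> 's state) \<Rightarrow> nat list \<Rightarrow> 's state \<Rightarrow> nat list \<Rightarrow> ennreal" where
  "leaf_mass F d p s r = path_weight d p r * F (path_state d p s r)"

lemma leaf_mass_Nil [simp]: "leaf_mass F d p s [] = F s"
  and leaf_mass_Cons [simp]: "leaf_mass F d p s (i # r) =
    ennreal (d (Weights p) (Inl i)) * leaf_mass F d (p @ [i]) (vadd s (d (Mark (p @ [i])))) r"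
  by (simp_all add: leaf_mass_def mult.assoc)

lemma partition_fun_eq:
  "partition_fun F d n p s = (\<integral>\<^sup>+r. leaf_mass F d p s r \<partial>count_space (leaves n))"
  by (induction n arbitrary: p s)
    (simp_all add: nn_integral_leaves_0 nn_integral_leaves_Suc nn_integral_cmult)

lemma suminf_mult_of_bool: "(\<Sum>j. f j * of_bool (i = j)) = (f i :: ennreal)" for i :: nat
proof -
  have "(\<Sum>j. f j * of_bool (i = j)) = (\<Sum>j\<in>{i}. f j * of_bool (i = j))"
    by (rule suminf_finite) auto
  then show ?thesis by simp
qed

text \<open>Both leaves are split at their first label. For positive \<open>j\<close> only equal
  first labels contribute, which produces the squared weight in the recursion of
  \<open>square_sum\<close>.\<close>

lemma square_sum_eq:
  "j \<le> n \<Longrightarrow> square_sum F d j n p s =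
    (\<integral>\<^sup>+\<alpha>. \<integral>\<^sup>+\<beta>. leaf_mass F d p s \<alpha> * leaf_mass F d p s \<beta> * of_bool (take j \<alpha> = take j \<beta>)
      \<partial>count_space (leaves n) \<partial>count_space (leaves n))"
proof (induction j arbitrary: n p s)
  case 0
  then show ?case
    by (simp add: partition_fun_eq nn_integral_cmult nn_integral_multc power2_eq_square)
next
  case (Suc j)
  then obtain n' where n: "n = Suc n'" "j \<le> n'" by (cases n) auto
  let ?w = "\<lambda>i. ennreal (d (Weights p) (Inl i))"
  let ?g = "\<lambda>i. leaf_mass F d (p @ [i]) (vadd s (d (Mark (p @ [i]))))"
  let ?L = "count_space (leaves n')"
  have inner: "(\<Sum>i'. \<integral>\<^sup>+\<beta>. ?w i * ?g i \<alpha> * (?w i' * ?g i' \<beta>) * of_bool (i = i' \<and> take j \<alpha> = take j \<beta>) \<partial>?L) =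
      (?w i)\<^sup>2 * (\<integral>\<^sup>+\<beta>. ?g i \<alpha> * ?g i \<beta> * of_bool (take j \<alpha> = take j \<beta>) \<partial>?L)" for i \<alpha>
  proof -
    have "(\<Sum>i'. \<integral>\<^sup>+\<beta>. ?w i * ?g i \<alpha> * (?w i' * ?g i' \<beta>) * of_bool (i = i' \<and> take j \<alpha> = take j \<beta>) \<partial>?L) =
        (\<Sum>i'. (\<integral>\<^sup>+\<beta>. ?w i * ?g i \<alpha> * (?w i' * ?g i' \<beta>) * of_bool (take j \<alpha> = take j \<beta>) \<partial>?L) * of_bool (i = i'))"
      by (intro suminf_cong) (auto simp: of_bool_def)
    also have "\<dots> = (\<integral>\<^sup>+\<beta>. (?w i)\<^sup>2 * (?g i \<alpha> * ?g i \<beta> * of_bool (take j \<alpha> = take j \<beta>)) \<partial>?L)"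
      unfolding suminf_mult_of_bool by (intro nn_integral_cong) (simp add: power2_eq_square mult_ac)
    finally show ?thesis by (simp add: nn_integral_cmult)
  qed
  show ?case
    by (simp add: n nn_integral_leaves_Suc Suc.IH[OF n(2)] inner nn_integral_cmult)
qed

lemma path_weight_eq_prod:
  assumes "\<And>q i. length q < length p + length r \<Longrightarrow> 0 \<le> d (Weights q) (Inl i)"
  shows "path_weight d p r = ennreal (\<Prod>l<length r. d (Weights (p @ take l r)) (Inl (r ! l)))"
  using assms
proof (induction r arbitrary: p)
  case (Cons i r)
  have IH: "path_weight d (p @ [i]) r = ennreal (\<Prod>l<length r. d (Weights ((p @ [i]) @ take l r)) (Inl (r ! l)))"
    using Cons.prems by (intro Cons.IH) auto
  have "(\<Prod>l<length (i # r). d (Weights (p @ take l (i # r))) (Inl ((i # r) ! l))) =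
      d (Weights p) (Inl i) * (\<Prod>l<length r. d (Weights ((p @ [i]) @ take l r)) (Inl (r ! l)))"
    by (simp add: prod.lessThan_Suc_shift del: prod.lessThan_Suc)
  then show ?case
    using Cons.prems IH by (simp add: ennreal_mult')
qed simp

text \<open>The sum starts at 1 because the mark of \<open>p\<close> is meant to be contained in
  \<open>s\<close> already.\<close>

lemma path_state_eq_sum:
  "path_state d p s r x = s x + (\<Sum>l=1..length r. d (Mark (p @ take l r)) x)"
proof (induction r arbitrary: p s)
  case (Cons i r)
  have "(\<Sum>l=1..length (i # r). d (Mark (p @ take l (i # r))) x) =
      d (Mark (p @ [i])) x + (\<Sum>l=1..length r. d (Mark ((p @ [i]) @ take l r)) x)"
    by (simp add: sum.atLeast_Suc_atMost_Suc_shift sum.atLeast_Suc_atMost del: sum.cl_ivl_Suc)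
  then show ?case by (simp add: Cons.IH vadd_def add.assoc)
qed simp

text \<open>\<open>r \<le> k\<close> excludes the default \<open>k + 1\<close> of equal leaves and
  keeps all compared positions inside the lists.\<close>

lemma split_level_eq:
  assumes "\<alpha> \<in> leaves k" "\<beta> \<in> leaves k" "1 \<le> r" "r \<le> k"
  shows "split_level k \<alpha> \<beta> = r \<longleftrightarrow> take (r - 1) \<alpha> = take (r - 1) \<beta> \<and> take r \<alpha> \<noteq> take r \<beta>"
proof -
  have len: "length \<alpha> = k" "length \<beta> = k" using assms by (auto simp: leaves_def)
  \<comment> \<open>Levels are numbered from 1, list positions from 0.\<close>
  have tk: "take j \<alpha> = take j \<beta> \<longleftrightarrow> (\<forall>l. 1 \<le> l \<and> l \<le> j \<longrightarrow> \<alpha> ! (l - 1) = \<beta> ! (l - 1))" if "j \<le> k" for j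
  proof -
    have "take j \<alpha> = take j \<beta> \<longleftrightarrow> (\<forall>i<j. \<alpha> ! i = \<beta> ! i)"
      using len that by (auto simp: list_eq_iff_nth_eq)
    also have "\<dots> \<longleftrightarrow> (\<forall>l. 1 \<le> l \<and> l \<le> j \<longrightarrow> \<alpha> ! (l - 1) = \<beta> ! (l - 1))"
    proof (intro iffI allI impI)
      fix i assume *: "\<forall>l. 1 \<le> l \<and> l \<le> j \<longrightarrow> \<alpha> ! (l - 1) = \<beta> ! (l - 1)" and "i < j"
      then show "\<alpha> ! i = \<beta> ! i" using *[rule_format, of "Suc i"] by simp
    next
      fix l assume "\<forall>i<j. \<alpha> ! i = \<beta> ! i" "1 \<le> l \<and> l \<le> j"
      moreover from this have "l - 1 < j" by linarith
      ultimately show "\<alpha> ! (l - 1) = \<beta> ! (l - 1)" by blast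
    qed
    finally show ?thesis .
  qed
  show ?thesis
  proof (cases "\<alpha> = \<beta>")
    case True then show ?thesis using assms by (simp add: split_level_def)
  next
    case False
    let ?P = "\<lambda>l. 1 \<le> l \<and> \<alpha> ! (l - 1) \<noteq> \<beta> ! (l - 1)"
    have ex: "\<exists>l. ?P l" using False tk[of k] len by auto
    have "Least ?P = r \<longleftrightarrow> ?P r \<and> (\<forall>l<r. \<not> ?P l)"
    proof
      assume "Least ?P = r"
      then show "?P r \<and> (\<forall>l<r. \<not> ?P l)" using LeastI_ex[OF ex] not_less_Least[of _ ?P] by blast
    next
      assume "?P r \<and> (\<forall>l<r. \<not> ?P l)"
      then show "Least ?P = r" by (intro Least_equality) (auto simp: not_less[symmetric])
    qed
    then have "split_level k \<alpha> \<beta> = r \<longleftrightarrow> ?P r \<and> (\<forall>l<r. \<not> ?P l)"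
      using False by (simp add: split_level_def)
    also have "\<dots> \<longleftrightarrow> take (r - 1) \<alpha> = take (r - 1) \<beta> \<and> take r \<alpha> \<noteq> take r \<beta>"
    proof -
      have "(\<forall>l. 1 \<le> l \<and> l \<le> r - 1 \<longrightarrow> \<alpha> ! (l - 1) = \<beta> ! (l - 1)) \<longleftrightarrow> (\<forall>l<r. \<not> ?P l)"
        using assms by (auto simp: less_eq_Suc_le le_diff_conv2)
      moreover have "(\<forall>l. 1 \<le> l \<and> l \<le> r \<longrightarrow> \<alpha> ! (l - 1) = \<beta> ! (l - 1)) \<longleftrightarrow> (\<forall>l<r. \<not> ?P l) \<and> \<not> ?P r"
        using assms by (auto simp: le_less)
      ultimately show ?thesis using tk[of r] tk[of "r - 1"] assms by auto
    qed
    finally show ?thesis .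
  qed
qed

text \<open>Finite point masses make the factors sigma-finite, and countability makes every subset
  measurable in the product.\<close>

lemma emeasure_pair_point_measure:
  assumes A: "countable A" and X: "X \<subseteq> A \<times> A" and g: "\<And>x. x \<in> A \<Longrightarrow> g x < \<top>"
  shows "emeasure (point_measure A g \<Otimes>\<^sub>M point_measure A g) X =
    (\<integral>\<^sup>+x. \<integral>\<^sup>+y. g x * g y * indicator X (x, y) \<partial>count_space A \<partial>count_space A)"
proof -
  interpret C: sigma_finite_measure "count_space A" by (rule sigma_finite_measure_count_space_countable[OF A])
  interpret P: sigma_finite_measure "point_measure A g"
    unfolding point_measure_def
    using g by (subst C.sigma_finite_iff_density_finite) (auto simp: AE_count_space less_top)
  have sets: "sets (point_measure A g \<Otimes>\<^sub>M point_measure A g) = sets (count_space (A \<times> A))"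
  proof -
    have "sets (point_measure A g \<Otimes>\<^sub>M point_measure A g) = sets (count_space A \<Otimes>\<^sub>M count_space A)"
      by (intro sets_pair_measure_cong sets_point_measure_count_space)
    then show ?thesis by (simp only: pair_measure_countable[OF A A])
  qed
  have "emeasure (point_measure A g \<Otimes>\<^sub>M point_measure A g) X =
      (\<integral>\<^sup>+x. \<integral>\<^sup>+y. indicator X (x, y) \<partial>point_measure A g \<partial>point_measure A g)"
    using X by (intro P.emeasure_pair_measure) (simp add: sets)
  also have "\<dots> = (\<integral>\<^sup>+x. g x * (\<integral>\<^sup>+y. g y * indicator X (x, y) \<partial>count_space A) \<partial>count_space A)"
    unfolding point_measure_def by (subst (1 2) nn_integral_density) auto
  finally show ?thesis by (simp add: nn_integral_cmult mult.assoc)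
qed

lemma measure_pair_eq_replica_average:
  "replica_average \<Gamma> (\<lambda>x. of_bool (P x)) = measure (\<Gamma> \<Otimes>\<^sub>M \<Gamma>) {x \<in> space (\<Gamma> \<Otimes>\<^sub>M \<Gamma>). P x}"
proof -
  have "replica_average \<Gamma> (\<lambda>x. of_bool (P x)) = (\<integral>x. indicator {x. P x} x \<partial>(\<Gamma> \<Otimes>\<^sub>M \<Gamma>))"
    by (simp add: replica_average_def indicator_def)
  also have "\<dots> = measure (\<Gamma> \<Otimes>\<^sub>M \<Gamma>) ({x. P x} \<inter> space (\<Gamma> \<Otimes>\<^sub>M \<Gamma>))"
    by simp
  also have "{x. P x} \<inter> space (\<Gamma> \<Otimes>\<^sub>M \<Gamma>) = {x \<in> space (\<Gamma> \<Otimes>\<^sub>M \<Gamma>). P x}" by auto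
  finally show ?thesis .
qed

section \<open>The concrete model\<close>

text \<open>Completing the square: the tilt by \<open>exp (c * x)\<close> moves the mean to
  \<open>c * s\<close> and leaves the factor \<open>exp (c^2 * s / 2)\<close>.\<close>

lemma nn_integral_normal_law_exp:
  "(\<integral>\<^sup>+x. ennreal (exp (c * x)) \<partial>normal_law 0 v) < \<top>"
proof (cases "v = 0")
  case True
  then show ?thesis by (simp add: normal_law_def nn_integral_return)
next
  case False
  \<comment> \<open>The density depends on \<open>sqrt v\<close> through its square, which is
    \<open>\<bar>v\<bar>\<close> for either sign of \<open>v\<close>.\<close>
  define s where "s = \<bar>v\<bar>"
  have s: "0 < s" "(sqrt v)\<^sup>2 = s" using False by (auto simp: s_def real_sqrt_abs2 power2_eq_square)
  interpret P: prob_space "density lborel (normal_density (c * s) (sqrt s))"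
    using s by (intro prob_space_normal_density) simp
  have nd: "normal_density 0 (sqrt v) x * exp (c * x) = exp (c\<^sup>2 * s / 2) * normal_density (c * s) (sqrt s) x" for x
  proof -
    have "- (x - 0)\<^sup>2 / (2 * s) + c * x = c\<^sup>2 * s / 2 + (- (x - c * s)\<^sup>2 / (2 * s))"
      using s(1) by (simp add: field_simps power2_eq_square)
    then show ?thesis
      using s by (simp add: normal_density_def mult_exp_exp mult.left_commute)
  qed
  have "(\<integral>\<^sup>+x. ennreal (exp (c * x)) \<partial>normal_law 0 v) =
      (\<integral>\<^sup>+x. ennreal (normal_density 0 (sqrt v) x) * ennreal (exp (c * x)) \<partial>lborel)"
    using False by (simp add: normal_law_def nn_integral_density)
  also have "\<dots> = (\<integral>\<^sup>+x. ennreal (exp (c\<^sup>2 * s / 2)) * ennreal (normal_density (c * s) (sqrt s) x) \<partial>lborel)"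
    by (simp only: nd ennreal_mult''[symmetric] exp_ge_zero) (simp add: ennreal_mult)
  also have "\<dots> = ennreal (exp (c\<^sup>2 * s / 2)) * emeasure (density lborel (normal_density (c * s) (sqrt s))) UNIV"
    by (subst nn_integral_cmult) (auto simp: emeasure_density)
  also have "\<dots> < \<top>"
    using P.emeasure_space_1 by simp
  finally show ?thesis .
qed

lemma prob_space_normal_law: "prob_space (normal_law 0 v)"
proof (cases "v = 0")
  case True then show ?thesis by (simp add: normal_law_def prob_space_return)
next
  case False
  then have "normal_density 0 (sqrt v) = normal_density 0 (sqrt \<bar>v\<bar>)"
    by (auto simp: fun_eq_iff normal_density_def power2_eq_square real_sqrt_abs2)
  then show ?thesis
    using False by (simp add: normal_law_def prob_space_normal_density)
qed

lemma sets_normal_law [measurable_cong]: "sets (normal_law 0 v) = sets borel"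
  by (simp add: normal_law_def)

lemma sets_generated_events:
  "sets (sigma (space M) {X i -` A \<inter> space M | i A. i \<in> T \<and> A \<in> sets borel}) = generated_events M T X"
  unfolding generated_events_def by (rule sets_measure_of) auto

text \<open>Realizing \<open>generated_events\<close> as the sigma-algebra of a measure space lets
  ordinary measurability rules show that an event belongs to it.\<close>

lemma generated_events_measurable:
  fixes M :: "'w measure" and X :: "'i \<Rightarrow> 'w \<Rightarrow> real" and T :: "'i set"
  defines "S \<equiv> sigma (space M) {X i -` A \<inter> space M | i A. i \<in> T \<and> A \<in> sets borel}"
  shows "space S = space M" "sets S = generated_events M T X" "i \<in> T \<Longrightarrow> X i \<in> borel_measurable S"
proof -
  show sp: "space S = space M" unfolding S_def by (rule space_measure_of) auto
  show se: "sets S = generated_events M T X" unfolding S_def by (rule sets_generated_events)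
  show "X i \<in> borel_measurable S" if "i \<in> T"
    using that by (intro measurableI) (auto simp: sp se generated_events_def intro!: sigma_sets.Basic)
qed

lemma measurable_if_const:
  "(P \<Longrightarrow> f \<in> borel_measurable M) \<Longrightarrow> (\<lambda>x. if P then f x else (0::real)) \<in> borel_measurable M"
  by (cases P) auto

lemma sources_below_length:
  "Mark q \<in> sources_below n p \<Longrightarrow> length q \<le> length p + n"
  "Weights q \<in> sources_below n p \<Longrightarrow> length q < length p + n"
  "External \<notin> sources_below n p"
proof -
  have "(\<forall>q. Mark q \<in> sources_below n p \<longrightarrow> length q \<le> length p + n) \<and>
    (\<forall>q. Weights q \<in> sources_below n p \<longrightarrow> length q < length p + n) \<and> External \<notin> sources_below n p"
  proof (induction n arbitrary: p)
    case (Suc n)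
    have "length q \<le> length p + Suc n" if "Mark q \<in> sources_below (Suc n) p" for q
      using that Suc by fastforce
    moreover have "length q < length p + Suc n" if "Weights q \<in> sources_below (Suc n) p" for q
      using that Suc by fastforce
    moreover have "External \<notin> sources_below (Suc n) p" using Suc by auto
    ultimately show ?case by blast
  qed simp
  then show "Mark q \<in> sources_below n p \<Longrightarrow> length q \<le> length p + n"
    "Weights q \<in> sources_below n p \<Longrightarrow> length q < length p + n"
    "External \<notin> sources_below n p" by auto
qed

section \<open>Embedding the spin model into the tree recursion\<close>

definition embed_mark :: "nat \<Rightarrow> (nat \<Rightarrow> real) \<Rightarrow> (nat \<Rightarrow> real) state" where
  "embed_mark N x = case_sum (\<lambda>i. if i \<in> {1..N} then x i else 0) (\<lambda>_. 0)"

text \<open>Columns sit on \<open>Inl\<close> and values of \<open>H\<close> on \<open>Inr\<close>,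
  with zeros elsewhere, so that adding them up in a state keeps them apart.\<close>

fun model_data :: "nat \<Rightarrow> ((nat \<Rightarrow> real) \<Rightarrow> 'w \<Rightarrow> real) \<Rightarrow> (nat list \<Rightarrow> nat \<Rightarrow> 'w \<Rightarrow> real) \<Rightarrow>
    (nat list \<Rightarrow> 'w \<Rightarrow> real) \<Rightarrow> source \<Rightarrow> 'w \<Rightarrow> (nat \<Rightarrow> real) state" where
  "model_data N H z u (Weights p) \<omega> = case_sum (\<lambda>i. u (p @ [i]) \<omega>) (\<lambda>_. 0)"
| "model_data N H z u (Mark p) \<omega> = embed_mark N (\<lambda>i. z p i \<omega>)"
| "model_data N H z u External \<omega> = case_sum (\<lambda>_. 0) (\<lambda>\<sigma>. if \<sigma> \<in> spins N then H \<sigma> \<omega> else 0)"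

text \<open>The weight \<open>G\<close> of the recursion. Being a product over coordinates, it has
  an integral over a column that factorizes; \<open>exp x + exp (- x)\<close> dominates
  \<open>exp \<bar>x\<bar>\<close> and splits into two exponential moments. The second product is 1
  on columns.\<close>

definition growth :: "nat \<Rightarrow> (nat \<Rightarrow> real) state \<Rightarrow> real" where
  "growth N s = (\<Prod>i=1..N. exp (s (Inl i)) + exp (- s (Inl i))) * (\<Prod>\<sigma>\<in>spins N. exp \<bar>s (Inr \<sigma>)\<bar>)"

text \<open>The Boltzmann factors of a leaf in state \<open>s\<close>, summed over the spins; this
  is the function \<open>F\<close> at the leaves.\<close>

definition spin_sum :: "nat \<Rightarrow> real \<Rightarrow> (nat \<Rightarrow> real) state \<Rightarrow> real" where
  "spin_sum N t s = (\<Sum>\<sigma>\<in>spins N. exp (sqrt t * s (Inr \<sigma>) + sqrt (1 - t) * (\<Sum>i=1..N. s (Inl i) * \<sigma> i)))"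

lemma finite_spins: "finite (spins N)"
  by (simp add: spins_def finite_PiE)

lemma spins_nonempty: "spins N \<noteq> {}"
  by (simp add: spins_def PiE_eq_empty_iff)

lemma measurable_growth [measurable]: "growth N \<in> borel_measurable vec"
  unfolding growth_def[abs_def] by measurable

lemma measurable_spin_sum [measurable]: "spin_sum N t \<in> borel_measurable vec"
  unfolding spin_sum_def[abs_def] by measurable

lemma one_le_exp_sum: "1 \<le> exp x + exp (- x :: real)"
  by (cases "0 \<le> x") (auto intro: add_increasing add_increasing2)

lemma growth_ge_1: "1 \<le> growth N s"
proof -
  have "1 * 1 \<le> growth N s"
    unfolding growth_def by (intro mult_mono prod_ge_1 one_le_exp_sum) (auto intro!: prod_nonneg)
  then show ?thesis by simp
qed

text \<open>Expanding the product of two factors \<open>exp x + exp (- x)\<close> gives the two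
  terms on the left and two further positive ones.\<close>

lemma growth_vadd: "growth N (vadd s v) \<le> growth N s * growth N v"
proof -
  have "growth N (vadd s v) \<le>
      (\<Prod>i=1..N. (exp (s (Inl i)) + exp (- s (Inl i))) * (exp (v (Inl i)) + exp (- v (Inl i)))) *
      (\<Prod>\<sigma>\<in>spins N. exp \<bar>s (Inr \<sigma>)\<bar> * exp \<bar>v (Inr \<sigma>)\<bar>)"
    unfolding growth_def
  proof (intro mult_mono prod_mono conjI)
    fix i
    show "exp (vadd s v (Inl i)) + exp (- vadd s v (Inl i)) \<le>
        (exp (s (Inl i)) + exp (- s (Inl i))) * (exp (v (Inl i)) + exp (- v (Inl i)))"
      by (simp add: vadd_def algebra_simps mult_exp_exp add_nonneg_nonneg)
  next
    fix \<sigma>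
    show "exp \<bar>vadd s v (Inr \<sigma>)\<bar> \<le> exp \<bar>s (Inr \<sigma>)\<bar> * exp \<bar>v (Inr \<sigma>)\<bar>"
      by (simp add: vadd_def mult_exp_exp abs_triangle_ineq)
  qed (auto intro!: prod_nonneg)
  then show ?thesis by (simp add: growth_def prod.distrib mult_ac)
qed

lemma spin_sum_pos: "0 < spin_sum N t s"
  unfolding spin_sum_def by (intro sum_pos finite_spins spins_nonempty) simp

text \<open>Spins have absolute value 1 and both square roots are at most 1, so every exponent is
  bounded by a sum of absolute values of coordinates.\<close>

lemma spin_sum_le:
  assumes t: "0 \<le> t" "t \<le> 1"
  shows "spin_sum N t s \<le> real (card (spins N)) * growth N s"
proof -
  have "exp (sqrt t * s (Inr \<sigma>) + sqrt (1 - t) * (\<Sum>i=1..N. s (Inl i) * \<sigma> i)) \<le> growth N s"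
    if \<sigma>: "\<sigma> \<in> spins N" for \<sigma>
  proof -
    have mul: "c * y \<le> \<bar>y\<bar>" if "0 \<le> c" "c \<le> 1" for c y :: real
    proof -
      have "c * y \<le> \<bar>c * y\<bar>" by simp
      also have "\<dots> \<le> 1 * \<bar>y\<bar>" unfolding abs_mult using that by (intro mult_right_mono) auto
      finally show ?thesis by simp
    qed
    have "sqrt (1 - t) * (\<Sum>i=1..N. s (Inl i) * \<sigma> i) \<le> \<bar>\<Sum>i=1..N. s (Inl i) * \<sigma> i\<bar>"
      using t by (intro mul) auto
    also have "\<dots> \<le> (\<Sum>i=1..N. \<bar>s (Inl i) * \<sigma> i\<bar>)" by (rule sum_abs)
    also have "\<dots> = (\<Sum>i=1..N. \<bar>s (Inl i)\<bar>)"
    proof (intro sum.cong refl)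
      fix i assume "i \<in> {1..N}"
      then have "\<sigma> i = - 1 \<or> \<sigma> i = 1" using \<sigma> by (auto simp: spins_def PiE_iff)
      then show "\<bar>s (Inl i) * \<sigma> i\<bar> = \<bar>s (Inl i)\<bar>" by auto
    qed
    finally have 1: "sqrt (1 - t) * (\<Sum>i=1..N. s (Inl i) * \<sigma> i) \<le> (\<Sum>i=1..N. \<bar>s (Inl i)\<bar>)" .
    have 2: "sqrt t * s (Inr \<sigma>) \<le> (\<Sum>\<tau>\<in>spins N. \<bar>s (Inr \<tau>)\<bar>)"
      using mul[of "sqrt t" "s (Inr \<sigma>)"] t member_le_sum[OF \<sigma>, of "\<lambda>\<tau>. \<bar>s (Inr \<tau>)\<bar>"] finite_spins by force
    have "exp (sqrt t * s (Inr \<sigma>) + sqrt (1 - t) * (\<Sum>i=1..N. s (Inl i) * \<sigma> i)) \<le>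
        exp (\<Sum>i=1..N. \<bar>s (Inl i)\<bar>) * exp (\<Sum>\<tau>\<in>spins N. \<bar>s (Inr \<tau>)\<bar>)"
      using 1 2 by (simp add: mult_exp_exp)
    also have "\<dots> = (\<Prod>i=1..N. exp \<bar>s (Inl i)\<bar>) * (\<Prod>\<tau>\<in>spins N. exp \<bar>s (Inr \<tau>)\<bar>)"
      by (simp add: exp_sum finite_spins)
    also have "\<dots> \<le> growth N s"
      unfolding growth_def by (intro mult_right_mono prod_mono prod_nonneg) (auto simp: abs_if)
    finally show ?thesis .
  qed
  then show ?thesis
    unfolding spin_sum_def by (rule sum_bounded_above)
qed

locale cascade_model = prob_space M for M :: "'w measure" +
  fixes N k :: nat and m vr :: "nat \<Rightarrow> real" and H :: "(nat \<Rightarrow> real) \<Rightarrow> 'w \<Rightarrow> real"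
    and z :: "nat list \<Rightarrow> nat \<Rightarrow> 'w \<Rightarrow> real" and u :: "nat list \<Rightarrow> 'w \<Rightarrow> real"
  assumes N_pos: "1 \<le> N" and k_pos: "1 \<le> k"
    and m_0: "m 0 = 0" and m_less: "\<And>l. l < k \<Longrightarrow> m l < m (Suc l)" and m_k: "m k < 1"
    and H_meas: "\<And>\<sigma>. \<sigma> \<in> spins N \<Longrightarrow> H \<sigma> \<in> borel_measurable M"
    and cascade: "derrida_ruelle_cascade M k m u"
    and z_indep: "indep_vars (\<lambda>_. borel) (\<lambda>(p, i). z p i) ({p. length p \<le> k} \<times> {1..N})"
    and z_law: "\<And>p i. length p \<le> k \<Longrightarrow> i \<in> {1..N} \<Longrightarrow> distr M borel (z p i) = normal_law 0 (vr (length p))"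
    and sources_indep: "independent_sources M N k H z u"
begin

abbreviation D :: "source \<Rightarrow> 'w \<Rightarrow> (nat \<Rightarrow> real) state" where
  "D \<equiv> model_data N H z u"

definition mark_measure :: "nat \<Rightarrow> (nat \<Rightarrow> real) state measure" where
  "mark_measure l = distr (Pi\<^sub>M {1..N} (\<lambda>_. normal_law 0 (vr l))) vec (embed_mark N)"

text \<open>The sequence \<open>m\<close> continued by the value 1 at level \<open>k + 1\<close>,
  the exponent of the leaves.\<close>

definition exponent :: "nat \<Rightarrow> real" where
  "exponent l = (if l \<le> k then m l else 1)"

section \<open>Independence and laws of the sources in the model\<close>

lemma z_meas: "length p \<le> k \<Longrightarrow> i \<in> {1..N} \<Longrightarrow> z p i \<in> borel_measurable M"
  using z_indep by (auto simp: indep_vars_def)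

lemma u_meas: "p \<noteq> [] \<Longrightarrow> length p \<le> k \<Longrightarrow> u p \<in> borel_measurable M"
proof -
  assume p: "p \<noteq> []" "length p \<le> k"
  then obtain q i where q: "p = q @ [i]" by (cases p rule: rev_cases) auto
  then have "decreasing_poisson_enumeration M (m (Suc (length q))) (\<lambda>n. u (q @ [n]))"
    using cascade p by (simp add: derrida_ruelle_cascade_def)
  then show ?thesis
    by (simp add: q decreasing_poisson_enumeration_def poisson_process_def)
qed

lemma embed_mark_measurable: "embed_mark N \<in> measurable (Pi\<^sub>M {1..N} (\<lambda>_. borel)) vec"
proof (rule measurable_vecI)
  fix j show "(\<lambda>x. embed_mark N x j) \<in> borel_measurable (Pi\<^sub>M {1..N} (\<lambda>_. borel))"
    by (cases j) (auto simp: embed_mark_def intro!: measurable_if_const measurable_component_singleton)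
qed

lemma indep_marks: "indep_vars (\<lambda>_. vec) (\<lambda>p. D (Mark p)) {p. length p \<le> k}"
proof -
  let ?K = "\<lambda>p::nat list. {p} \<times> {1..N}"
  let ?e = "\<lambda>(p::nat list) (x :: nat list \<times> nat \<Rightarrow> real). embed_mark N (\<lambda>i. x (p, i))"
  have "indep_vars (\<lambda>p. Pi\<^sub>M (?K p) (\<lambda>_. borel)) (\<lambda>p \<omega>. restrict (\<lambda>pi. (\<lambda>(p, i). z p i) pi \<omega>) (?K p)) {p. length p \<le> k}"
    by (rule indep_vars_restrict[OF z_indep]) (auto simp: disjoint_family_on_def)
  then have "indep_vars (\<lambda>_. vec) (\<lambda>p \<omega>. ?e p (restrict (\<lambda>pi. (\<lambda>(p, i). z p i) pi \<omega>) (?K p))) {p. length p \<le> k}"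
  proof (rule indep_vars_compose2)
    fix p
    show "?e p \<in> measurable (Pi\<^sub>M (?K p) (\<lambda>_. borel)) vec"
    proof (rule measurable_vecI)
      fix j show "(\<lambda>x. ?e p x j) \<in> borel_measurable (Pi\<^sub>M (?K p) (\<lambda>_. borel))"
        by (cases j) (auto simp: embed_mark_def intro!: measurable_if_const measurable_component_singleton)
    qed
  qed
  moreover have "(\<lambda>p \<omega>. ?e p (restrict (\<lambda>pi. (\<lambda>(p, i). z p i) pi \<omega>) (?K p))) = (\<lambda>p. D (Mark p))"
    by (auto simp: embed_mark_def fun_eq_iff split: sum.split)
  ultimately show ?thesis by (simp only:)
qed

lemma indep_weights: "indep_vars (\<lambda>_. vec) (\<lambda>p. D (Weights p)) {p. length p < k}"
proof -
  have "indep_vars (\<lambda>_. Pi\<^sub>M UNIV (\<lambda>_. borel)) (\<lambda>p \<omega> n. u (p @ [n]) \<omega>) {p. length p < k}"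
    using cascade by (simp add: derrida_ruelle_cascade_def)
  moreover have "(\<lambda>x :: nat \<Rightarrow> real. case_sum x (\<lambda>_::nat \<Rightarrow> real. 0)) \<in> measurable (Pi\<^sub>M UNIV (\<lambda>_. borel)) vec"
  proof (rule measurable_vecI)
    fix j :: "nat + (nat \<Rightarrow> real)"
    show "(\<lambda>x. case_sum x (\<lambda>_. 0) j) \<in> borel_measurable (Pi\<^sub>M UNIV (\<lambda>_. borel :: real measure))"
      by (cases j) auto
  qed
  ultimately have "indep_vars (\<lambda>_. vec) (\<lambda>p \<omega>. case_sum (\<lambda>n. u (p @ [n]) \<omega>) (\<lambda>_::nat \<Rightarrow> real. 0)) {p. length p < k}"
    by (rule indep_vars_compose2[where Y="\<lambda>_ x. case_sum x (\<lambda>_. 0)"])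
  moreover have "(\<lambda>p \<omega>. case_sum (\<lambda>n. u (p @ [n]) \<omega>) (\<lambda>_. 0)) = (\<lambda>p. D (Weights p))"
    by (simp add: fun_eq_iff)
  ultimately show ?thesis by (simp only:)
qed

lemma D_measurable:
  "D External \<in> measurable M vec"
  "length p \<le> k \<Longrightarrow> D (Mark p) \<in> measurable M vec"
  "length p < k \<Longrightarrow> D (Weights p) \<in> measurable M vec"
proof -
  show "D External \<in> measurable M vec"
  proof (rule measurable_vecI)
    fix j show "(\<lambda>\<omega>. D External \<omega> j) \<in> borel_measurable M"
      by (cases j) (auto intro!: measurable_if_const H_meas)
  qed
  show "length p \<le> k \<Longrightarrow> D (Mark p) \<in> measurable M vec"
    using indep_marks by (auto simp: indep_vars_def)
  show "length p < k \<Longrightarrow> D (Weights p) \<in> measurable M vec"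
    using indep_weights by (auto simp: indep_vars_def)
qed

text \<open>Two stages: a finite family of events is grouped by kind into \<open>BH\<close>,
  \<open>Bz\<close> and \<open>Bu\<close>, whose probabilities multiply by independence of the three
  sources; then \<open>Bz\<close> and \<open>Bu\<close> factorize by independence among the marks
  and among the weights.\<close>

lemma indep_model_data:
  "indep_vars (\<lambda>_. vec) D (insert External (insert (Mark []) (sources_below k [])))"
proof -
  let ?I = "insert External (Mark ` {p. length p \<le> k} \<union> Weights ` {p. length p < k})"
  let ?gH = "generated_events M (spins N) H"
  let ?gz = "generated_events M ({p. length p \<le> k} \<times> {1..N}) (\<lambda>(p, i). z p i)"
  let ?gu = "generated_events M {p. 1 \<le> length p \<and> length p \<le> k} u"
  let ?E = "\<lambda>b. {D b -` A \<inter> space M |A. A \<in> sets vec}"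
  define SH where "SH = sigma (space M) {H i -` A \<inter> space M | i A. i \<in> spins N \<and> A \<in> sets borel}"
  define Sz where "Sz = sigma (space M) {(\<lambda>(p, i). z p i) pi -` A \<inter> space M | pi A.
      pi \<in> {p. length p \<le> k} \<times> {1..N} \<and> A \<in> sets borel}"
  define Su where "Su = sigma (space M) {u i -` A \<inter> space M | i A.
      i \<in> {p. 1 \<le> length p \<and> length p \<le> k} \<and> A \<in> sets borel}"
  note gH = generated_events_measurable[where M=M and X=H and T="spins N", folded SH_def]
  note gz = generated_events_measurable[where M=M and X="\<lambda>(p, i). z p i" and T="{p. length p \<le> k} \<times> {1..N}", folded Sz_def]
  note gu = generated_events_measurable[where M=M and X=u and T="{p. 1 \<le> length p \<and> length p \<le> k}", folded Su_def]
  have mH: "D External \<in> measurable SH vec"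
  proof (rule measurable_vecI)
    fix j show "(\<lambda>\<omega>. D External \<omega> j) \<in> borel_measurable SH"
      by (cases j) (auto intro!: measurable_if_const gH(3))
  qed
  have mz: "D (Mark p) \<in> measurable Sz vec" if "length p \<le> k" for p
  proof (rule measurable_vecI)
    fix j show "(\<lambda>\<omega>. D (Mark p) \<omega> j) \<in> borel_measurable Sz"
      using gz(3)[of "(p, _)"] that by (cases j) (auto simp: embed_mark_def intro!: measurable_if_const)
  qed
  have mu: "D (Weights p) \<in> measurable Su vec" if "length p < k" for p
  proof (rule measurable_vecI)
    fix j show "(\<lambda>\<omega>. D (Weights p) \<omega> j) \<in> borel_measurable Su"
      using that by (cases j) (auto intro: gu(3))
  qed
  have "indep_sets ?E ?I"
  proof (rule indep_setsI)
    show "?E b \<subseteq> events" if "b \<in> ?I" for b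
      using that D_measurable by (auto intro: measurable_sets)
  next
    fix A J assume J: "J \<noteq> {}" "J \<subseteq> ?I" "finite J" "\<forall>j\<in>J. A j \<in> ?E j"
    define Jz where "Jz = {p. Mark p \<in> J}"
    define Ju where "Ju = {p. Weights p \<in> J}"
    have fin: "finite Jz" "finite Ju"
      unfolding Jz_def Ju_def using J(3) by (auto intro!: finite_inverse_image inj_onI)
    \<comment> \<open>The three events are cut out of \<open>space M\<close> by conditions, so that
      an absent kind gives the whole space instead of an empty intersection.\<close>
    define BH where "BH = {\<omega> \<in> space M. External \<in> J \<longrightarrow> \<omega> \<in> A External}"
    define Bz where "Bz = {\<omega> \<in> space M. \<forall>p\<in>Jz. \<omega> \<in> A (Mark p)}"
    define Bu where "Bu = {\<omega> \<in> space M. \<forall>p\<in>Ju. \<omega> \<in> A (Weights p)}"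
    have AH: "A External \<in> sets SH" if "External \<in> J"
      using J(4) that measurable_sets[OF mH] by (auto simp: gH(1))
    have Az: "A (Mark p) \<in> sets Sz" "length p \<le> k" if "p \<in> Jz" for p
    proof -
      show "length p \<le> k" using J(2) that by (auto simp: Jz_def)
      then show "A (Mark p) \<in> sets Sz" using J(4) that measurable_sets[OF mz] by (fastforce simp: gz(1) Jz_def)
    qed
    have Au: "A (Weights p) \<in> sets Su" "length p < k" if "p \<in> Ju" for p
    proof -
      show "length p < k" using J(2) that by (auto simp: Ju_def)
      then show "A (Weights p) \<in> sets Su" using J(4) that measurable_sets[OF mu] by (fastforce simp: gu(1) Ju_def)
    qed
    have BH: "BH \<in> ?gH"
    proof -
      have "BH = (if External \<in> J then A External else space SH)"
        using AH sets.sets_into_space[of "A External" SH] by (auto simp: BH_def gH(1))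
      then have "BH \<in> sets SH" using AH by auto
      then show ?thesis by (simp add: gH(2))
    qed
    have Bz: "Bz \<in> ?gz"
    proof -
      have "{\<omega> \<in> space Sz. \<forall>p\<in>Jz. \<omega> \<in> A (Mark p)} \<in> sets Sz"
        using Az(1) by (intro sets.sets_Collect_finite_All fin)
          (auto simp: Collect_conj_eq Int_absorb1 sets.sets_into_space)
      then show ?thesis by (simp add: Bz_def gz(1,2))
    qed
    have Bu: "Bu \<in> ?gu"
    proof -
      have "{\<omega> \<in> space Su. \<forall>p\<in>Ju. \<omega> \<in> A (Weights p)} \<in> sets Su"
        using Au(1) by (intro sets.sets_Collect_finite_All fin)
          (auto simp: Collect_conj_eq Int_absorb1 sets.sets_into_space)
      then show ?thesis by (simp add: Bu_def gu(1,2))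
    qed
    \<comment> \<open>The order of the list is that of the three families of events in
      \<open>independent_sources\<close>.\<close>
    have "prob (\<Inter>j\<in>{0, 1, 2}. [BH, Bz, Bu] ! j) = (\<Prod>j\<in>{0, 1, 2}. prob ([BH, Bz, Bu] ! j))"
      using sources_indep BH Bz Bu unfolding independent_sources_def
      by (intro indep_setsD) auto
    then have three: "prob (BH \<inter> Bz \<inter> Bu) = prob BH * prob Bz * prob Bu"
      by (simp add: Int_assoc mult.assoc)
    have pz: "prob Bz = (\<Prod>p\<in>Jz. prob (A (Mark p)))"
    proof (cases "Jz = {}")
      case True then show ?thesis by (simp add: Bz_def prob_space)
    next
      case False
      have "prob (\<Inter>p\<in>Jz. A (Mark p)) = (\<Prod>p\<in>Jz. prob (A (Mark p)))"
      proof (rule indep_setsD[OF conjunct2[OF indep_marks[unfolded indep_vars_def2]] _ False fin(1)])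
        show "Jz \<subseteq> {p. length p \<le> k}" using Az(2) by auto
        show "\<forall>p\<in>Jz. A (Mark p) \<in> {D (Mark p) -` A \<inter> space M |A. A \<in> sets vec}"
          using J(4) by (auto simp: Jz_def)
      qed
      moreover have "Bz = (\<Inter>p\<in>Jz. A (Mark p))"
        using False J(4) by (fastforce simp: Bz_def Jz_def)
      ultimately show ?thesis by simp
    qed
    have pu: "prob Bu = (\<Prod>p\<in>Ju. prob (A (Weights p)))"
    proof (cases "Ju = {}")
      case True then show ?thesis by (simp add: Bu_def prob_space)
    next
      case False
      have "prob (\<Inter>p\<in>Ju. A (Weights p)) = (\<Prod>p\<in>Ju. prob (A (Weights p)))"
      proof (rule indep_setsD[OF conjunct2[OF indep_weights[unfolded indep_vars_def2]] _ False fin(2)])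
        show "Ju \<subseteq> {p. length p < k}" using Au(2) by auto
        show "\<forall>p\<in>Ju. A (Weights p) \<in> {D (Weights p) -` A \<inter> space M |A. A \<in> sets vec}"
          using J(4) by (auto simp: Ju_def)
      qed
      moreover have "Bu = (\<Inter>p\<in>Ju. A (Weights p))"
        using False J(4) by (fastforce simp: Bu_def Ju_def)
      ultimately show ?thesis by simp
    qed
    have JU: "J = (J \<inter> {External}) \<union> (Mark ` Jz \<union> Weights ` Ju)"
      using J(2) by (auto simp: Jz_def Ju_def)
    have MW: "(\<Prod>j\<in>Mark ` Jz \<union> Weights ` Ju. prob (A j)) =
        (\<Prod>j\<in>Mark ` Jz. prob (A j)) * (\<Prod>j\<in>Weights ` Ju. prob (A j))"
      using fin by (intro prod.union_disjoint) auto
    have "(\<Prod>j\<in>J. prob (A j)) = (\<Prod>j\<in>(J \<inter> {External}) \<union> (Mark ` Jz \<union> Weights ` Ju). prob (A j))"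
      by (rule arg_cong[OF JU])
    also have "\<dots> = (\<Prod>j\<in>J \<inter> {External}. prob (A j)) * (\<Prod>j\<in>Mark ` Jz \<union> Weights ` Ju. prob (A j))"
      using fin by (intro prod.union_disjoint) auto
    also note MW
    also have "(\<Prod>j\<in>J \<inter> {External}. prob (A j)) = prob BH"
    proof (cases "External \<in> J")
      case True
      then have "BH = A External" using J(4) by (auto simp: BH_def)
      then show ?thesis using True by simp
    qed (simp add: BH_def prob_space)
    also have "(\<Prod>j\<in>Mark ` Jz. prob (A j)) = prob Bz"
      unfolding pz by (subst prod.reindex) (auto intro: inj_onI)
    also have "(\<Prod>j\<in>Weights ` Ju. prob (A j)) = prob Bu"
      unfolding pu by (subst prod.reindex) (auto intro: inj_onI)
    finally have "(\<Prod>j\<in>J. prob (A j)) = prob (BH \<inter> Bz \<inter> Bu)"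
      using three by simp
    also have "BH \<inter> Bz \<inter> Bu = (\<Inter>j\<in>J. A j)"
    proof -
      have "A j \<subseteq> space M" if "j \<in> J" for j using J(4) that by auto
      then have e1: "\<omega> \<in> (\<Inter>j\<in>J. A j) \<longleftrightarrow> \<omega> \<in> space M \<and> (\<forall>j\<in>J. \<omega> \<in> A j)" for \<omega>
        using J(1) by auto
      have e2: "(\<forall>j\<in>J. \<omega> \<in> A j) \<longleftrightarrow>
          (External \<in> J \<longrightarrow> \<omega> \<in> A External) \<and> (\<forall>p\<in>Jz. \<omega> \<in> A (Mark p)) \<and> (\<forall>p\<in>Ju. \<omega> \<in> A (Weights p))" for \<omega>
        by (subst JU) (auto simp: Jz_def Ju_def)
      show ?thesis
        by (rule set_eqI) (unfold e1 e2, auto simp: BH_def Bz_def Bu_def)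
    qed
    finally show "prob (\<Inter>j\<in>J. A j) = (\<Prod>j\<in>J. prob (A j))" ..
  qed
  then have "indep_vars (\<lambda>_. vec) D ?I"
    using D_measurable by (auto simp: indep_vars_def2)
  then show ?thesis
  proof (rule indep_vars_subset)
    have "b \<in> ?I" if "b \<in> sources_below k []" for b
      using that sources_below_length(1,2)[of _ k "[]"] sources_below_length(3)[of k "[]"] by (cases b) auto
    then show "insert External (insert (Mark []) (sources_below k [])) \<subseteq> ?I" by auto
  qed
qed

text \<open>The entries of a column are independent with a common normal law, so the column has a
  product law, which \<open>embed_mark\<close> transports to states.\<close>

lemma distr_mark:
  assumes p: "length p \<le> k"
  shows "distr M vec (D (Mark p)) = mark_measure (length p)"
proof -
  let ?P = "Pi\<^sub>M {1..N} (\<lambda>_. borel) :: (nat \<Rightarrow> real) measure"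
  have rv: "\<And>i. i \<in> {1..N} \<Longrightarrow> z p i \<in> borel_measurable M" using p by (rule z_meas)
  have "indep_vars (\<lambda>_. borel) (z p) {1..N}"
  proof -
    have "indep_vars (\<lambda>i. Pi\<^sub>M {(p, i)} (\<lambda>_. borel))
        (\<lambda>i \<omega>. restrict (\<lambda>pi. (\<lambda>(p, i). z p i) pi \<omega>) {(p, i)}) {1..N}"
      by (rule indep_vars_restrict[OF z_indep]) (use p in \<open>auto simp: disjoint_family_on_def\<close>)
    from indep_vars_compose2[OF this, of "\<lambda>i x. x (p, i)" "\<lambda>_. borel"] show ?thesis
      by simp
  qed
  then have "distr M ?P (\<lambda>\<omega>. \<lambda>i\<in>{1..N}. z p i \<omega>) = Pi\<^sub>M {1..N} (\<lambda>i. distr M borel (z p i))"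
    using N_pos rv by (subst (asm) indep_vars_iff_distr_eq_PiM') auto
  also have "\<dots> = Pi\<^sub>M {1..N} (\<lambda>_. normal_law 0 (vr (length p)))"
    using p by (intro PiM_cong refl z_law)
  finally have eq: "distr M ?P (\<lambda>\<omega>. \<lambda>i\<in>{1..N}. z p i \<omega>) = Pi\<^sub>M {1..N} (\<lambda>_. normal_law 0 (vr (length p)))" .
  have D: "D (Mark p) = embed_mark N \<circ> (\<lambda>\<omega>. \<lambda>i\<in>{1..N}. z p i \<omega>)"
    by (auto simp: fun_eq_iff embed_mark_def split: sum.split)
  have "(\<lambda>\<omega>. \<lambda>i\<in>{1..N}. z p i \<omega>) \<in> measurable M ?P"
    by (rule measurable_restrict[OF rv])
  from distr_distr[OF embed_mark_measurable this] show ?thesis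
    unfolding mark_measure_def eq[symmetric] D by (simp only:)
qed

text \<open>On an embedded column the factors belonging to \<open>H\<close> equal 1, and the rest is
  a product of one-dimensional Gaussian integrals.\<close>

lemma growth_integral: "(\<integral>\<^sup>+s. ennreal (growth N s) \<partial>mark_measure l) < \<top>"
proof -
  let ?n = "\<lambda>_::nat. normal_law 0 (vr l)"
  interpret product_sigma_finite ?n
    by (intro product_sigma_finite.intro prob_space_imp_sigma_finite prob_space_normal_law)
  have em: "embed_mark N \<in> measurable (Pi\<^sub>M {1..N} ?n) vec"
    using embed_mark_measurable
    by (simp add: measurable_cong_sets[OF sets_PiM_cong[OF refl sets_normal_law] refl])
  have "(\<integral>\<^sup>+s. ennreal (growth N s) \<partial>mark_measure l) =
      (\<integral>\<^sup>+x. ennreal (growth N (embed_mark N x)) \<partial>Pi\<^sub>M {1..N} ?n)"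
    unfolding mark_measure_def by (rule nn_integral_distr[OF em]) measurable
  also have "\<dots> = (\<integral>\<^sup>+x. (\<Prod>i\<in>{1..N}. ennreal (exp (x i) + exp (- x i))) \<partial>Pi\<^sub>M {1..N} ?n)"
    by (intro nn_integral_cong) (simp add: growth_def embed_mark_def prod_ennreal del: ennreal_plus)
  also have "\<dots> = (\<Prod>i\<in>{1..N}. \<integral>\<^sup>+x. ennreal (exp x + exp (- x)) \<partial>normal_law 0 (vr l))"
  proof (rule product_nn_integral_prod)
    have "(\<lambda>x. ennreal (exp x + exp (- x))) \<in> borel_measurable borel" by measurable
    then show "(\<lambda>x. ennreal (exp x + exp (- x))) \<in> borel_measurable (normal_law 0 (vr l))"
      by (subst measurable_cong_sets[OF sets_normal_law refl])
  qed simp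
  also have "\<dots> < \<top>"
  proof -
    have "(\<integral>\<^sup>+x. ennreal (exp x + exp (- x)) \<partial>normal_law 0 (vr l)) =
        (\<integral>\<^sup>+x. ennreal (exp (1 * x)) + ennreal (exp (-1 * x)) \<partial>normal_law 0 (vr l))"
      by (intro nn_integral_cong) simp
    also have "\<dots> = (\<integral>\<^sup>+x. ennreal (exp (1 * x)) \<partial>normal_law 0 (vr l)) + (\<integral>\<^sup>+x. ennreal (exp (-1 * x)) \<partial>normal_law 0 (vr l))"
      by (rule nn_integral_add) (simp_all add: measurable_cong_sets[OF sets_normal_law refl])
    also have "\<dots> < \<top>"
      using nn_integral_normal_law_exp[where c=1 and v="vr l"] nn_integral_normal_law_exp[where c="-1" and v="vr l"] by simp
    finally have "(\<integral>\<^sup>+x. ennreal (exp x + exp (- x)) \<partial>normal_law 0 (vr l)) \<noteq> \<top>" by (simp only: less_top)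
    then show ?thesis unfolding less_top[symmetric] by (subst ennreal_prod_eq_top) blast
  qed
  finally show ?thesis .
qed

lemma weights_positive: "length p < k \<Longrightarrow> AE \<omega> in M. \<forall>i. 0 < u (p @ [i]) \<omega>"
  using cascade by (auto simp: derrida_ruelle_cascade_def decreasing_poisson_enumeration_def elim: eventually_mono)

text \<open>\<open>F\<close> is left general because two instances follow: the spin sum for the
  Gibbs normalization, and the constant 1 for the normalization of the cascade weights.\<close>

lemma marked_cascade:
  assumes F: "F \<in> borel_measurable vec" "\<And>s. 0 < F s" "\<And>s. F s \<le> K * growth N s" and K: "0 \<le> K"
  shows "marked_cascade M D k exponent (\<lambda>s. ennreal (F s)) (\<lambda>s. ennreal (growth N s)) mark_measure"
proof (unfold_locales)
  show "indep_vars (\<lambda>_. vec) D (insert External (insert (Mark []) (sources_below k [])))"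
    by (rule indep_model_data)
  show "(\<integral>\<^sup>+\<omega>. nexp (\<Sum>i. f (D (Weights p) \<omega> (Inl i))) \<partial>M) =
      nexp (\<integral>\<^sup>+y. 1 - nexp (f y) \<partial>stable_intensity (exponent (Suc (length p))))"
    if "length p < k" "f \<in> borel_measurable borel" for p f
  proof -
    have "poisson_process M (stable_intensity (m (Suc (length p)))) (\<lambda>n. u (p @ [n]))"
      using that(1) cascade by (simp add: derrida_ruelle_cascade_def decreasing_poisson_enumeration_def)
    from poisson_process_laplace[OF prob_space_axioms this _ that(2)] show ?thesis
      using that(1) by (simp add: exponent_def)
  qed
  show "AE \<omega> in M. \<forall>i. 0 < D (Weights p) \<omega> (Inl i)" if "length p < k" for p
    using weights_positive[OF that] by simp
  show "distr M vec (D (Mark p)) = mark_measure (length p)" if "length p \<le> k" for p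
    by (rule distr_mark[OF that])
  show "1 \<le> k" by (rule k_pos)
  show "0 < exponent 1" using k_pos m_less[of 0] by (simp add: exponent_def m_0)
  show "exponent l < exponent (Suc l)" if "1 \<le> l" "l \<le> k" for l
    using that m_less[of l] m_k by (cases "l = k") (auto simp: exponent_def)
  show "exponent (Suc k) = 1" by (simp add: exponent_def)
  show "(\<lambda>s. ennreal (F s)) \<in> borel_measurable vec" using F(1) by measurable
  show "0 < ennreal (F s)" for s using F(2) by simp
  show "(\<lambda>s. ennreal (growth N s)) \<in> borel_measurable vec" by measurable
  show "1 \<le> ennreal (growth N s)" for s using growth_ge_1 by (simp flip: ennreal_1 add: ennreal_leI)
  show "ennreal (growth N s) < \<top>" for s by simp
  show "ennreal (growth N (vadd s v)) \<le> ennreal (growth N s) * ennreal (growth N v)" for s v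
    using growth_vadd[of N s v] growth_ge_1[of N s] by (simp add: ennreal_mult'[symmetric] ennreal_leI)
  show "(\<integral>\<^sup>+v. ennreal (growth N v) \<partial>mark_measure l) < \<top>" for l by (rule growth_integral)
  show "\<exists>K\<ge>0. \<forall>s. ennreal (F s) \<le> ennreal K * ennreal (growth N s)"
    using F(3) K by (intro exI[of _ K]) (simp add: ennreal_mult'[symmetric] ennreal_leI)
qed

end

section \<open>The Gibbs measure\<close>

lemma nn_integral_finite_times:
  assumes "finite S" "countable L"
  shows "(\<integral>\<^sup>+x. h x \<partial>count_space (S \<times> L)) = (\<integral>\<^sup>+\<alpha>. (\<Sum>\<sigma>\<in>S. h (\<sigma>, \<alpha>)) \<partial>count_space L)"
proof -
  interpret L: sigma_finite_measure "count_space L"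
    by (rule sigma_finite_measure_count_space_countable[OF assms(2)])
  have S: "countable S" using assms(1) by (rule countable_finite)
  have "(\<integral>\<^sup>+x. h x \<partial>count_space (S \<times> L)) = (\<integral>\<^sup>+x. h x \<partial>(count_space S \<Otimes>\<^sub>M count_space L))"
    by (simp add: pair_measure_countable S assms)
  also have "\<dots> = (\<integral>\<^sup>+\<sigma>. \<integral>\<^sup>+\<alpha>. h (\<sigma>, \<alpha>) \<partial>count_space L \<partial>count_space S)"
    by (rule L.nn_integral_fst[symmetric]) (simp add: pair_measure_countable S assms)
  also have "\<dots> = (\<Sum>\<sigma>\<in>S. \<integral>\<^sup>+\<alpha>. h (\<sigma>, \<alpha>) \<partial>count_space L)"
    by (rule nn_integral_count_space_finite[OF assms(1)])
  also have "\<dots> = (\<integral>\<^sup>+\<alpha>. (\<Sum>\<sigma>\<in>S. h (\<sigma>, \<alpha>)) \<partial>count_space L)"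
    by (rule nn_integral_sum[symmetric]) simp
  finally show ?thesis .
qed

text \<open>The factor \<open>b\<close> depends on the leaves alone, so the spins are summed out
  first; \<open>c\<close> is the reciprocal normalization, occurring once per replica.\<close>

lemma nn_integral_pairs_ratio:
  fixes e :: "'a \<times> 'b \<Rightarrow> ennreal" and b :: "'b \<Rightarrow> 'b \<Rightarrow> ennreal"
  assumes "finite S" "countable L" and g: "\<And>\<alpha>. \<alpha> \<in> L \<Longrightarrow> g \<alpha> = (\<Sum>\<sigma>\<in>S. e (\<sigma>, \<alpha>))"
  shows "(\<integral>\<^sup>+x. \<integral>\<^sup>+y. e x * c * (e y * c) * b (snd x) (snd y) \<partial>count_space (S \<times> L) \<partial>count_space (S \<times> L)) =
    (\<integral>\<^sup>+\<alpha>. \<integral>\<^sup>+\<beta>. g \<alpha> * g \<beta> * b \<alpha> \<beta> \<partial>count_space L \<partial>count_space L) * (c * c)"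
proof -
  have inner: "(\<integral>\<^sup>+y. e x * c * (e y * c) * b (snd x) (snd y) \<partial>count_space (S \<times> L)) =
      e x * ((c * c) * (\<integral>\<^sup>+\<beta>. g \<beta> * b (snd x) \<beta> \<partial>count_space L))" for x
  proof -
    have "(\<integral>\<^sup>+y. e x * c * (e y * c) * b (snd x) (snd y) \<partial>count_space (S \<times> L)) =
        (\<integral>\<^sup>+y. e x * (c * c) * (e y * b (snd x) (snd y)) \<partial>count_space (S \<times> L))"
      by (intro nn_integral_cong) (simp add: mult_ac)
    also have "\<dots> = e x * (c * c) * (\<integral>\<^sup>+y. e y * b (snd x) (snd y) \<partial>count_space (S \<times> L))"
      by (rule nn_integral_cmult) simp
    also have "(\<integral>\<^sup>+y. e y * b (snd x) (snd y) \<partial>count_space (S \<times> L)) = (\<integral>\<^sup>+\<beta>. g \<beta> * b (snd x) \<beta> \<partial>count_space L)"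
      unfolding nn_integral_finite_times[OF assms(1,2)]
      by (intro nn_integral_cong) (simp add: g sum_distrib_right)
    finally show ?thesis by (simp add: mult.assoc)
  qed
  have "(\<integral>\<^sup>+x. e x * ((c * c) * (\<integral>\<^sup>+\<beta>. g \<beta> * b (snd x) \<beta> \<partial>count_space L)) \<partial>count_space (S \<times> L)) =
      (\<integral>\<^sup>+\<alpha>. g \<alpha> * ((c * c) * (\<integral>\<^sup>+\<beta>. g \<beta> * b \<alpha> \<beta> \<partial>count_space L)) \<partial>count_space L)"
    unfolding nn_integral_finite_times[OF assms(1,2)]
    by (intro nn_integral_cong) (simp add: g sum_distrib_right)
  also have "\<dots> = (\<integral>\<^sup>+\<alpha>. (c * c) * (\<integral>\<^sup>+\<beta>. g \<alpha> * g \<beta> * b \<alpha> \<beta> \<partial>count_space L) \<partial>count_space L)"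
    by (intro nn_integral_cong) (simp add: nn_integral_cmult mult.assoc mult.left_commute)
  finally show ?thesis unfolding inner by (simp add: nn_integral_cmult mult.commute)
qed

context cascade_model
begin

abbreviation energy :: "real \<Rightarrow> 'w \<Rightarrow> (nat \<Rightarrow> real) \<Rightarrow> nat list \<Rightarrow> real" where
  "energy t \<omega> \<equiv> hamiltonian N k t (\<lambda>\<sigma>. H \<sigma> \<omega>) (\<lambda>p i. z p i \<omega>)"

abbreviation weight :: "real \<Rightarrow> 'w \<Rightarrow> (nat \<Rightarrow> real) \<times> nat list \<Rightarrow> real" where
  "weight t \<omega> \<equiv> gibbs_weight N k t (\<lambda>\<sigma>. H \<sigma> \<omega>) (\<lambda>p i. z p i \<omega>) (\<lambda>p. u p \<omega>)"

abbreviation path_product :: "'w \<Rightarrow> nat list \<Rightarrow> real" where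
  "path_product \<omega> \<equiv> cascade_product k (\<lambda>p. u p \<omega>)"

definition gibbs_mass :: "real \<Rightarrow> 'w \<Rightarrow> (nat \<Rightarrow> real) \<times> nat list \<Rightarrow> ennreal" where
  "gibbs_mass t \<omega> x = ennreal (weight t \<omega> x / infsum (weight t \<omega>) (spins N \<times> leaves k))"

lemma countable_configurations: "countable (spins N \<times> leaves k)"
  by (intro countable_SIGMA countable_finite finite_spins countable_leaves)

lemma leaf_measurable:
  assumes "\<alpha> \<in> leaves k"
  shows "(\<lambda>\<omega>. path_product \<omega> \<alpha>) \<in> borel_measurable M"
    and "\<sigma> \<in> spins N \<Longrightarrow> (\<lambda>\<omega>. energy t \<omega> \<sigma> \<alpha>) \<in> borel_measurable M"
proof -
  have len: "length \<alpha> = k" using assms by (simp add: leaves_def)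
  have "(\<lambda>\<omega>. u (take l \<alpha>) \<omega>) \<in> borel_measurable M" if "l \<in> {1..k}" for l
    using that len k_pos by (intro u_meas) auto
  then show "(\<lambda>\<omega>. path_product \<omega> \<alpha>) \<in> borel_measurable M"
    unfolding cascade_product_def by (intro borel_measurable_prod)
  have "(\<lambda>\<omega>. z (take l \<alpha>) i \<omega>) \<in> borel_measurable M" if "i \<in> {1..N}" for l i
    using that len by (intro z_meas) auto
  then show "(\<lambda>\<omega>. energy t \<omega> \<sigma> \<alpha>) \<in> borel_measurable M" if "\<sigma> \<in> spins N"
    unfolding hamiltonian_def leaf_field_def
    by (intro borel_measurable_add borel_measurable_times borel_measurable_const borel_measurable_sum H_meas that)
qed

text \<open>As \<open>M\<close> need not be complete, measurability has to hold also where the sums diverge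
  (there \<open>infsum\<close> is 0).\<close>

lemma gibbs_mass_measurable:
  assumes "x \<in> spins N \<times> leaves k"
  shows "(\<lambda>\<omega>. gibbs_mass t \<omega> x) \<in> borel_measurable M"
proof -
  have sum: "(\<lambda>\<omega>. infsum (path_product \<omega>) (leaves k)) \<in> borel_measurable M"
    by (rule measurable_infsum_real[OF countable_leaves leaf_measurable(1)])
  have w: "(\<lambda>\<omega>. weight t \<omega> x) \<in> borel_measurable M" if x_in: "x \<in> spins N \<times> leaves k" for x
  proof -
    obtain \<sigma> \<alpha> where x: "x = (\<sigma>, \<alpha>)" "\<sigma> \<in> spins N" "\<alpha> \<in> leaves k" using x_in by auto
    note [measurable] = sum leaf_measurable(1)[OF x(3)] leaf_measurable(2)[OF x(3,2), of t]
    show ?thesis unfolding gibbs_weight_def x cascade_weight_def by simp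
  qed
  note [measurable] = w[OF assms] measurable_infsum_real[OF countable_configurations w]
  show ?thesis unfolding gibbs_mass_def by measurable
qed

text \<open>This links the recursion to the definitions of the model: along the path of \<alpha> the
  weights multiply to \<open>v_\<alpha>\<close>, and the marks, together with the root state, add up
  to the arguments of the Hamiltonian.\<close>

lemma leaf_mass_model:
  assumes \<alpha>: "\<alpha> \<in> leaves k" and pos: "\<And>p i. length p < k \<Longrightarrow> 0 < u (p @ [i]) \<omega>"
  shows "0 < path_product \<omega> \<alpha>"
    and "leaf_mass F (\<lambda>b. D b \<omega>) [] s \<alpha> = ennreal (path_product \<omega> \<alpha>) * F (path_state (\<lambda>b. D b \<omega>) [] s \<alpha>)"
    and "spin_sum N t (path_state (\<lambda>b. D b \<omega>) [] (vadd (D (Mark []) \<omega>) (D External \<omega>)) \<alpha>) =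
      (\<Sum>\<sigma>\<in>spins N. exp (energy t \<omega> \<sigma> \<alpha>))"
proof -
  have len: "length \<alpha> = k" using \<alpha> by (simp add: leaves_def)
  \<comment> \<open>Points are stored at the parent \<open>take l \<alpha>\<close>, which shifts the
    index range \<open>{1..k}\<close> to \<open>{..<k}\<close>.\<close>
  have tk: "take l \<alpha> @ [\<alpha> ! l] = take (Suc l) \<alpha>" if "l < k" for l
    using that len by (simp add: take_Suc_conv_app_nth)
  have prod: "(\<Prod>l<k. u (take l \<alpha> @ [\<alpha> ! l]) \<omega>) = path_product \<omega> \<alpha>"
    using prod.atLeast1_atMost_eq[of "\<lambda>l. u (take l \<alpha>) \<omega>" k] by (simp add: cascade_product_def tk)
  have "0 < (\<Prod>l<k. u (take l \<alpha> @ [\<alpha> ! l]) \<omega>)"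
    using len by (intro prod_pos) (auto intro!: pos)
  then show "0 < path_product \<omega> \<alpha>" by (simp only: prod)
  have "path_weight (\<lambda>b. D b \<omega>) [] \<alpha> = ennreal (\<Prod>l<length \<alpha>. D (Weights ([] @ take l \<alpha>)) \<omega> (Inl (\<alpha> ! l)))"
    by (rule path_weight_eq_prod) (use len pos in \<open>auto intro!: less_imp_le\<close>)
  then have "path_weight (\<lambda>b. D b \<omega>) [] \<alpha> = ennreal (path_product \<omega> \<alpha>)"
    by (simp add: len prod)
  then show "leaf_mass F (\<lambda>b. D b \<omega>) [] s \<alpha> = ennreal (path_product \<omega> \<alpha>) * F (path_state (\<lambda>b. D b \<omega>) [] s \<alpha>)"
    by (simp add: leaf_mass_def)
  let ?s = "path_state (\<lambda>b. D b \<omega>) [] (vadd (D (Mark []) \<omega>) (D External \<omega>)) \<alpha>"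
  \<comment> \<open>The term \<open>l = 0\<close> of \<open>leaf_field\<close> is the root column,
    which enters through the starting state.\<close>
  have l: "?s (Inl i) = leaf_field k (\<lambda>p i. z p i \<omega>) \<alpha> i" if "i \<in> {1..N}" for i
    using that by (simp add: path_state_eq_sum vadd_def embed_mark_def leaf_field_def len sum.atLeast_Suc_atMost)
  have r: "?s (Inr \<sigma>) = H \<sigma> \<omega>" if "\<sigma> \<in> spins N" for \<sigma>
    using that by (simp add: path_state_eq_sum vadd_def embed_mark_def)
  show "spin_sum N t ?s = (\<Sum>\<sigma>\<in>spins N. exp (energy t \<omega> \<sigma> \<alpha>))"
    unfolding spin_sum_def hamiltonian_def
  proof (intro sum.cong refl)
    fix \<sigma> assume \<sigma>: "\<sigma> \<in> spins N"
    have "(\<Sum>i=1..N. ?s (Inl i) * \<sigma> i) = (\<Sum>i=1..N. leaf_field k (\<lambda>p i. z p i \<omega>) \<alpha> i * \<sigma> i)"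
      by (intro sum.cong refl) (simp only: l)
    then show "exp (sqrt t * ?s (Inr \<sigma>) + sqrt (1 - t) * (\<Sum>i=1..N. ?s (Inl i) * \<sigma> i)) =
        exp (sqrt t * H \<sigma> \<omega> + sqrt (1 - t) * (\<Sum>i=1..N. leaf_field k (\<lambda>p i. z p i \<omega>) \<alpha> i * \<sigma> i))"
      by (simp only: r[OF \<sigma>])
  qed
qed

context
  fixes t :: real
  assumes t: "0 \<le> t" "t \<le> 1"
begin

interpretation C: marked_cascade M D k exponent "\<lambda>s. ennreal (spin_sum N t s)" "\<lambda>s. ennreal (growth N s)" mark_measure
  by (rule marked_cascade[OF measurable_spin_sum spin_sum_pos spin_sum_le[OF t]]) simp

text \<open>With leaf function 1 the partition function is the sum of all \<open>v_\<gamma>\<close>;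
  its almost sure finiteness makes the denominator of \<open>cascade_weight\<close> a genuine sum
  rather than a default value of \<open>infsum\<close>.\<close>

interpretation U: marked_cascade M D k exponent "\<lambda>s. ennreal 1" "\<lambda>s. ennreal (growth N s)" mark_measure
  by (rule marked_cascade[where F="\<lambda>_. 1" and K=1]) (simp_all add: growth_ge_1)

abbreviation total :: "'w \<Rightarrow> ennreal" where
  "total \<omega> \<equiv> C.Z k [] (C.root_state \<omega>) \<omega>"

text \<open>Where both sums are finite and positive, \<open>infsum\<close> agrees with the sum in
  \<open>ennreal\<close>, and the normalization of the cascade weights cancels between numerator and
  denominator.\<close>

lemma AE_gibbs_mass:
  "AE \<omega> in M. 0 < total \<omega> \<and> total \<omega> < \<top> \<and>
    (\<forall>\<alpha>\<in>leaves k. leaf_mass (\<lambda>s. ennreal (spin_sum N t s)) (\<lambda>b. D b \<omega>) [] (C.root_state \<omega>) \<alpha> =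
      (\<Sum>\<sigma>\<in>spins N. ennreal (path_product \<omega> \<alpha> * exp (energy t \<omega> \<sigma> \<alpha>)))) \<and>
    (\<forall>\<sigma>\<in>spins N. \<forall>\<alpha>\<in>leaves k. gibbs_mass t \<omega> (\<sigma>, \<alpha>) =
      ennreal (path_product \<omega> \<alpha> * exp (energy t \<omega> \<sigma> \<alpha>)) * inverse (total \<omega>))"
proof -
  have "AE \<omega> in M. \<forall>p. length p < k \<longrightarrow> (\<forall>i. 0 < u (p @ [i]) \<omega>)"
    using weights_positive by (subst AE_all_countable) auto
  then show ?thesis
    using C.AE_Z_root_finite C.AE_Z_pos U.AE_Z_root_finite U.AE_Z_pos
  proof eventually_elim
    case (elim \<omega>)
    let ?d = "\<lambda>b. D b \<omega>" and ?w = "\<lambda>(\<sigma>, \<alpha>). path_product \<omega> \<alpha> * exp (energy t \<omega> \<sigma> \<alpha>)"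
    have pos: "\<And>p i. length p < k \<Longrightarrow> 0 < u (p @ [i]) \<omega>" using elim(1) by blast
    note lm = leaf_mass_model[OF _ pos]
    obtain zr where zr: "total \<omega> = ennreal zr" "0 < zr"
      using elim(2) elim(3)[rule_format, of "C.root_state \<omega>"] by (cases "total \<omega>") auto
    \<comment> \<open>From here on \<open>vr\<close> is the value of the cascade sum and hides the
      variances of the same name.\<close>
    obtain vr where vr: "U.Z k [] (U.root_state \<omega>) \<omega> = ennreal vr" "0 < vr"
      using elim(4) elim(5)[rule_format, of "U.root_state \<omega>"] by (cases "U.Z k [] (U.root_state \<omega>) \<omega>") auto
    have mass: "leaf_mass (\<lambda>s. ennreal (spin_sum N t s)) ?d [] (C.root_state \<omega>) \<alpha> =
        (\<Sum>\<sigma>\<in>spins N. ennreal (?w (\<sigma>, \<alpha>)))" if \<alpha>: "\<alpha> \<in> leaves k" for \<alpha>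
    proof -
      have "leaf_mass (\<lambda>s. ennreal (spin_sum N t s)) ?d [] (C.root_state \<omega>) \<alpha> =
          ennreal (path_product \<omega> \<alpha>) * ennreal (\<Sum>\<sigma>\<in>spins N. exp (energy t \<omega> \<sigma> \<alpha>))"
        using leaf_mass_model(2)[OF \<alpha> pos, where F="\<lambda>s. ennreal (spin_sum N t s)" and s="C.root_state \<omega>"]
          leaf_mass_model(3)[OF \<alpha> pos]
        by (simp only: C.root_state_def)
      also have "\<dots> = ennreal (\<Sum>\<sigma>\<in>spins N. ?w (\<sigma>, \<alpha>))"
        using lm(1)[OF \<alpha>] by (subst ennreal_mult'[symmetric]) (simp_all add: sum_distrib_left)
      also have "\<dots> = (\<Sum>\<sigma>\<in>spins N. ennreal (?w (\<sigma>, \<alpha>)))"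
        using lm(1)[OF \<alpha>] by (intro sum_ennreal[symmetric]) simp
      finally show ?thesis .
    qed
    have "(\<integral>\<^sup>+\<alpha>. ennreal (path_product \<omega> \<alpha>) \<partial>count_space (leaves k)) = ennreal vr"
      unfolding vr(1)[symmetric] partition_fun_eq by (intro nn_integral_cong) (simp add: lm(2))
    moreover from this have "ennreal (infsum (path_product \<omega>) (leaves k)) =
        (\<integral>\<^sup>+\<alpha>. ennreal (path_product \<omega> \<alpha>) \<partial>count_space (leaves k))"
      by (intro ennreal_infsum) (auto intro: less_imp_le lm(1))
    moreover have "0 \<le> infsum (path_product \<omega>) (leaves k)"
      by (intro infsum_nonneg less_imp_le lm(1))
    ultimately have V: "infsum (path_product \<omega>) (leaves k) = vr" using vr by simp
    have weight: "weight t \<omega> x = ?w x / vr" for x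
      by (simp add: gibbs_weight_def cascade_weight_def V split: prod.split)
    have wpos: "0 \<le> ?w x" if "x \<in> spins N \<times> leaves k" for x
      using that lm(1) by (auto intro!: mult_nonneg_nonneg less_imp_le)
    have "(\<integral>\<^sup>+x. ennreal (weight t \<omega> x) \<partial>count_space (spins N \<times> leaves k)) =
        (\<integral>\<^sup>+x. ennreal (?w x) * ennreal (1 / vr) \<partial>count_space (spins N \<times> leaves k))"
      using vr(2) by (intro nn_integral_cong) (simp add: weight ennreal_mult''[symmetric] split_beta')
    also have "\<dots> = (\<integral>\<^sup>+x. ennreal (?w x) \<partial>count_space (spins N \<times> leaves k)) * ennreal (1 / vr)"
      by (rule nn_integral_multc) simp
    also have "(\<integral>\<^sup>+x. ennreal (?w x) \<partial>count_space (spins N \<times> leaves k)) = total \<omega>"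
      unfolding nn_integral_finite_times[OF finite_spins countable_leaves] partition_fun_eq
      by (intro nn_integral_cong) (simp add: mass)
    also have "total \<omega> * ennreal (1 / vr) = ennreal (zr / vr)"
      using zr vr by (simp add: ennreal_mult''[symmetric])
    finally have nn: "(\<integral>\<^sup>+x. ennreal (weight t \<omega> x) \<partial>count_space (spins N \<times> leaves k)) = ennreal (zr / vr)" .
    have w0: "0 \<le> weight t \<omega> x" if "x \<in> spins N \<times> leaves k" for x
      unfolding weight using wpos[OF that] vr by (intro divide_nonneg_nonneg) auto
    have "ennreal (infsum (weight t \<omega>) (spins N \<times> leaves k)) = ennreal (zr / vr)"
      unfolding nn[symmetric] by (intro ennreal_infsum w0) (simp_all add: nn)
    moreover have "0 \<le> infsum (weight t \<omega>) (spins N \<times> leaves k)" by (intro infsum_nonneg w0)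
    ultimately have W: "infsum (weight t \<omega>) (spins N \<times> leaves k) = zr / vr"
      using zr vr by simp
    have "gibbs_mass t \<omega> (\<sigma>, \<alpha>) = ennreal (?w (\<sigma>, \<alpha>)) * inverse (total \<omega>)" for \<sigma> \<alpha>
    proof -
      have "weight t \<omega> (\<sigma>, \<alpha>) / (zr / vr) = ?w (\<sigma>, \<alpha>) * inverse zr"
        using zr vr unfolding weight by (simp add: field_simps)
      then have "gibbs_mass t \<omega> (\<sigma>, \<alpha>) = ennreal (?w (\<sigma>, \<alpha>) * inverse zr)"
        by (simp only: gibbs_mass_def W)
      also have "\<dots> = ennreal (?w (\<sigma>, \<alpha>)) * ennreal (inverse zr)"
        using zr by (intro ennreal_mult'') simp
      finally show ?thesis using zr by (simp add: inverse_ennreal)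
    qed
    then show ?case using mass elim(2,3) by simp
  qed
qed

text \<open>The mass that two replicas give to agreement of the leaves up to level \<open>J\<close>,
  as a double sum in \<open>ennreal\<close> that can be added and integrated freely.\<close>

definition same_block :: "nat \<Rightarrow> 'w \<Rightarrow> ennreal" where
  "same_block J \<omega> = (\<integral>\<^sup>+x. \<integral>\<^sup>+y. gibbs_mass t \<omega> x * gibbs_mass t \<omega> y *
      of_bool (take J (snd x) = take J (snd y)) \<partial>count_space (spins N \<times> leaves k) \<partial>count_space (spins N \<times> leaves k))"

lemma pair_measurable:
  "(\<lambda>\<omega>. \<integral>\<^sup>+x. \<integral>\<^sup>+y. gibbs_mass t \<omega> x * gibbs_mass t \<omega> y * h x y
      \<partial>count_space (spins N \<times> leaves k) \<partial>count_space (spins N \<times> leaves k)) \<in> borel_measurable M"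
  by (intro measurable_nn_integral_count_space countable_configurations borel_measurable_times_ennreal
      gibbs_mass_measurable borel_measurable_const)

text \<open>Almost surely this is the ratio of the square sum and the squared partition function at
  the root, whose expectation is known for \<open>J \<ge> 1\<close>. For \<open>J = 0\<close> the
  condition is void and the ratio is 1, in accordance with \<open>m 0 = 0\<close>.\<close>

lemma nn_integral_same_block:
  assumes J: "J \<le> k"
  shows "(\<integral>\<^sup>+\<omega>. same_block J \<omega> \<partial>M) = ennreal (1 - m J)"
proof -
  have "AE \<omega> in M. same_block J \<omega> = C.Y J k [] (C.root_state \<omega>) \<omega> / (total \<omega>)\<^sup>2 \<and> 0 < total \<omega> \<and> total \<omega> < \<top>"
    using AE_gibbs_mass
  proof eventually_elim
    case (elim \<omega>)
    let ?e = "\<lambda>x. ennreal (path_product \<omega> (snd x) * exp (energy t \<omega> (fst x) (snd x)))"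
    obtain zr where zr: "total \<omega> = ennreal zr" "0 < zr"
      using elim by (cases "total \<omega>") auto
    have "same_block J \<omega> = (\<integral>\<^sup>+x. \<integral>\<^sup>+y. ?e x * inverse (total \<omega>) * (?e y * inverse (total \<omega>)) *
      of_bool (take J (snd x) = take J (snd y)) \<partial>count_space (spins N \<times> leaves k) \<partial>count_space (spins N \<times> leaves k))"
      unfolding same_block_def using elim by (intro nn_integral_cong) auto
    also have "\<dots> = C.Y J k [] (C.root_state \<omega>) \<omega> * (inverse (total \<omega>) * inverse (total \<omega>))"
      unfolding square_sum_eq[OF J]
      by (rule nn_integral_pairs_ratio[OF finite_spins countable_leaves]) (use elim in simp)
    also have "inverse (total \<omega>) * inverse (total \<omega>) = inverse ((total \<omega>)\<^sup>2)"
      using zr by (simp add: inverse_ennreal ennreal_mult[symmetric] ennreal_power power2_eq_square)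
    finally show ?case using elim by (simp add: divide_ennreal_def)
  qed
  note AE = this
  show ?thesis
  proof (cases "J = 0")
    case True
    have "AE \<omega> in M. same_block J \<omega> = 1"
      using AE
    proof eventually_elim
      case (elim \<omega>)
      then obtain zr where zr: "total \<omega> = ennreal zr" "0 < zr" by (cases "total \<omega>") auto
      then show ?case using elim True by (simp add: ennreal_power divide_ennreal)
    qed
    then have "(\<integral>\<^sup>+\<omega>. same_block J \<omega> \<partial>M) = (\<integral>\<^sup>+\<omega>. 1 \<partial>M)" by (rule nn_integral_cong_AE)
    then show ?thesis using True by (simp add: m_0 emeasure_space_1)
  next
    case False
    then have "(\<integral>\<^sup>+\<omega>. same_block J \<omega> \<partial>M) = (\<integral>\<^sup>+\<omega>. C.Y J k [] (C.root_state \<omega>) \<omega> / (total \<omega>)\<^sup>2 \<partial>M)"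
      using AE by (intro nn_integral_cong_AE) (auto elim: eventually_mono)
    also have "\<dots> = ennreal (1 - exponent J)"
      using False J by (intro C.expectation_square_ratio_root) auto
    finally show ?thesis using J by (simp add: exponent_def)
  qed
qed

lemma m_less_1: "J \<le> k \<Longrightarrow> m J < 1"
proof -
  assume "J \<le> k"
  then have "m J \<le> m k"
    by (induction J rule: inc_induct) (auto intro: order_trans[OF less_imp_le[OF m_less]])
  then show ?thesis using m_k by simp
qed

text \<open>For pairs of leaves, splitting at \<open>r\<close> and agreeing up to \<open>r\<close>
  exclude each other and together mean agreeing up to \<open>r - 1\<close>. The masses are related
  by addition; subtraction takes place only after integration, where all values are finite.\<close>

lemma expectation_split_level:
  assumes r: "1 \<le> r" "r \<le> k"
  defines "\<Gamma> \<equiv> \<lambda>\<omega>. gibbs_measure N k t (\<lambda>\<sigma>. H \<sigma> \<omega>) (\<lambda>p i. z p i \<omega>) (\<lambda>p. u p \<omega>)"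
  shows "expectation (\<lambda>\<omega>. measure (\<Gamma> \<omega> \<Otimes>\<^sub>M \<Gamma> \<omega>)
      {x \<in> space (\<Gamma> \<omega> \<Otimes>\<^sub>M \<Gamma> \<omega>). split_level k (snd (fst x)) (snd (snd x)) = r}) = m r - m (r - 1)"
proof -
  let ?A = "spins N \<times> leaves k"
  let ?C = "count_space ?A"
  have \<Gamma>: "\<Gamma> \<omega> = point_measure ?A (gibbs_mass t \<omega>)" for \<omega>
    by (simp add: \<Gamma>_def gibbs_measure_def gibbs_mass_def[abs_def])
  define X where "X = {x \<in> ?A \<times> ?A. split_level k (snd (fst x)) (snd (snd x)) = r}"
  define E where "E \<omega> = (\<integral>\<^sup>+x. \<integral>\<^sup>+y. gibbs_mass t \<omega> x * gibbs_mass t \<omega> y * indicator X (x, y) \<partial>?C \<partial>?C)" for \<omega>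
  have set: "{x \<in> space (\<Gamma> \<omega> \<Otimes>\<^sub>M \<Gamma> \<omega>). split_level k (snd (fst x)) (snd (snd x)) = r} = X" for \<omega>
    by (simp add: X_def \<Gamma> space_pair_measure space_point_measure)
  have meas: "measure (\<Gamma> \<omega> \<Otimes>\<^sub>M \<Gamma> \<omega>) X = enn2real (E \<omega>)" for \<omega>
    unfolding measure_def \<Gamma> E_def
    by (subst emeasure_pair_point_measure[OF countable_configurations]) (auto simp: X_def gibbs_mass_def)
  have Em: "E \<in> borel_measurable M" unfolding E_def[abs_def] by (rule pair_measurable)
  have Sm: "same_block r \<in> borel_measurable M" unfolding same_block_def[abs_def] by (rule pair_measurable)
  have split: "E \<omega> + same_block r \<omega> = same_block (r - 1) \<omega>" for \<omega>
  proof -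
    let ?g = "\<lambda>x y. gibbs_mass t \<omega> x * gibbs_mass t \<omega> y"
    have "E \<omega> + same_block r \<omega> = (\<integral>\<^sup>+x. (\<integral>\<^sup>+y. ?g x y * indicator X (x, y) \<partial>?C) +
        (\<integral>\<^sup>+y. ?g x y * of_bool (take r (snd x) = take r (snd y)) \<partial>?C) \<partial>?C)"
      unfolding E_def same_block_def by (rule nn_integral_add[symmetric]) simp_all
    also have "\<dots> = (\<integral>\<^sup>+x. \<integral>\<^sup>+y. ?g x y * indicator X (x, y) + ?g x y * of_bool (take r (snd x) = take r (snd y)) \<partial>?C \<partial>?C)"
      by (intro nn_integral_cong nn_integral_add[symmetric]) simp_all
    also have "\<dots> = same_block (r - 1) \<omega>"
      unfolding same_block_def
    proof (intro nn_integral_cong)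
      fix x y assume "x \<in> space ?C" "y \<in> space ?C"
      then have xy: "x \<in> ?A" "y \<in> ?A" by simp_all
      then have l: "snd x \<in> leaves k" "snd y \<in> leaves k" by auto
      have "take (r - 1) (snd x) = take (r - 1) (snd y)" if "take r (snd x) = take r (snd y)"
        using arg_cong[OF that, of "take (r - 1)"] by simp
      then have "indicator X (x, y) + of_bool (take r (snd x) = take r (snd y)) =
          (of_bool (take (r - 1) (snd x) = take (r - 1) (snd y)) :: ennreal)"
        using xy split_level_eq[OF l r] by (auto simp: X_def indicator_def)
      then show "?g x y * indicator X (x, y) + ?g x y * of_bool (take r (snd x) = take r (snd y)) =
          ?g x y * of_bool (take (r - 1) (snd x) = take (r - 1) (snd y))"
        by (simp only: distrib_left[symmetric])
    qed
    finally show ?thesis .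
  qed
  have mr: "m r < 1" "m (r - 1) < m r" using r m_less_1[of r] m_less[of "r - 1"] by auto
  have "(\<integral>\<^sup>+\<omega>. E \<omega> \<partial>M) + ennreal (1 - m r) = ennreal (1 - m (r - 1))"
  proof -
    have "(\<integral>\<^sup>+\<omega>. E \<omega> \<partial>M) + (\<integral>\<^sup>+\<omega>. same_block r \<omega> \<partial>M) = (\<integral>\<^sup>+\<omega>. E \<omega> + same_block r \<omega> \<partial>M)"
      by (rule nn_integral_add[symmetric, OF Em Sm])
    then show ?thesis using r by (simp add: split nn_integral_same_block)
  qed
  then have EI: "(\<integral>\<^sup>+\<omega>. E \<omega> \<partial>M) = ennreal (m r - m (r - 1))"
    using mr by (cases "\<integral>\<^sup>+\<omega>. E \<omega> \<partial>M") (auto simp: ennreal_plus[symmetric] simp del: ennreal_plus)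
  \<comment> \<open>A finite expectation makes \<open>E \<omega>\<close> finite almost surely, so
    \<open>enn2real\<close> in the definition of \<open>measure\<close> loses nothing.\<close>
  have "AE \<omega> in M. E \<omega> \<noteq> \<infinity>"
    by (rule nn_integral_PInf_AE[OF Em]) (simp add: EI)
  then have "AE \<omega> in M. ennreal (enn2real (E \<omega>)) = E \<omega>"
    by eventually_elim (simp add: less_top)
  then have "(\<integral>\<^sup>+\<omega>. ennreal (enn2real (E \<omega>)) \<partial>M) = ennreal (m r - m (r - 1))"
    unfolding EI[symmetric] by (rule nn_integral_cong_AE)
  then have "expectation (\<lambda>\<omega>. enn2real (E \<omega>)) = m r - m (r - 1)"
    using Em mr by (subst integral_eq_nn_integral) auto
  then show ?thesis by (simp only: set meas)
qed

end

end

theorem theorem3: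
  fixes M :: "'w measure"
    and N k r :: nat
    and t :: real
    and \<xi> :: "real \<Rightarrow> real"
    and m q :: "nat \<Rightarrow> real"
    and H :: "(nat \<Rightarrow> real) \<Rightarrow> 'w \<Rightarrow> real"
    and z :: "nat list \<Rightarrow> nat \<Rightarrow> 'w \<Rightarrow> real"
    and u :: "nat list \<Rightarrow> 'w \<Rightarrow> real"
    and \<Gamma> :: "'w \<Rightarrow> ((nat \<Rightarrow> real) \<times> nat list) measure"
  assumes "prob_space M"
    and "N \<ge> 1" and "k \<ge> 1"
    and "smooth_fun \<xi>" and "convex_on UNIV \<xi>" and "\<xi> 0 = 0"
    and "m 0 = 0" and "\<forall>l<k. m l < m (Suc l)" and "m k < 1"
    and "q 0 = 0" and "\<forall>l\<le>k. q l < q (Suc l)" and "q (Suc k) = 1"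
    and "centered_gaussian_process M (spins N) H"
    and "\<forall>\<sigma>\<in>spins N. \<forall>\<tau>\<in>spins N.
           prob_space.expectation M (\<lambda>\<omega>. H \<sigma> \<omega> * H \<tau> \<omega>) = real N * \<xi> (overlap N \<sigma> \<tau>)"
    and "derrida_ruelle_cascade M k m u"
    and "gaussian_columns M N k \<xi> q z"
    and "independent_sources M N k H z u"
    and "1 \<le> r" and "r \<le> k"
    and "0 \<le> t" and "t \<le> 1"
    and "\<And>\<omega>. \<Gamma> \<omega> = gibbs_measure N k t (\<lambda>\<sigma>. H \<sigma> \<omega>) (\<lambda>p i. z p i \<omega>) (\<lambda>p. u p \<omega>)"
  shows "prob_space.expectation M (\<lambda>\<omega>. replica_average (\<Gamma> \<omega>)
             (\<lambda>((\<sigma>1, \<alpha>), (\<sigma>2, \<beta>)). of_bool (split_level k \<alpha> \<beta> = r)))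
           = prob_space.expectation M (\<lambda>\<omega>. measure (\<Gamma> \<omega> \<Otimes>\<^sub>M \<Gamma> \<omega>)
               {((\<sigma>1, \<alpha>), (\<sigma>2, \<beta>)) \<in> space (\<Gamma> \<omega> \<Otimes>\<^sub>M \<Gamma> \<omega>). split_level k \<alpha> \<beta> = r})
         \<and> prob_space.expectation M (\<lambda>\<omega>. measure (\<Gamma> \<omega> \<Otimes>\<^sub>M \<Gamma> \<omega>)
               {((\<sigma>1, \<alpha>), (\<sigma>2, \<beta>)) \<in> space (\<Gamma> \<omega> \<Otimes>\<^sub>M \<Gamma> \<omega>). split_level k \<alpha> \<beta> = r})
           = m r - m (r - 1)"
proof -
  interpret prob_space M by fact
  interpret cascade_model M N k m "\<lambda>l. deriv \<xi> (q (Suc l)) - deriv \<xi> (q l)" H z u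
  proof unfold_locales
    show "H \<sigma> \<in> borel_measurable M" if "\<sigma> \<in> spins N" for \<sigma>
      using assms(13) that by (simp add: centered_gaussian_process_def)
    show "indep_vars (\<lambda>_. borel) (\<lambda>(p, i). z p i) ({p. length p \<le> k} \<times> {1..N})"
      using assms(16) by (simp add: gaussian_columns_def)
    show "distr M borel (z p i) = normal_law 0 (deriv \<xi> (q (Suc (length p))) - deriv \<xi> (q (length p)))"
      if "length p \<le> k" "i \<in> {1..N}" for p i
      using assms(16) that by (simp add: gaussian_columns_def)
  qed (use assms in auto)
  let ?P = "\<lambda>x. split_level k (snd (fst x)) (snd (snd x)) = r"
  have set: "{((\<sigma>1, \<alpha>), (\<sigma>2, \<beta>)) \<in> space (\<Gamma> \<omega> \<Otimes>\<^sub>M \<Gamma> \<omega>). split_level k \<alpha> \<beta> = r} =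
      {x \<in> space (\<Gamma> \<omega> \<Otimes>\<^sub>M \<Gamma> \<omega>). ?P x}" for \<omega>
    by (simp add: split_beta')
  have fn: "(\<lambda>((\<sigma>1, \<alpha>), (\<sigma>2, \<beta>)). of_bool (split_level k \<alpha> \<beta> = r)) =
      (\<lambda>x :: ((nat \<Rightarrow> real) \<times> nat list) \<times> ((nat \<Rightarrow> real) \<times> nat list). of_bool (?P x) :: real)"
    by (simp add: split_beta')
  have "expectation (\<lambda>\<omega>. measure (\<Gamma> \<omega> \<Otimes>\<^sub>M \<Gamma> \<omega>) {x \<in> space (\<Gamma> \<omega> \<Otimes>\<^sub>M \<Gamma> \<omega>). ?P x}) = m r - m (r - 1)"
    unfolding assms(22) using assms by (intro expectation_split_level)
  then show ?thesis
    unfolding set fn measure_pair_eq_replica_average by simp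
qed

end
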